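(* Let $K$ be a field and let $\mathcal{C}$ be a finite, non-empty, weakly connected collection of cells in $\mathbb{Z}^2$, with adjacent $2$-minor ideal $I_{\mathrm{adj}}(\mathcal{C})\subset S_{\mathcal{C}}=K[x_v\mid v\in V(\mathcal{C})]$. If $I_{\mathrm{adj}}(\mathcal{C})$ satisfies the following equivalent conditions: (1) $I_{\mathrm{adj}}(\mathcal{C})$ is a complete intersection; (2) $S_{\mathcal{C}}/I_{\mathrm{adj}}(\mathcal{C})$ is Gorenstein; (3) $S_{\mathcal{C}}/I_{\mathrm{adj}}(\mathcal{C})$ is level; (4) $S_{\mathcal{C}}/I_{\mathrm{adj}}(\mathcal{C})$ is Cohen--Macaulay; (5) $I_{\mathrm{adj}}(\mathcal{C})$ is unmixed; then $\mathcal{C}$ does not contain an $X$-pentomino.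
   Context: A cell of $\mathbb{Z}^2$ is a set $C=[a,b]=\{a,b,c,d\}$ with $a=(i,j)$, $b=a+(1,1)$, $c=(i,j+1)$, $d=(i+1,j)$; $a,b$ are its diagonal corners, $c,d$ its anti-diagonal corners, $V(C)=\{a,b,c,d\}$ its vertices, and $\{a,c\},\{c,b\},\{b,d\},\{a,d\}$ its edges. For a set $\mathcal{C}$ of cells, $V(\mathcal{C})=\bigcup_{C\in\mathcal{C}}V(C)$. $\mathcal{C}$ is weakly connected if any two cells of $\mathcal{C}$ can be joined by a sequence of cells of $\mathcal{C}$ in which consecutive cells share an edge or a vertex. $I_{\mathrm{adj}}(\mathcal{C})$ is the ideal of $S_{\mathcal{C}}$ generated by the adjacent $2$-minors $x_ax_b-x_cx_d$, one for each cell of $\mathcal{C}$ (with diagonal corners $a,b$ and anti-diagonal corners $c,d$). An $X$-pentomino is a set of five cells consisting of a cell together with its four edge-neighbours; $\mathcal{C}$ contains it if these five cells all belong to $\mathcal{C}$. An ideal is called unmixed if all its minimal primes have the same height. A standard graded Cohen--Macaulay $K$-algebra is level if its canonical module is generated in a single degree. The five listed conditions are equivalent for every weakly connected collection of cells. *)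

theory Defs
  imports
    "HOL-Library.Poly_Mapping"
    "HOL-Library.Extended_Nat"
    "HOL-Library.FuncSet"
    "HOL-Algebra.QuotRing"
    "HOL-Algebra.Module"
    "HOL-Algebra.Ring_Divisibility"
begin

section \<open>Collections of cells\<close>

text \<open>A cell is identified with the set of its four vertices; its lower left (diagonal)
  corner, and hence all of its corners, can be recovered from that set. The vertex set of
  a collection \<open>\<C>\<close> is therefore \<open>\<Union>\<C>\<close>.\<close>

definition cell :: "int \<Rightarrow> int \<Rightarrow> (int \<times> int) set" where
  "cell i j = {(i, j), (i + 1, j + 1), (i, j + 1), (i + 1, j)}"

definition cells :: "(int \<times> int) set set" where
  "cells = {cell i j | i j. True}"

definition cell_edges :: "(int \<times> int) set \<Rightarrow> (int \<times> int) set set" where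
  "cell_edges C = {e. \<exists>i j. C = cell i j \<and>
     e \<in> {{(i, j), (i, j + 1)}, {(i, j + 1), (i + 1, j + 1)},
          {(i + 1, j + 1), (i + 1, j)}, {(i, j), (i + 1, j)}}}"

definition weakly_connected :: "(int \<times> int) set set \<Rightarrow> bool" where
  "weakly_connected \<C> \<longleftrightarrow> (\<forall>C\<in>\<C>. \<forall>D\<in>\<C>. \<exists>Cs. Cs \<noteq> [] \<and> hd Cs = C \<and> last Cs = D \<and> set Cs \<subseteq> \<C> \<and>
     successively (\<lambda>A B. cell_edges A \<inter> cell_edges B \<noteq> {} \<or> A \<inter> B \<noteq> {}) Cs)"

definition x_pentomino :: "int \<Rightarrow> int \<Rightarrow> (int \<times> int) set set" where
  "x_pentomino i j = {cell i j, cell (i + 1) j, cell (i - 1) j, cell i (j + 1), cell i (j - 1)}"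

definition contains_x_pentomino :: "(int \<times> int) set set \<Rightarrow> bool" where
  "contains_x_pentomino \<C> \<longleftrightarrow> (\<exists>i j. x_pentomino i j \<subseteq> \<C>)"


section \<open>Polynomial rings and the adjacent 2-minor ideal\<close>

text \<open>Monomials are finitely supported exponent functions, polynomials are finitely supported
  coefficient functions on monomials. The ring \<open>K[x\<^sub>v | v \<in> V]\<close> consists of the polynomials all
  of whose monomials involve only variables from \<open>V\<close>.\<close>

type_synonym ('v, 'k) mpoly = "('v \<Rightarrow>\<^sub>0 nat) \<Rightarrow>\<^sub>0 'k"

definition mpoly_ring :: "'v set \<Rightarrow> ('v, 'k::field) mpoly ring" where
  "mpoly_ring V = \<lparr>carrier = {p. \<forall>m\<in>Poly_Mapping.keys p. Poly_Mapping.keys m \<subseteq> V},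
     mult = (*), one = 1, zero = 0, add = (+)\<rparr>"

definition mvar :: "'v \<Rightarrow> ('v, 'k::field) mpoly" where
  "mvar v = Poly_Mapping.single (Poly_Mapping.single v 1) 1"

definition adjacent_minor :: "int \<Rightarrow> int \<Rightarrow> (int \<times> int, 'k::field) mpoly" where
  "adjacent_minor i j = mvar (i, j) * mvar (i + 1, j + 1) - mvar (i, j + 1) * mvar (i + 1, j)"

definition I_adj :: "(int \<times> int) set set \<Rightarrow> (int \<times> int, 'k::field) mpoly set" where
  "I_adj \<C> = Idl\<^bsub>mpoly_ring (\<Union>\<C>)\<^esub> {adjacent_minor i j | i j. cell i j \<in> \<C>}"

definition mono_degree :: "('v \<Rightarrow>\<^sub>0 nat) \<Rightarrow> nat" where
  "mono_degree m = (\<Sum>v\<in>Poly_Mapping.keys m. Poly_Mapping.lookup m v)"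

text \<open>The graded piece of degree \<open>k\<close>; it is \<open>{0}\<close> for negative \<open>k\<close>.\<close>

definition homog :: "'v set \<Rightarrow> int \<Rightarrow> ('v, 'k::field) mpoly set" where
  "homog V k = {p \<in> carrier (mpoly_ring V). \<forall>m\<in>Poly_Mapping.keys p. int (mono_degree m) = k}"


section \<open>Height, unmixedness, regular sequences, Cohen-Macaulay rings\<close>

definition prime_height :: "('a, 'b) ring_scheme \<Rightarrow> 'a set \<Rightarrow> enat" where
  "prime_height R P = Sup {enat n | n. \<exists>p. (\<forall>i\<le>n. primeideal (p i) R) \<and>
     (\<forall>i<n. p i \<subset> p (Suc i)) \<and> p n = P}"

definition krull_dim :: "('a, 'b) ring_scheme \<Rightarrow> enat" where
  "krull_dim R = Sup {prime_height R P | P. primeideal P R}"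

definition minimal_prime :: "('a, 'b) ring_scheme \<Rightarrow> 'a set \<Rightarrow> 'a set \<Rightarrow> bool" where
  "minimal_prime R I P \<longleftrightarrow> primeideal P R \<and> I \<subseteq> P \<and>
     (\<forall>Q. primeideal Q R \<and> I \<subseteq> Q \<and> Q \<subseteq> P \<longrightarrow> Q = P)"

definition unmixed :: "('a, 'b) ring_scheme \<Rightarrow> 'a set \<Rightarrow> bool" where
  "unmixed R I \<longleftrightarrow>
     (\<forall>P Q. minimal_prime R I P \<and> minimal_prime R I Q \<longrightarrow> prime_height R P = prime_height R Q)"

definition regular_sequence :: "('a, 'b) ring_scheme \<Rightarrow> 'a list \<Rightarrow> bool" where
  "regular_sequence R xs \<longleftrightarrow> set xs \<subseteq> carrier R \<and> Idl\<^bsub>R\<^esub> (set xs) \<noteq> carrier R \<and>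
     (\<forall>i<length xs. \<forall>r\<in>carrier R.
        xs ! i \<otimes>\<^bsub>R\<^esub> r \<in> Idl\<^bsub>R\<^esub> (set (take i xs)) \<longrightarrow> r \<in> Idl\<^bsub>R\<^esub> (set (take i xs)))"

definition complete_intersection :: "('a, 'b) ring_scheme \<Rightarrow> 'a set \<Rightarrow> bool" where
  "complete_intersection R I \<longleftrightarrow> (\<exists>xs. regular_sequence R xs \<and> I = Idl\<^bsub>R\<^esub> (set xs))"

definition ideal_depth :: "('a, 'b) ring_scheme \<Rightarrow> 'a set \<Rightarrow> enat" where
  "ideal_depth R P = Sup {enat (length xs) | xs. set xs \<subseteq> P \<and> regular_sequence R xs}"

text \<open>For a Noetherian ring and a maximal ideal \<open>P\<close>, depth and height of \<open>P\<close> are the depth and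
  the dimension of the localization at \<open>P\<close>, so this is Cohen-Macaulayness of all localizations.\<close>

definition cohen_macaulay :: "('a, 'b) ring_scheme \<Rightarrow> bool" where
  "cohen_macaulay R \<longleftrightarrow> cring R \<and> noetherian_ring R \<and>
     (\<forall>P. maximalideal P R \<longrightarrow> ideal_depth R P = prime_height R P)"


section \<open>Modules\<close>

text \<open>Module records extend ring records; the components \<open>mult\<close> and \<open>one\<close> carry no meaning
  for modules.\<close>

definition free_module :: "('a, 'b) ring_scheme \<Rightarrow> nat \<Rightarrow> ('a, nat \<Rightarrow> 'a) module" where
  "free_module R b = \<lparr>carrier = {..<b} \<rightarrow>\<^sub>E carrier R, mult = undefined, one = undefined,
     zero = (\<lambda>j\<in>{..<b}. \<zero>\<^bsub>R\<^esub>), add = (\<lambda>u v. \<lambda>j\<in>{..<b}. u j \<oplus>\<^bsub>R\<^esub> v j),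
     smult = (\<lambda>r u. \<lambda>j\<in>{..<b}. r \<otimes>\<^bsub>R\<^esub> u j)\<rparr>"

definition self_module :: "('a, 'b) ring_scheme \<Rightarrow> ('a, 'a) module" where
  "self_module R = \<lparr>carrier = carrier R, mult = mult R, one = \<one>\<^bsub>R\<^esub>, zero = \<zero>\<^bsub>R\<^esub>, add = add R,
     smult = mult R\<rparr>"

definition quotient_module :: "('a, 'm, 'b) module_scheme \<Rightarrow> 'm set \<Rightarrow> ('a, 'm set) module" where
  "quotient_module M N = \<lparr>carrier = a_rcosets\<^bsub>M\<^esub> N, mult = undefined, one = undefined,
     zero = N, add = set_add M, smult = (\<lambda>r X. \<Union>x\<in>X. N +>\<^bsub>M\<^esub> (r \<odot>\<^bsub>M\<^esub> x))\<rparr>"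

definition generates_module ::
  "('a, 'b) ring_scheme \<Rightarrow> ('a, 'm, 'c) module_scheme \<Rightarrow> 'm set \<Rightarrow> bool" where
  "generates_module R M X \<longleftrightarrow> \<Inter>{N. submodule N R M \<and> X \<subseteq> N} = carrier M"

definition module_iso :: "('a, 'b) ring_scheme \<Rightarrow> ('a, 'm, 'c) module_scheme \<Rightarrow>
    ('a, 'n, 'd) module_scheme \<Rightarrow> ('m \<Rightarrow> 'n) \<Rightarrow> bool" where
  "module_iso R M N f \<longleftrightarrow> bij_betw f (carrier M) (carrier N) \<and>
     (\<forall>x\<in>carrier M. \<forall>y\<in>carrier M. f (x \<oplus>\<^bsub>M\<^esub> y) = f x \<oplus>\<^bsub>N\<^esub> f y) \<and>
     (\<forall>r\<in>carrier R. \<forall>x\<in>carrier M. f (r \<odot>\<^bsub>M\<^esub> x) = r \<odot>\<^bsub>N\<^esub> f x)"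

text \<open>The linear map \<open>R\<^sup>b \<rightarrow> R\<^sup>c\<close> given by a \<open>c \<times> b\<close> matrix.\<close>

definition mat_map ::
  "('a, 'b) ring_scheme \<Rightarrow> nat \<Rightarrow> nat \<Rightarrow> (nat \<Rightarrow> nat \<Rightarrow> 'a) \<Rightarrow> (nat \<Rightarrow> 'a) \<Rightarrow> (nat \<Rightarrow> 'a)" where
  "mat_map R b c A u = (\<lambda>k\<in>{..<c}. \<Oplus>\<^bsub>R\<^esub>j\<in>{..<b}. A k j \<otimes>\<^bsub>R\<^esub> u j)"


section \<open>The canonical module; Gorenstein and level algebras\<close>

text \<open>Let \<open>S = K[x\<^sub>v | v \<in> V]\<close> with \<open>V\<close> finite, \<open>n = |V|\<close>.
  A graded free resolution \<open>\<dots> \<rightarrow> F\<^sub>1 \<rightarrow> F\<^sub>0 = S \<rightarrow> S/I \<rightarrow> 0\<close> by finitely generated modules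
  \<open>F\<^sub>i = \<Oplus>\<^sub>j\<^sub><\<^sub>b\<^sub>i S(-d\<^sub>i\<^sub>j)\<close>; the map \<open>F\<^sub>i\<^sub>+\<^sub>1 \<rightarrow> F\<^sub>i\<close> has matrix \<open>A i\<close>.\<close>

definition graded_free_resolution :: "'v set \<Rightarrow> ('v, 'k::field) mpoly set \<Rightarrow> (nat \<Rightarrow> nat) \<Rightarrow>
    (nat \<Rightarrow> nat \<Rightarrow> int) \<Rightarrow> (nat \<Rightarrow> nat \<Rightarrow> nat \<Rightarrow> ('v, 'k) mpoly) \<Rightarrow> bool" where
  "graded_free_resolution V I b d A \<longleftrightarrow>
     (let S = mpoly_ring V;
          F = (\<lambda>i. free_module S (b i));
          \<phi> = (\<lambda>i. mat_map S (b (Suc i)) (b i) (A i))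
      in b 0 = 1 \<and> d 0 0 = 0 \<and>
         (\<forall>i. \<forall>k<b i. \<forall>l<b (Suc i). A i k l \<in> homog V (d (Suc i) l - d i k)) \<and>
         \<phi> 0 ` carrier (F 1) = {u \<in> carrier (F 0). u 0 \<in> I} \<and>
         (\<forall>i. \<phi> (Suc i) ` carrier (F (Suc (Suc i))) =
              {u \<in> carrier (F (Suc i)). \<phi> i u = \<zero>\<^bsub>F i\<^esub>}))"

text \<open>\<open>Ext\<^sup>c(S/I, S(-n))\<close> is the cohomology at the \<open>c\<close>-th place of the complex \<open>Hom(F\<^sub>\<bullet>, S(-n))\<close>,
  whose terms are \<open>S\<^sup>b\<^sup>c\<close> and whose maps are given by the transposed matrices.
  As \<open>Hom(S(-d), S(-n)) = S(d-n)\<close>, a cocycle \<open>u\<close> is homogeneous of degree \<open>e\<close>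
  if each \<open>u j\<close> is homogeneous of degree \<open>e + d c j - n\<close>.\<close>

definition dual_map :: "'v set \<Rightarrow> (nat \<Rightarrow> nat) \<Rightarrow> (nat \<Rightarrow> nat \<Rightarrow> nat \<Rightarrow> ('v, 'k::field) mpoly) \<Rightarrow>
    nat \<Rightarrow> (nat \<Rightarrow> ('v, 'k) mpoly) \<Rightarrow> (nat \<Rightarrow> ('v, 'k) mpoly)" where
  "dual_map V b A i = mat_map (mpoly_ring V) (b i) (b (Suc i)) (\<lambda>l k. A i k l)"

definition cocycles :: "'v set \<Rightarrow> (nat \<Rightarrow> nat) \<Rightarrow> (nat \<Rightarrow> nat \<Rightarrow> nat \<Rightarrow> ('v, 'k::field) mpoly) \<Rightarrow>
    nat \<Rightarrow> (nat \<Rightarrow> ('v, 'k) mpoly) set" where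
  "cocycles V b A c = {u \<in> carrier (free_module (mpoly_ring V) (b c)).
     dual_map V b A c u = \<zero>\<^bsub>free_module (mpoly_ring V) (b (Suc c))\<^esub>}"

definition coboundaries :: "'v set \<Rightarrow> (nat \<Rightarrow> nat) \<Rightarrow> (nat \<Rightarrow> nat \<Rightarrow> nat \<Rightarrow> ('v, 'k::field) mpoly) \<Rightarrow>
    nat \<Rightarrow> (nat \<Rightarrow> ('v, 'k) mpoly) set" where
  "coboundaries V b A c = (case c of
       0 \<Rightarrow> {\<zero>\<^bsub>free_module (mpoly_ring V) (b 0)\<^esub>}
     | Suc i \<Rightarrow> dual_map V b A i ` carrier (free_module (mpoly_ring V) (b i)))"

definition ext_module :: "'v set \<Rightarrow> (nat \<Rightarrow> nat) \<Rightarrow> (nat \<Rightarrow> nat \<Rightarrow> nat \<Rightarrow> ('v, 'k::field) mpoly) \<Rightarrow>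
    nat \<Rightarrow> (('v, 'k) mpoly, (nat \<Rightarrow> ('v, 'k) mpoly) set) module" where
  "ext_module V b A c = quotient_module
     (free_module (mpoly_ring V) (b c)\<lparr>carrier := cocycles V b A c\<rparr>) (coboundaries V b A c)"

definition ext_piece :: "'v set \<Rightarrow> (nat \<Rightarrow> nat) \<Rightarrow> (nat \<Rightarrow> nat \<Rightarrow> int) \<Rightarrow>
    (nat \<Rightarrow> nat \<Rightarrow> nat \<Rightarrow> ('v, 'k::field) mpoly) \<Rightarrow> nat \<Rightarrow> int \<Rightarrow> (nat \<Rightarrow> ('v, 'k) mpoly) set set" where
  "ext_piece V b d A c e = {coboundaries V b A c +>\<^bsub>free_module (mpoly_ring V) (b c)\<^esub> u | u.
     u \<in> cocycles V b A c \<and> (\<forall>j<b c. u j \<in> homog V (e + d c j - int (card V)))}"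

text \<open>\<open>(\<omega>, g)\<close> is the canonical module \<open>Ext\<^sup>n\<^sup>-\<^sup>d\<^sup>i\<^sup>m\<^sup>(\<^sup>S\<^sup>/\<^sup>I\<^sup>)(S/I, S(-n))\<close> of \<open>S/I\<close>, regarded as a module
  over \<open>S\<close>, with graded pieces \<open>g e\<close>. Up to graded isomorphism it does not depend on
  the resolution.\<close>

definition canonical_module :: "'v set \<Rightarrow> ('v, 'k::field) mpoly set \<Rightarrow>
    (('v, 'k) mpoly, (nat \<Rightarrow> ('v, 'k) mpoly) set) module \<Rightarrow>
    (int \<Rightarrow> (nat \<Rightarrow> ('v, 'k) mpoly) set set) \<Rightarrow> bool" where
  "canonical_module V I \<omega> g \<longleftrightarrow> (\<exists>b d A c. graded_free_resolution V I b d A \<and>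
     enat c + krull_dim (mpoly_ring V Quot I) = enat (card V) \<and>
     \<omega> = ext_module V b A c \<and> g = ext_piece V b d A c)"

definition residue_module ::
  "'v set \<Rightarrow> ('v, 'k::field) mpoly set \<Rightarrow> (('v, 'k) mpoly, ('v, 'k) mpoly set) module" where
  "residue_module V I = quotient_module (self_module (mpoly_ring V)) I"

definition residue_piece :: "'v set \<Rightarrow> ('v, 'k::field) mpoly set \<Rightarrow> int \<Rightarrow> ('v, 'k) mpoly set set" where
  "residue_piece V I k = {I +>\<^bsub>mpoly_ring V\<^esub> p | p. p \<in> homog V k}"

text \<open>\<open>S/I\<close> is Gorenstein: it is Cohen-Macaulay and its canonical module is isomorphic, up to a
  shift \<open>a\<close> of the grading, to \<open>S/I\<close>.\<close>

definition gorenstein :: "'v set \<Rightarrow> ('v, 'k::field) mpoly set \<Rightarrow> bool" where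
  "gorenstein V I \<longleftrightarrow> cohen_macaulay (mpoly_ring V Quot I) \<and>
     (\<exists>\<omega> g f a. canonical_module V I \<omega> g \<and> module_iso (mpoly_ring V) (residue_module V I) \<omega> f \<and>
        (\<forall>k. f ` residue_piece V I k = g (k + a)))"

definition level :: "'v set \<Rightarrow> ('v, 'k::field) mpoly set \<Rightarrow> bool" where
  "level V I \<longleftrightarrow> cohen_macaulay (mpoly_ring V Quot I) \<and>
     (\<exists>\<omega> g e. canonical_module V I \<omega> g \<and> generates_module (mpoly_ring V) \<omega> (g e))"

end

theory Submission
  imports Defs "HOL-Library.Product_Lexorder"
begin

text \<open>Let \<open>I = I_adj \<C>\<close> in \<open>S = K[x\<^sub>v | v \<in> V]\<close>. The binomials of the cells span a saturated lattice of
  rank \<open>|\<C>|\<close>, whose lattice ideal \<open>P\<close> is a minimal prime of \<open>I\<close> of height at least \<open>|\<C>|\<close>. If \<open>\<C>\<close> contains an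
  X-pentomino, then the four vertices of its central cell, enlarged suitably to a set \<open>Z\<close> of vertices,
  together with the lattice of the cells avoiding \<open>Z\<close>, define a toric prime \<open>Q \<supseteq> I\<close> of height less
  than \<open>|\<C>|\<close>. So \<open>I\<close> is not unmixed.

  A regular sequence generating \<open>I\<close> would have length less than \<open>|\<C>|\<close> because it lies in \<open>Q\<close>, but
  the \<open>|\<C>|\<close> minors are linearly independent quadrics, so that \<open>I\<close> needs \<open>|\<C>|\<close> generators.

  If \<open>S/I\<close> were Cohen-Macaulay, consider the irrelevant maximal ideal \<open>\<mm>\<close>. As \<open>P/I\<close> is the annihilator of
  a monomial, the depth at \<open>\<mm>\<close> is at most \<open>|V| - |\<C>|\<close>. A regular sequence whose length is the height of
  \<open>\<mm>/I\<close> generates an ideal with minimal prime \<open>\<mm>\<close>; so \<open>dim S/(I + \<mm>\<^sup>d)\<close> is bounded by a polynomial in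
  \<open>d\<close> whose degree is that length, while \<open>dim S/(Q + \<mm>\<^sup>d)\<close> grows with a degree exceeding \<open>|V| - |\<C>|\<close>.

  Upper bounds for heights come from chains of ideals of \<open>S\<close> in which each step adds a nonzerodivisor modulo the
  previous ideal: these elements are algebraically independent, so there are at most \<open>|V|\<close> steps.\<close>

section \<open>Minimal primes, regular sequences and colon ideals\<close>

text \<open>The X-pentomino enters through one count: killing the four vertices of its central cell
  kills both terms of five minors. A variable in \<open>Z\<close> and a cell avoiding
  \<open>Z\<close> each cost one in the height of the toric prime, so trading five cells for four
  variables lowers it. Prime chains and the colon ideals attached to a regular sequence are both
  chains of nonzerodivisor steps, so one length bound serves heights and depths. The colon ideals
  may fail to be prime, hence chains of primes alone would not do. In the Cohen-Macaulay case
  everything has to be compared at \<mm>. The elements x_v - 1 that complete \<open>Q\<close> to a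
  long chain of primes lie outside \<mm>, so that chain says nothing about the height of \<mm>/I;
  growth modulo powers of \<mm> measures the dimension there instead. Gorenstein and level algebras
  are Cohen-Macaulay by definition, so these two conditions reduce to the fourth.\<close>

lemma idealI_cring:
  assumes "cring R" "J \<subseteq> carrier R" "\<zero>\<^bsub>R\<^esub> \<in> J"
    and add: "\<And>x y. x \<in> J \<Longrightarrow> y \<in> J \<Longrightarrow> x \<oplus>\<^bsub>R\<^esub> y \<in> J"
    and mult: "\<And>r x. r \<in> carrier R \<Longrightarrow> x \<in> J \<Longrightarrow> r \<otimes>\<^bsub>R\<^esub> x \<in> J"
  shows "ideal J R"
proof -
  interpret cring R by fact
  have neg: "\<ominus>\<^bsub>R\<^esub> x \<in> J" if "x \<in> J" for x
    using mult[of "\<ominus>\<^bsub>R\<^esub> \<one>\<^bsub>R\<^esub>" x] that assms(2) l_minus[of "\<one>\<^bsub>R\<^esub>" x] by auto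
  show ?thesis
  proof (rule idealI)
    show "subgroup J (add_monoid R)"
      using assms neg by unfold_locales (auto simp: a_inv_def[symmetric])
    next
    fix a x assume ax: "a \<in> J" "x \<in> carrier R"
    then show "x \<otimes>\<^bsub>R\<^esub> a \<in> J" "a \<otimes>\<^bsub>R\<^esub> x \<in> J" using mult[of x a] m_comm[of a x] assms(2) by auto
  qed (rule ring_axioms)
qed

definition prime_chain :: "('a, 'b) ring_scheme \<Rightarrow> nat \<Rightarrow> 'a set \<Rightarrow> bool" where
  "prime_chain R n P \<longleftrightarrow> (\<exists>p. (\<forall>i\<le>n. primeideal (p i) R) \<and> (\<forall>i<n. p i \<subset> p (Suc i)) \<and> p n = P)"

lemma prime_height_eq_Sup: "prime_height R P = Sup {enat n | n. prime_chain R n P}"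
  by (simp add: prime_height_def prime_chain_def)

lemma prime_chain_0: "primeideal P R \<Longrightarrow> prime_chain R 0 P"
  by (auto simp: prime_chain_def)

lemma prime_chain_Suc:
  assumes "prime_chain R n P" "primeideal Q R" "P \<subset> Q"
  shows "prime_chain R (Suc n) Q"
proof -
  obtain p where p: "\<forall>i\<le>n. primeideal (p i) R" "\<forall>i<n. p i \<subset> p (Suc i)" "p n = P"
    using assms(1) by (auto simp: prime_chain_def)
  define q where "q i = (if i = Suc n then Q else p i)" for i
  have "primeideal (q i) R" if "i \<le> Suc n" for i
    using that assms p by (auto simp: q_def le_Suc_eq)
  moreover have "q i \<subset> q (Suc i)" if "i < Suc n" for i
    using that assms p by (auto simp: q_def less_Suc_eq)
  ultimately show ?thesis unfolding prime_chain_def by (intro exI[of _ q]) (auto simp: q_def)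
qed

context cring
begin

lemmas ring_ac = l_distr r_distr a_ac m_ac l_minus r_minus minus_add r_neg l_neg r_neg1 r_neg2

definition adjoin :: "'a set \<Rightarrow> 'a \<Rightarrow> 'a set" where
  "adjoin J a = {j \<oplus> r \<otimes> a | j r. j \<in> J \<and> r \<in> carrier R}"

definition colon :: "'a set \<Rightarrow> 'a \<Rightarrow> 'a set" where
  "colon J z = {r \<in> carrier R. r \<otimes> z \<in> J}"

lemma adjoinE:
  assumes "x \<in> adjoin J a"
  obtains j r where "j \<in> J" "r \<in> carrier R" "x = j \<oplus> r \<otimes> a"
  using assms by (auto simp: adjoin_def)

lemma adjoinI: "j \<in> J \<Longrightarrow> r \<in> carrier R \<Longrightarrow> x = j \<oplus> r \<otimes> a \<Longrightarrow> x \<in> adjoin J a"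
  by (auto simp: adjoin_def)

lemma ideal_adjoin:
  assumes "ideal J R" "a \<in> carrier R"
  shows "ideal (adjoin J a) R"
proof -
  interpret J: ideal J R by fact
  show ?thesis
  proof (rule idealI_cring[OF is_cring])
    show "adjoin J a \<subseteq> carrier R"
      using assms J.Icarr by (auto simp: adjoin_def)
    have "\<zero> = \<zero> \<oplus> \<zero> \<otimes> a" using assms by simp
    then show "\<zero> \<in> adjoin J a" by (intro adjoinI[OF J.zero_closed zero_closed])
  next
    fix x y assume "x \<in> adjoin J a" "y \<in> adjoin J a"
    then obtain j r k s where *: "j \<in> J" "r \<in> carrier R" "x = j \<oplus> r \<otimes> a"
      "k \<in> J" "s \<in> carrier R" "y = k \<oplus> s \<otimes> a" by (elim adjoinE)
    have "j \<in> carrier R" "k \<in> carrier R" using * J.Icarr by blast+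
    then have "x \<oplus> y = (j \<oplus> k) \<oplus> (r \<oplus> s) \<otimes> a"
      unfolding *(3,6) using assms(2) *(2,5) by (simp add: ring_ac)
    then show "x \<oplus> y \<in> adjoin J a"
      using * by (intro adjoinI[of "j \<oplus> k" _ "r \<oplus> s"]) (auto intro: J.a_closed)
  next
    fix c x assume c: "c \<in> carrier R" and "x \<in> adjoin J a"
    then obtain j r where *: "j \<in> J" "r \<in> carrier R" "x = j \<oplus> r \<otimes> a" by (elim adjoinE)
    have "j \<in> carrier R" using * J.Icarr by blast
    then have "c \<otimes> x = c \<otimes> j \<oplus> (c \<otimes> r) \<otimes> a"
      unfolding *(3) using assms(2) *(2) c by (simp add: ring_ac)
    then show "c \<otimes> x \<in> adjoin J a"
      using * c by (intro adjoinI[of "c \<otimes> j" _ "c \<otimes> r"]) (auto intro: J.I_l_closed)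
  qed
qed

lemma adjoin_superset:
  assumes "ideal J R" "a \<in> carrier R"
  shows "J \<subseteq> adjoin J a" "a \<in> adjoin J a"
proof -
  interpret J: ideal J R by fact
  have "x = x \<oplus> \<zero> \<otimes> a" if "x \<in> J" for x using that J.Icarr assms by simp
  then show "J \<subseteq> adjoin J a" by (auto intro: adjoinI[of _ J \<zero>])
  have "a = \<zero> \<oplus> \<one> \<otimes> a" using assms by simp
  then show "a \<in> adjoin J a" by (intro adjoinI[OF J.zero_closed one_closed])
qed

lemma Idl_insert_subset_adjoin:
  assumes "X \<subseteq> carrier R" "a \<in> carrier R"
  shows "Idl (insert a X) \<subseteq> adjoin (Idl X) a"
  using assms adjoin_superset[OF genideal_ideal[OF assms(1)] assms(2)] genideal_self[OF assms(1)]
  by (intro genideal_minimal ideal_adjoin genideal_ideal) auto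

lemma ideal_colon:
  assumes "ideal J R" "z \<in> carrier R"
  shows "ideal (colon J z) R"
proof -
  interpret J: ideal J R by fact
  show ?thesis
    by (rule idealI_cring[OF is_cring])
      (use assms J.I_l_closed in \<open>auto simp: colon_def l_distr m_assoc\<close>)
qed

text \<open>An ideal maximal among those that contain \<open>J\<close> and miss \<open>T\<close> is
  prime: adjoining either of two outside elements makes it meet \<open>T\<close>, and the product of
  the two elements of \<open>T\<close> found in this way would lie in the ideal if the product of
  the outside elements did.\<close>

lemma exists_prime_disjoint:
  assumes J: "ideal J R" and T: "\<one> \<in> T" "T \<subseteq> carrier R" "\<And>a b. a \<in> T \<Longrightarrow> b \<in> T \<Longrightarrow> a \<otimes> b \<in> T"
    and "J \<inter> T = {}"
  obtains P where "primeideal P R" "J \<subseteq> P" "P \<inter> T = {}"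
proof -
  define A where "A = {K. ideal K R \<and> J \<subseteq> K \<and> K \<inter> T = {}}"
  have "\<exists>M\<in>A. \<forall>X\<in>A. M \<subseteq> X \<longrightarrow> X = M"
  proof (rule subset_Zorn_nonempty)
    show "A \<noteq> {}" using assms by (auto simp: A_def)
    fix C assume C: "C \<noteq> {}" "subset.chain A C"
    then have "subset.chain {I. ideal I R} C"
      by (auto simp: pred_on.chain_def A_def)
    from chain_Union_is_ideal[OF this] have "ideal (\<Union>C) R" using C by simp
    then show "\<Union>C \<in> A" using C by (auto simp: pred_on.chain_def A_def)
  qed
  then obtain M where M: "ideal M R" "J \<subseteq> M" "M \<inter> T = {}"
    and max: "\<And>X. ideal X R \<Longrightarrow> M \<subseteq> X \<Longrightarrow> X \<inter> T = {} \<Longrightarrow> X = M"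
    unfolding A_def by auto
  interpret M: ideal M R by fact
  have meets: "\<exists>m\<in>M. \<exists>r\<in>carrier R. m \<oplus> r \<otimes> a \<in> T" if "a \<in> carrier R" "a \<notin> M" for a
  proof (rule ccontr)
    assume "\<not> ?thesis"
    then have "adjoin M a \<inter> T = {}" by (auto simp: adjoin_def)
    with max[OF ideal_adjoin] adjoin_superset[of M a] M that show False by blast
  qed
  have "primeideal M R"
  proof (rule primeidealI[OF M(1) is_cring])
    show "carrier R \<noteq> M" using M T by auto
    fix a b assume ab: "a \<in> carrier R" "b \<in> carrier R" "a \<otimes> b \<in> M"
    show "a \<in> M \<or> b \<in> M"
    proof (rule ccontr)
      assume "\<not> (a \<in> M \<or> b \<in> M)"
      with meets ab obtain m r m' r' where *: "m \<in> M" "r \<in> carrier R" "m \<oplus> r \<otimes> a \<in> T"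
        "m' \<in> M" "r' \<in> carrier R" "m' \<oplus> r' \<otimes> b \<in> T" by meson
      have mc: "m \<in> carrier R" "m' \<in> carrier R" using *(1,4) M.Icarr by blast+
      have "(m \<oplus> r \<otimes> a) \<otimes> (m' \<oplus> r' \<otimes> b) = (m' \<oplus> r' \<otimes> b) \<otimes> m \<oplus> ((r \<otimes> a) \<otimes> m' \<oplus> (r \<otimes> r') \<otimes> (a \<otimes> b))"
        using mc *(2,5) ab(1,2) by (simp add: ring_ac)
      moreover have "\<dots> \<in> M"
        using M.I_l_closed[OF ab(3), of "r \<otimes> r'"] M.I_l_closed[OF *(1), of "m' \<oplus> r' \<otimes> b"]
          M.I_l_closed[OF *(4), of "r \<otimes> a"] M.a_closed *(2,5) ab(1,2) mc by simp
      moreover have "(m \<oplus> r \<otimes> a) \<otimes> (m' \<oplus> r' \<otimes> b) \<in> T" using T * by blast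
      ultimately show False using M by auto
    qed
  qed
  with M that show ?thesis by blast
qed

text \<open>Zorn's lemma is applied to multiplicative sets that contain the complement of
  \<open>Q\<close> and miss \<open>J\<close>, so that unions of chains are the bounds. A prime
  avoiding a maximal such set is exactly its complement.\<close>

lemma exists_minimal_prime:
  assumes J: "ideal J R" and Q: "primeideal Q R" "J \<subseteq> Q"
  obtains P where "minimal_prime R J P" "P \<subseteq> Q"
proof -
  interpret Q: primeideal Q R by fact
  define A where "A = {T. carrier R - Q \<subseteq> T \<and> T \<subseteq> carrier R \<and> (\<forall>a\<in>T. \<forall>b\<in>T. a \<otimes> b \<in> T) \<and> J \<inter> T = {}}"
  have oneQ: "\<one> \<notin> Q" using Q.I_notcarr Q.one_imp_carrier by blast
  have compl: "carrier R - P \<in> A" if P: "primeideal P R" "J \<subseteq> P" "P \<subseteq> Q" for P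
  proof -
    interpret P: primeideal P R by fact
    show ?thesis using P P.I_prime by (auto simp: A_def)
  qed
  have "\<exists>M\<in>A. \<forall>X\<in>A. M \<subseteq> X \<longrightarrow> X = M"
  proof (rule subset_Zorn_nonempty)
    show "A \<noteq> {}" using compl[OF Q] by auto
    fix C assume C: "C \<noteq> {}" "subset.chain A C"
    then have CA: "\<And>T. T \<in> C \<Longrightarrow> T \<in> A" and lin: "\<And>S T. S \<in> C \<Longrightarrow> T \<in> C \<Longrightarrow> S \<subseteq> T \<or> T \<subseteq> S"
      unfolding pred_on.chain_def by blast+
    have "a \<otimes> b \<in> \<Union>C" if ab: "a \<in> \<Union>C" "b \<in> \<Union>C" for a b
    proof -
      obtain T where "T \<in> C" "a \<in> T" "b \<in> T" using ab lin by blast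
      then show ?thesis using CA by (auto simp: A_def)
    qed
    moreover have "carrier R - Q \<subseteq> \<Union>C" "\<Union>C \<subseteq> carrier R" "J \<inter> \<Union>C = {}"
      using C(1) CA unfolding A_def by blast+
    ultimately show "\<Union>C \<in> A" unfolding A_def by blast
  qed
  then obtain M where M: "M \<in> A" and max: "\<And>X. X \<in> A \<Longrightarrow> M \<subseteq> X \<Longrightarrow> X = M" by auto
  obtain P where P: "primeideal P R" "J \<subseteq> P" "P \<inter> M = {}"
    using exists_prime_disjoint[OF J, of M] M oneQ by (auto simp: A_def)
  interpret P: primeideal P R by fact
  have PQ: "P \<subseteq> Q" using P(3) M P.Icarr unfolding A_def by blast
  have "minimal_prime R J P"
    unfolding minimal_prime_def
  proof (intro conjI allI impI)
    fix Q' assume Q': "primeideal Q' R \<and> J \<subseteq> Q' \<and> Q' \<subseteq> P"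
    interpret Q': primeideal Q' R using Q' by blast
    have M_sub: "M \<subseteq> carrier R" using M unfolding A_def by blast
    have "carrier R - Q' = M"
      using max[OF compl[of Q']] Q' PQ P(3) M_sub by blast
    moreover have "carrier R - P = M"
      using max[OF compl[of P]] P PQ M_sub by blast
    ultimately show "Q' = P" using Q'.Icarr P.Icarr by blast
  qed (use P in auto)
  with PQ that show ?thesis by blast
qed

text \<open>In the localization at \<open>P\<close> the only prime over \<open>J\<close> is
  \<open>P\<close>, so its elements are nilpotent modulo \<open>J\<close>. Without localizing: a
  prime over \<open>J\<close> that misses all products of an element outside \<open>P\<close> with a
  power of \<open>f\<close> would lie in \<open>P\<close> and miss \<open>f\<close>.\<close>

lemma minimal_prime_nilpotent:
  assumes J: "ideal J R" and P: "minimal_prime R J P" and f: "f \<in> P"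
  obtains g n where "g \<in> carrier R" "g \<notin> P" "g \<otimes> f [^] (n::nat) \<in> J"
proof -
  interpret P: primeideal P R using P by (simp add: minimal_prime_def)
  have oneP: "\<one> \<notin> P" using P.I_notcarr P.one_imp_carrier by blast
  have fc: "f \<in> carrier R" using f P.Icarr by blast
  define T where "T = {g \<otimes> f [^] (n::nat) | g n. g \<in> carrier R \<and> g \<notin> P}"
  have inT: "g \<otimes> f [^] n \<in> T" if "g \<in> carrier R" "g \<notin> P" for g and n :: nat
    using that by (auto simp: T_def)
  have "J \<inter> T \<noteq> {}"
  proof
    assume dis: "J \<inter> T = {}"
    obtain P' where P': "primeideal P' R" "J \<subseteq> P'" "P' \<inter> T = {}"
    proof (rule exists_prime_disjoint[OF J _ _ _ dis])
      show "\<one> \<in> T" using inT[of \<one> 0] oneP by simp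
      show "T \<subseteq> carrier R" using fc by (auto simp: T_def)
      fix a b assume "a \<in> T" "b \<in> T"
      then obtain g h and n k :: nat where *: "g \<in> carrier R" "g \<notin> P" "h \<in> carrier R" "h \<notin> P"
        "a = g \<otimes> f [^] n" "b = h \<otimes> f [^] k" by (auto simp: T_def)
      have "a \<otimes> b = (g \<otimes> h) \<otimes> (f [^] n \<otimes> f [^] k)"
        using * fc by (simp add: m_ac)
      also have "\<dots> = (g \<otimes> h) \<otimes> f [^] (n + k)"
        using fc by (simp add: nat_pow_mult)
      finally show "a \<otimes> b \<in> T" using inT[of "g \<otimes> h"] * P.I_prime by auto
    qed
    interpret P': primeideal P' R by fact
    have "P' \<subseteq> P" using P' inT[of _ 0] P'.Icarr by (auto simp: r_one)
    moreover have "f \<notin> P'" using inT[of \<one> 1] oneP fc P' by auto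
    ultimately show False using P P' f by (auto simp: minimal_prime_def)
  qed
  then show ?thesis using that by (auto simp: T_def)
qed

lemma nonzerodivisor_notin_minimal_prime:
  assumes J: "ideal J R" and P: "minimal_prime R J P" and x: "x \<in> carrier R"
    and nzd: "\<And>r. r \<in> carrier R \<Longrightarrow> x \<otimes> r \<in> J \<Longrightarrow> r \<in> J"
  shows "x \<notin> P"
proof
  assume "x \<in> P"
  then obtain g n where g: "g \<in> carrier R" "g \<notin> P" "g \<otimes> x [^] (n::nat) \<in> J"
    using minimal_prime_nilpotent[OF J P] by blast
  have "g \<in> J" using g(3)
  proof (induction n)
    case 0 then show ?case using g by simp
  next
    case (Suc n)
    have "g \<otimes> x [^] Suc n = x \<otimes> (g \<otimes> x [^] n)" using g x by (simp add: m_ac)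
    with Suc nzd[of "g \<otimes> x [^] n"] g x show ?case by auto
  qed
  then show False using g P by (auto simp: minimal_prime_def)
qed

lemma regular_sequence_append1D:
  assumes "regular_sequence R (xs @ [x])"
  shows "regular_sequence R xs" "x \<in> carrier R"
    "r \<in> carrier R \<Longrightarrow> x \<otimes> r \<in> Idl (set xs) \<Longrightarrow> r \<in> Idl (set xs)"
proof -
  have c: "set (xs @ [x]) \<subseteq> carrier R" and ne: "Idl (set (xs @ [x])) \<noteq> carrier R"
    and reg: "\<And>i r. i < Suc (length xs) \<Longrightarrow> r \<in> carrier R \<Longrightarrow>
      (xs @ [x]) ! i \<otimes> r \<in> Idl (set (take i (xs @ [x]))) \<Longrightarrow> r \<in> Idl (set (take i (xs @ [x])))"
    using assms unfolding regular_sequence_def by auto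
  show "x \<in> carrier R" using c by simp
  show "r \<in> carrier R \<Longrightarrow> x \<otimes> r \<in> Idl (set xs) \<Longrightarrow> r \<in> Idl (set xs)"
    using reg[of "length xs" r] by simp
  have "Idl (set xs) \<subseteq> Idl (set (xs @ [x]))" using c by (intro subset_Idl_subset) auto
  moreover have "Idl (set (xs @ [x])) \<subseteq> carrier R"
    by (rule genideal_minimal[OF oneideal c])
  ultimately have ne': "Idl (set xs) \<noteq> carrier R" using ne by auto
  then show "regular_sequence R xs"
    unfolding regular_sequence_def
  proof (intro conjI allI ballI impI)
    fix i r assume i: "i < length xs" and r: "r \<in> carrier R" "xs ! i \<otimes> r \<in> Idl (set (take i xs))"
    have "(xs @ [x]) ! i = xs ! i" "take i (xs @ [x]) = take i xs" using i by (auto simp: nth_append)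
    then show "r \<in> Idl (set (take i xs))" using reg[of i r] i r by simp
  qed (use c ne' in auto)
qed

text \<open>Grade is at most height. A minimal prime over the earlier elements that lies inside
  \<open>Q\<close> cannot contain the last element, a nonzerodivisor, so it lies strictly below
  \<open>Q\<close> and the induction continues with it.\<close>

lemma regular_sequence_prime_chain:
  assumes "regular_sequence R xs" "primeideal Q R" "set xs \<subseteq> Q"
  shows "prime_chain R (length xs) Q"
  using assms
proof (induction xs arbitrary: Q rule: rev_induct)
  case Nil
  then show ?case by (simp add: prime_chain_0)
next
  case (snoc x xs)
  note reg = regular_sequence_append1D[OF snoc.prems(1)]
  interpret Q: primeideal Q R by fact
  have c: "set xs \<subseteq> carrier R" using snoc.prems Q.Icarr by auto
  then have J: "ideal (Idl (set xs)) R" by (rule genideal_ideal)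
  have "Idl (set xs) \<subseteq> Q" using snoc.prems by (intro genideal_minimal Q.is_ideal) auto
  then obtain P where P: "minimal_prime R (Idl (set xs)) P" "P \<subseteq> Q"
    using exists_minimal_prime[OF J snoc.prems(2)] by blast
  have "x \<notin> P" using nonzerodivisor_notin_minimal_prime[OF J P(1)] reg by blast
  then have "P \<subset> Q" using P(2) snoc.prems(3) by auto
  moreover have "prime_chain R (length xs) P"
    using snoc.IH[OF reg(1)] P(1) genideal_self[OF c] by (auto simp: minimal_prime_def)
  ultimately show ?case using prime_chain_Suc[of R "length xs" P Q] snoc.prems(2) by simp
qed

end

text \<open>A weak counterpart of a chain of primes from \<open>A\<close> up to \<open>C\<close>,
  with \<open>n\<close> counting the nonzerodivisors. Properness is no part of it; the length bound
  asks for it at the top, as \<open>1 \<notin> C\<close>.\<close>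

inductive nzd_chain :: "('a, 'b) ring_scheme \<Rightarrow> nat \<Rightarrow> 'a set \<Rightarrow> 'a set \<Rightarrow> bool" for R (structure) where
  nzd_chain_refl: "ideal A R \<Longrightarrow> nzd_chain R 0 A A"
| nzd_chain_step: "ideal A R \<Longrightarrow> A \<subseteq> B \<Longrightarrow> f \<in> B \<Longrightarrow>
    (\<And>r. r \<in> carrier R \<Longrightarrow> f \<otimes> r \<in> A \<Longrightarrow> r \<in> A) \<Longrightarrow> nzd_chain R n B C \<Longrightarrow> nzd_chain R (Suc n) A C"

lemma nzd_chain_trans:
  "nzd_chain R m A B \<Longrightarrow> nzd_chain R n B C \<Longrightarrow> nzd_chain R (m + n) A C"
  by (induction rule: nzd_chain.induct) (auto intro: nzd_chain.intros)

lemma nzd_chain_ideal: "nzd_chain R n A B \<Longrightarrow> ideal A R \<and> ideal B R"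
  by (induction rule: nzd_chain.induct) auto

lemma nzd_chain_Suc:
  assumes "nzd_chain R n A B" "ideal C R" "B \<subseteq> C" "f \<in> C"
    "\<And>r. r \<in> carrier R \<Longrightarrow> f \<otimes>\<^bsub>R\<^esub> r \<in> B \<Longrightarrow> r \<in> B"
  shows "nzd_chain R (Suc n) A C"
proof -
  have "nzd_chain R (Suc 0) B C"
    using assms nzd_chain_ideal[OF assms(1)] by (intro nzd_chain_step[of B R C f] nzd_chain_refl) auto
  from nzd_chain_trans[OF assms(1) this] show ?thesis by simp
qed

text \<open>An element of \<open>Q\<close> outside the prime \<open>P\<close> is a nonzerodivisor
  modulo \<open>P\<close>, so a strict inclusion of primes is one step.\<close>

lemma nzd_chain_primes_Suc:
  assumes "nzd_chain R n A P" "primeideal P R" "primeideal Q R" "P \<subset> Q"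
  shows "nzd_chain R (Suc n) A Q"
proof -
  interpret P: primeideal P R by fact
  interpret Q: primeideal Q R by fact
  obtain f where f: "f \<in> Q" "f \<notin> P" using assms by blast
  show ?thesis
    by (rule nzd_chain_Suc[OF assms(1) Q.is_ideal _ f(1)])
      (use assms f P.I_prime Q.Icarr in blast)+
qed

lemma prime_chain_nzd_chain:
  assumes "prime_chain R n P"
  obtains A where "nzd_chain R n A P"
proof -
  obtain p where p: "\<forall>i\<le>n. primeideal (p i) R" "\<forall>i<n. p i \<subset> p (Suc i)" "p n = P"
    using assms by (auto simp: prime_chain_def)
  have "i \<le> n \<Longrightarrow> nzd_chain R i (p 0) (p i)" for i
  proof (induction i)
    case 0
    have "primeideal (p 0) R" using p by blast
    then show ?case by (intro nzd_chain_refl) (simp add: primeideal.axioms)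
  next
    case (Suc i)
    then show ?case using p by (intro nzd_chain_primes_Suc[of R i "p 0" "p i"]) auto
  qed
  then show ?thesis using p that by blast
qed

text \<open>The maximal saturated ideal \<open>{w. \<exists>u \<notin> M. u w \<in> J + (z)}\<close> takes the place of Nakayama's
  lemma in the localization at \<open>M\<close>.\<close>

lemma (in cring) colon_adjoin:
  assumes noeth: "noetherian_ring R" and M: "primeideal M R" and J: "ideal J R"
    and z: "z \<in> carrier R" "colon J z \<subseteq> M"
    and y: "y \<in> M" and nzd: "\<And>r. r \<in> carrier R \<Longrightarrow> y \<otimes> r \<in> J \<Longrightarrow> r \<in> J"
    and K: "ideal K R" "J \<subseteq> K" "y \<in> K" "K \<subseteq> adjoin J y"
  obtains z' where "z' \<in> carrier R" "colon J z \<subseteq> colon K z'" "y \<in> colon K z'" "colon K z' \<subseteq> M"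
proof -
  interpret M: primeideal M R by fact
  interpret J: ideal J R by fact
  interpret K: ideal K R by fact
  have yc: "y \<in> carrier R" using y M.Icarr by blast
  have oneM: "\<one> \<notin> M" using M.I_notcarr M.one_imp_carrier by blast
  define L where "L x = {w \<in> carrier R. \<exists>u\<in>carrier R - M. u \<otimes> w \<in> adjoin J x}" for x
  have idL: "ideal (L x) R" if x: "x \<in> carrier R" for x
  proof -
    interpret X: ideal "adjoin J x" R using ideal_adjoin[OF J x] .
    show ?thesis
    proof (rule idealI_cring[OF is_cring])
      show "\<zero> \<in> L x" using X.zero_closed oneM by (auto simp: L_def)
      fix a b assume "a \<in> L x" "b \<in> L x"
      then obtain u v where *: "a \<in> carrier R" "b \<in> carrier R" "u \<in> carrier R" "u \<notin> M"
        "v \<in> carrier R" "v \<notin> M" "u \<otimes> a \<in> adjoin J x" "v \<otimes> b \<in> adjoin J x"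
        by (auto simp: L_def)
      have "(u \<otimes> v) \<otimes> (a \<oplus> b) = v \<otimes> (u \<otimes> a) \<oplus> u \<otimes> (v \<otimes> b)"
        using *(1-3,5) by (simp add: ring_ac)
      also have "\<dots> \<in> adjoin J x" using *(3,5,7,8) by (auto intro!: X.a_closed X.I_l_closed)
      finally show "a \<oplus> b \<in> L x"
        using *(1-6) M.I_prime[of u v] unfolding L_def by (auto intro!: bexI[of _ "u \<otimes> v"])
    next
      fix r a assume r: "r \<in> carrier R" "a \<in> L x"
      then obtain u where *: "a \<in> carrier R" "u \<in> carrier R" "u \<notin> M" "u \<otimes> a \<in> adjoin J x"
        by (auto simp: L_def)
      have "u \<otimes> (r \<otimes> a) = r \<otimes> (u \<otimes> a)" using * r by (simp add: m_lcomm)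
      also have "\<dots> \<in> adjoin J x" using * r X.I_l_closed by blast
      finally show "r \<otimes> a \<in> L x" using * r unfolding L_def by (auto intro!: bexI[of _ u])
    qed (auto simp: L_def)
  qed
  \<comment> \<open>The candidates \<open>x\<close> have colon ideals between that of
    \<open>z\<close> and \<open>M\<close>; noetherianity yields one with maximal
    \<open>L x\<close>.\<close>
  define N where "N = {x \<in> carrier R. colon J z \<subseteq> colon J x \<and> colon J x \<subseteq> M}"
  have "\<exists>X\<in>L ` N. \<forall>Y\<in>L ` N. X \<subseteq> Y \<longrightarrow> Y = X"
  proof (rule subset_Zorn_nonempty)
    show "L ` N \<noteq> {}" using z by (auto simp: N_def)
    fix C assume C: "C \<noteq> {}" "subset.chain (L ` N) C"
    then have "subset.chain {I. ideal I R} C"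
      using idL by (force simp: pred_on.chain_def N_def)
    then have "\<Union>C \<in> C" using noetherian_ring.ideal_chain_is_trivial[OF noeth C(1)] by blast
    then show "\<Union>C \<in> L ` N" using C by (auto simp: pred_on.chain_def)
  qed
  then obtain x where x: "x \<in> N" and max: "\<And>x'. x' \<in> N \<Longrightarrow> L x \<subseteq> L x' \<Longrightarrow> L x' = L x"
    by auto
  have xc: "x \<in> carrier R" using x by (simp add: N_def)
  \<comment> \<open>If some \<open>u\<close> outside \<open>M\<close> sends \<open>x\<close> into
    \<open>K\<close>, then locally \<open>x\<close> is a multiple of \<open>y\<close> modulo
    \<open>J\<close>, with quotient \<open>z'\<close>. This quotient is again a candidate and
    \<open>L x\<close> lies in \<open>L z'\<close>, so by maximality \<open>z'\<close> is locally a
    multiple of \<open>x\<close>. Then v u - c y sends \<open>x\<close> into \<open>J\<close> and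
    belongs to \<open>M\<close>; as \<open>y\<close> does too, so does v u, a contradiction.\<close>
  have "colon K x \<subseteq> M"
  proof
    fix u assume u: "u \<in> colon K x"
    then have uc: "u \<in> carrier R" and "u \<otimes> x \<in> adjoin J y" using K by (auto simp: colon_def)
    then obtain j z' where jz: "j \<in> J" "z' \<in> carrier R" "u \<otimes> x = j \<oplus> z' \<otimes> y"
      by (elim adjoinE)
    have jc: "j \<in> carrier R" using jz J.Icarr by blast
    show "u \<in> M"
    proof (rule ccontr)
      assume uM: "u \<notin> M"
      have "colon J z \<subseteq> colon J z'"
      proof
        fix r assume "r \<in> colon J z"
        then have r: "r \<in> carrier R" "r \<otimes> x \<in> J" using x by (auto simp: N_def colon_def)
        have "y \<otimes> (r \<otimes> z') = u \<otimes> (r \<otimes> x) \<oplus> (\<ominus> r) \<otimes> j"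
        proof -
          have "u \<otimes> (r \<otimes> x) = r \<otimes> (u \<otimes> x)"
        using r(1) uc xc by (simp add: ring_ac)
          also have "\<dots> = r \<otimes> (j \<oplus> z' \<otimes> y)" using jz by simp
          finally show ?thesis using r(1) yc jz(2) jc by (simp add: ring_ac)
        qed
        also have "\<dots> \<in> J" using r(1,2) uc jz(1) by (auto intro!: J.a_closed J.I_l_closed)
        finally show "r \<in> colon J z'" using nzd[of "r \<otimes> z'"] r jz by (simp add: colon_def)
      qed
      moreover have "colon J z' \<subseteq> M"
      proof
        fix v assume v: "v \<in> colon J z'"
        then have vc: "v \<in> carrier R" "v \<otimes> z' \<in> J" by (auto simp: colon_def)
        have "(v \<otimes> u) \<otimes> x = v \<otimes> (u \<otimes> x)" using vc uc xc by (simp add: m_assoc)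
        also have "\<dots> = v \<otimes> j \<oplus> y \<otimes> (v \<otimes> z')" unfolding jz(3) using vc(1) jz(2) jc yc by (simp add: ring_ac)
        also have "\<dots> \<in> J" using vc yc jz(1) by (auto intro!: J.a_closed J.I_l_closed)
        finally have "v \<otimes> u \<in> M" using x vc uc by (auto simp: N_def colon_def)
        then show "v \<in> M" using M.I_prime vc uc uM by blast
      qed
      ultimately have z'N: "z' \<in> N" using jz by (auto simp: N_def)
      have "L x \<subseteq> L z'"
      proof
        fix w assume "w \<in> L x"
        then obtain v where v: "w \<in> carrier R" "v \<in> carrier R" "v \<notin> M" "v \<otimes> w \<in> adjoin J x"
          by (auto simp: L_def)
        then obtain k r where kr: "k \<in> J" "r \<in> carrier R" "v \<otimes> w = k \<oplus> r \<otimes> x" by (elim adjoinE)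
        have kc: "k \<in> carrier R" using kr J.Icarr by blast
        have "(u \<otimes> v) \<otimes> w = u \<otimes> (v \<otimes> w)" using uc v by (simp add: m_assoc)
        also have "\<dots> = u \<otimes> k \<oplus> r \<otimes> (u \<otimes> x)" unfolding kr(3) using uc kc kr(2) xc by (simp add: ring_ac)
        also have "\<dots> = (u \<otimes> k \<oplus> r \<otimes> j) \<oplus> (r \<otimes> y) \<otimes> z'"
          unfolding jz(3) using uc kc kr(2) jc jz(2) yc by (simp add: ring_ac)
        also have "\<dots> \<in> adjoin J z'"
          using uc kr(1,2) jz(1,2) yc
          by (intro adjoinI[of "u \<otimes> k \<oplus> r \<otimes> j" _ "r \<otimes> y"]) (auto intro!: J.I_l_closed J.a_closed)
        finally show "w \<in> L z'"
          using v(1-3) uc uM M.I_prime[of u v] unfolding L_def by (auto intro!: bexI[of _ "u \<otimes> v"])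
      qed
      then have "L z' = L x" using max z'N by blast
      moreover have "z' \<in> L z'"
        using adjoin_superset(2)[OF J jz(2)] jz(2) oneM unfolding L_def by (auto intro!: bexI[of _ \<one>])
      ultimately obtain v where v: "v \<in> carrier R" "v \<notin> M" "v \<otimes> z' \<in> adjoin J x"
        by (auto simp: L_def)
      then obtain k c where kc: "k \<in> J" "c \<in> carrier R" "v \<otimes> z' = k \<oplus> c \<otimes> x" by (elim adjoinE)
      have kcarr: "k \<in> carrier R" using kc J.Icarr by blast
      have "(v \<otimes> u \<oplus> (\<ominus> c) \<otimes> y) \<otimes> x = v \<otimes> (u \<otimes> x) \<oplus> (\<ominus> (c \<otimes> y)) \<otimes> x"
        using v(1) uc kc(2) yc xc by (simp add: ring_ac)
      also have "\<dots> = v \<otimes> j \<oplus> (v \<otimes> z') \<otimes> y \<oplus> (\<ominus> (c \<otimes> y)) \<otimes> x"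
        unfolding jz(3) using v(1) jc jz(2) yc kc(2) xc by (simp add: ring_ac)
      also have "\<dots> = v \<otimes> j \<oplus> y \<otimes> k"
        unfolding kc(3) using v(1) jc yc kc(2) kcarr xc by (simp add: ring_ac)
      also have "\<dots> \<in> J" using v(1) jz(1) kc(1) yc by (auto intro!: J.a_closed J.I_l_closed)
      finally have "v \<otimes> u \<oplus> (\<ominus> c) \<otimes> y \<in> M" (is "?e \<in> M")
        using x v uc kc yc by (auto simp: N_def colon_def)
      moreover have "c \<otimes> y \<in> M" using kc y M.I_l_closed by blast
      ultimately have "?e \<oplus> c \<otimes> y \<in> M" by (rule M.a_closed)
      moreover have "?e \<oplus> c \<otimes> y = v \<otimes> u"
        using v(1) uc kc(2) yc by (simp add: a_assoc l_minus l_neg)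
      ultimately show False using M.I_prime v uc uM by auto
    qed
  qed
  moreover have "colon J z \<subseteq> colon K x" using x K(2) unfolding N_def colon_def by fast
  moreover have "y \<in> colon K x" using yc xc K.I_r_closed[OF K(3)] by (auto simp: colon_def)
  ultimately show ?thesis using that[OF xc] by simp
qed

text \<open>The chain form of the inequality between the depth at \<open>M\<close> and dim R/p for
  an associated prime p inside \<open>M\<close>. The annihilator of \<open>z\<close> plays the role
  of p; for each element of the sequence \<open>colon_adjoin\<close> gives a larger colon ideal that
  contains this element and stays inside \<open>M\<close>.\<close>

lemma (in cring) regular_sequence_nzd_chain:
  assumes noeth: "noetherian_ring R" and M: "primeideal M R"
    and z: "z \<in> carrier R" "colon {\<zero>} z \<subseteq> M"
    and ys: "regular_sequence R ys" "set ys \<subseteq> M"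
  shows "\<exists>z'\<in>carrier R. colon (Idl (set ys)) z' \<subseteq> M \<and>
    nzd_chain R (length ys) (colon {\<zero>} z) (colon (Idl (set ys)) z')"
  using ys
proof (induction ys rule: rev_induct)
  case Nil
  have "Idl {} = {\<zero>}" using genideal_minimal[OF zeroideal, of "{}"] genideal_ideal[of "{}"]
    by (simp add: additive_subgroup.zero_closed ideal.axioms(1) subset_antisym)
  then show ?case using z by (auto intro!: bexI[of _ z] nzd_chain_refl ideal_colon zeroideal)
next
  case (snoc y ys)
  note reg = regular_sequence_append1D[OF snoc.prems(1)]
  have c: "set ys \<subseteq> carrier R" using reg(1) by (simp add: regular_sequence_def)
  then have J: "ideal (Idl (set ys)) R" by (rule genideal_ideal)
  have c': "set (ys @ [y]) \<subseteq> carrier R" using c reg(2) by auto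
  obtain z1 where z1: "z1 \<in> carrier R" "colon (Idl (set ys)) z1 \<subseteq> M"
    "nzd_chain R (length ys) (colon {\<zero>} z) (colon (Idl (set ys)) z1)"
    using snoc.IH[OF reg(1)] snoc.prems by auto
  obtain z' where z': "z' \<in> carrier R" "colon (Idl (set ys)) z1 \<subseteq> colon (Idl (set (ys @ [y]))) z'"
    "y \<in> colon (Idl (set (ys @ [y]))) z'" "colon (Idl (set (ys @ [y]))) z' \<subseteq> M"
  proof (rule colon_adjoin[OF noeth M J z1(1,2)])
    show "y \<in> M" using snoc.prems by simp
    show "ideal (Idl (set (ys @ [y]))) R" using c' by (rule genideal_ideal)
    show "Idl (set ys) \<subseteq> Idl (set (ys @ [y]))" using c' by (intro subset_Idl_subset) auto
    show "y \<in> Idl (set (ys @ [y]))" using genideal_self[OF c'] by auto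
    show "Idl (set (ys @ [y])) \<subseteq> adjoin (Idl (set ys)) y"
      using Idl_insert_subset_adjoin[OF c reg(2)] by simp
  qed (use reg in auto)
  have "nzd_chain R (Suc (length ys)) (colon {\<zero>} z) (colon (Idl (set (ys @ [y]))) z')"
  proof (rule nzd_chain_Suc[OF z1(3) _ z'(2,3)])
    show "ideal (colon (Idl (set (ys @ [y]))) z') R"
      using genideal_ideal[OF c'] z'(1) by (rule ideal_colon)
    fix r assume r: "r \<in> carrier R" "y \<otimes> r \<in> colon (Idl (set ys)) z1"
    then have "y \<otimes> (r \<otimes> z1) \<in> Idl (set ys)" using reg(2) z1(1) by (simp add: colon_def m_assoc)
    then show "r \<in> colon (Idl (set ys)) z1" using reg(3)[of "r \<otimes> z1"] r z1(1) by (simp add: colon_def)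
  qed
  with z'(1,4) show ?case by (intro bexI[of _ z']) simp_all
qed

section \<open>Dimension counting in polynomial rings\<close>

abbreviation const :: "'k::field \<Rightarrow> 'a::comm_monoid_add \<Rightarrow>\<^sub>0 'k" where
  "const c \<equiv> Poly_Mapping.single 0 c"

text \<open>A named scalar multiplication for the vector space interpretation. The exponent type is
  left general, so that it serves polynomial rings and the group ring of the lattice alike.\<close>

definition pscale :: "'k::field \<Rightarrow> ('a::comm_monoid_add \<Rightarrow>\<^sub>0 'k) \<Rightarrow> ('a \<Rightarrow>\<^sub>0 'k)" where
  "pscale c p = const c * p"

lemma vector_space_pscale: "vector_space (pscale :: 'k::field \<Rightarrow> ('a::comm_monoid_add \<Rightarrow>\<^sub>0 'k) \<Rightarrow> _)"
proof
  fix c d :: 'k and p q :: "'a \<Rightarrow>\<^sub>0 'k"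
  show "pscale c (p + q) = pscale c p + pscale c q" unfolding pscale_def by (rule distrib_left)
  show "pscale (c + d) p = pscale c p + pscale d p"
    unfolding pscale_def by (simp only: single_add distrib_right)
  show "pscale c (pscale d p) = pscale (c * d) p"
    unfolding pscale_def by (simp only: mult_single mult.assoc[symmetric] add_0)
  show "pscale 1 p = p" unfolding pscale_def by (simp only: single_one mult_1_left)
qed


global_interpretation pm: vector_space "pscale :: 'k::field \<Rightarrow> ('a::comm_monoid_add \<Rightarrow>\<^sub>0 'k) \<Rightarrow> _"
  by (rule vector_space_pscale)

lemma lookup_const_mult: "Poly_Mapping.lookup (const c * p) m = c * Poly_Mapping.lookup p m"
  by (simp add: mult_map_scale_conv_mult[symmetric] Poly_Mapping.map.rep_eq when_def)

lemma sum_keys_const_single: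
  fixes p :: "'a::comm_monoid_add \<Rightarrow>\<^sub>0 'k::field"
  assumes "finite X" "Poly_Mapping.keys p \<subseteq> X"
  shows "p = (\<Sum>m\<in>X. const (Poly_Mapping.lookup p m) * Poly_Mapping.single m 1)"
proof (rule poly_mapping_eqI)
  fix k
  have "(\<Sum>m\<in>X. Poly_Mapping.lookup (Poly_Mapping.single m (Poly_Mapping.lookup p m)) k)
      = (\<Sum>m\<in>X. if m = k then Poly_Mapping.lookup p k else 0)"
    by (rule sum.cong) (auto simp: lookup_single)
  also have "\<dots> = Poly_Mapping.lookup p k"
    using assms by (auto simp: in_keys_iff)
  finally show "Poly_Mapping.lookup p k =
      Poly_Mapping.lookup (\<Sum>m\<in>X. const (Poly_Mapping.lookup p m) * Poly_Mapping.single m 1) k"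
    by (simp add: lookup_sum mult_single)
qed

section \<open>The polynomial ring in the variables of \<open>V\<close> and its ideals\<close>

lemma mpoly_ring_simps [simp]:
  "mult (mpoly_ring V) = (*)" "one (mpoly_ring V) = 1" "zero (mpoly_ring V) = 0" "add (mpoly_ring V) = (+)"
  by (simp_all add: mpoly_ring_def)

lemma carrier_mpoly_ring: "p \<in> carrier (mpoly_ring V) \<longleftrightarrow> (\<forall>m\<in>Poly_Mapping.keys p. Poly_Mapping.keys m \<subseteq> V)"
  by (simp add: mpoly_ring_def)

lemma keys_plus_nat: "Poly_Mapping.keys (a + b :: 'v \<Rightarrow>\<^sub>0 nat) = Poly_Mapping.keys a \<union> Poly_Mapping.keys b"
  by (auto simp: in_keys_iff lookup_add)

lemma single_carrier: "Poly_Mapping.keys m \<subseteq> V \<Longrightarrow> Poly_Mapping.single m c \<in> carrier (mpoly_ring V)"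
  by (simp add: carrier_mpoly_ring)

lemma const_carrier: "const c \<in> carrier (mpoly_ring V)"
  by (simp add: carrier_mpoly_ring)

lemma plus_carrier:
  "p \<in> carrier (mpoly_ring V) \<Longrightarrow> q \<in> carrier (mpoly_ring V) \<Longrightarrow> p + q \<in> carrier (mpoly_ring V)"
  using keys_add[of p q] by (auto simp: carrier_mpoly_ring)

lemma times_carrier:
  "p \<in> carrier (mpoly_ring V) \<Longrightarrow> q \<in> carrier (mpoly_ring V) \<Longrightarrow> p * q \<in> carrier (mpoly_ring V)"
  using keys_mult[of p q] unfolding carrier_mpoly_ring by (fastforce simp: keys_plus_nat)

lemma uminus_carrier: "p \<in> carrier (mpoly_ring V) \<Longrightarrow> - p \<in> carrier (mpoly_ring V)"
  by (simp add: carrier_mpoly_ring in_keys_iff)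

lemma zero_carrier: "0 \<in> carrier (mpoly_ring V)" by (simp add: carrier_mpoly_ring)

lemma one_carrier: "1 \<in> carrier (mpoly_ring V)" by (simp add: carrier_mpoly_ring)

lemmas mpoly_carrier = plus_carrier times_carrier uminus_carrier zero_carrier one_carrier const_carrier

lemma sum_carrier:
  "(\<And>x. x \<in> X \<Longrightarrow> f x \<in> carrier (mpoly_ring V)) \<Longrightarrow> sum f X \<in> carrier (mpoly_ring V)"
  by (induction X rule: infinite_finite_induct) (auto intro: mpoly_carrier)

lemma power_carrier: "p \<in> carrier (mpoly_ring V) \<Longrightarrow> p ^ k \<in> carrier (mpoly_ring V)"
  by (induction k) (auto intro: mpoly_carrier)

lemma cring_mpoly_ring: "cring (mpoly_ring V :: ('v, 'k::field) mpoly ring)"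
proof (rule cringI)
  show "abelian_group (mpoly_ring V :: ('v, 'k) mpoly ring)"
  proof (rule abelian_groupI)
    fix x :: "('v, 'k) mpoly" assume "x \<in> carrier (mpoly_ring V)"
    then show "\<exists>y\<in>carrier (mpoly_ring V). y \<oplus>\<^bsub>mpoly_ring V\<^esub> x = \<zero>\<^bsub>mpoly_ring V\<^esub>"
      by (intro bexI[of _ "- x"]) (auto intro: mpoly_carrier)
  qed (auto intro: mpoly_carrier)
  show "Group.comm_monoid (mpoly_ring V :: ('v, 'k) mpoly ring)"
    by (rule comm_monoidI) (auto intro: mpoly_carrier simp: ac_simps)
qed (simp add: distrib_right)

lemma mpoly_nat_pow:
  fixes p :: "('v, 'k::field) mpoly"
  shows "p [^]\<^bsub>mpoly_ring V\<^esub> (n::nat) = p ^ n"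
proof -
  interpret cring "mpoly_ring V :: ('v, 'k) mpoly ring" by (rule cring_mpoly_ring)
  show ?thesis by (induction n) (simp_all add: mult.commute)
qed

lemma mpoly_idealI:
  assumes "J \<subseteq> carrier (mpoly_ring V)" "0 \<in> J" "\<And>x y. x \<in> J \<Longrightarrow> y \<in> J \<Longrightarrow> x + y \<in> J"
    "\<And>r x. r \<in> carrier (mpoly_ring V) \<Longrightarrow> x \<in> J \<Longrightarrow> r * x \<in> J"
  shows "ideal J (mpoly_ring V :: ('v, 'k::field) mpoly ring)"
  using assms by (intro idealI_cring cring_mpoly_ring) auto

lemma mpoly_idealD:
  assumes "ideal J (mpoly_ring V :: ('v, 'k::field) mpoly ring)"
  shows "J \<subseteq> carrier (mpoly_ring V)" "0 \<in> J" "x \<in> J \<Longrightarrow> y \<in> J \<Longrightarrow> x + y \<in> J"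
    "r \<in> carrier (mpoly_ring V) \<Longrightarrow> x \<in> J \<Longrightarrow> r * x \<in> J" "x \<in> J \<Longrightarrow> - x \<in> J"
    "x \<in> J \<Longrightarrow> y \<in> J \<Longrightarrow> x - y \<in> J"
proof -
  interpret ideal J "mpoly_ring V :: ('v, 'k) mpoly ring" by fact
  show "J \<subseteq> carrier (mpoly_ring V)" using Icarr by blast
  show "0 \<in> J" using additive_subgroup.zero_closed[OF ideal.axioms(1)[OF assms]] by simp
  show add: "x \<in> J \<Longrightarrow> y \<in> J \<Longrightarrow> x + y \<in> J" for x y
    using additive_subgroup.a_closed[OF ideal.axioms(1)[OF assms]] by simp
  show mult: "r \<in> carrier (mpoly_ring V) \<Longrightarrow> x \<in> J \<Longrightarrow> r * x \<in> J" for r x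
    using I_l_closed[of x r] by simp
  show neg: "x \<in> J \<Longrightarrow> - x \<in> J" for x
    using mult[of "- 1" x] by (simp add: mpoly_carrier)
  show "x \<in> J \<Longrightarrow> y \<in> J \<Longrightarrow> x - y \<in> J" using add[of x "- y"] neg[of y] by simp
qed

lemma mpoly_ideal_sum:
  assumes "ideal J (mpoly_ring V :: ('v, 'k::field) mpoly ring)" "\<And>x. x \<in> X \<Longrightarrow> f x \<in> J"
  shows "sum f X \<in> J"
  using assms(2) by (induction X rule: infinite_finite_induct) (auto intro: mpoly_idealD[OF assms(1)])

section \<open>Counting dimensions and lengths of chains\<close>

text \<open>Steinitz exchange for an indexed family. Independence of the family includes injectivity
  of \<open>g\<close>, as the relation with coefficients 1 and -1 shows.\<close>

lemma (in vector_space) card_le_of_independent_family: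
  assumes X: "finite X" and ind: "\<And>c. (\<Sum>x\<in>X. scale (c x) (g x)) = 0 \<Longrightarrow> \<forall>x\<in>X. c x = 0"
    and T: "finite T" "g ` X \<subseteq> span T"
  shows "card X \<le> card T"
proof -
  have inj: "inj_on g X"
  proof (rule inj_onI, rule ccontr)
    fix x y assume xy: "x \<in> X" "y \<in> X" "g x = g y" "x \<noteq> y"
    define c :: "_ \<Rightarrow> 'a" where "c z = (if z = x then 1 else if z = y then -1 else 0)" for z
    have "(\<Sum>z\<in>X. scale (c z) (g z)) = (\<Sum>z\<in>{x, y}. scale (c z) (g z))"
      using X xy by (intro sum.mono_neutral_right) (auto simp: c_def)
    also have "\<dots> = 0" using xy by (simp add: c_def)
    finally have "c x = 0" using ind xy by blast
    then show False by (simp add: c_def)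
  qed
  have "independent (g ` X)"
  proof (rule independent_if_scalars_zero)
    fix f y assume s: "(\<Sum>y\<in>g ` X. scale (f y) y) = 0" and y: "y \<in> g ` X"
    have "(\<Sum>x\<in>X. scale (f (g x)) (g x)) = 0" using s by (simp add: sum.reindex[OF inj])
    then have "\<forall>x\<in>X. f (g x) = 0" by (rule ind)
    then show "f y = 0" using y by blast
  qed (use X in simp)
  from independent_span_bound[OF T(1) this T(2)] show ?thesis
    by (simp add: card_image[OF inj])
qed

text \<open>If \<open>a\<close> exceeded \<open>b\<close>, the value
  \<open>D = c * K ^ b + 1\<close> would already violate the bound; one value replaces an asymptotic
  comparison.\<close>

lemma exponent_le_of_power_bound:
  fixes a b c K :: nat
  assumes "\<And>D. D \<ge> 1 \<Longrightarrow> D ^ a \<le> c * (K * D) ^ b"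
  shows "a \<le> b"
proof (rule ccontr)
  assume "\<not> a \<le> b"
  define D where "D = c * K ^ b + 1"
  have D: "D \<ge> 1" by (simp add: D_def)
  have "D * D ^ b = D ^ Suc b" by simp
  also have "\<dots> \<le> D ^ a" using D \<open>\<not> a \<le> b\<close> by (intro power_increasing) auto
  also have "\<dots> \<le> c * K ^ b * D ^ b" using assms[OF D] by (simp add: power_mult_distrib mult.assoc)
  finally have "D \<le> c * K ^ b" using D by simp
  then show False by (simp add: D_def)
qed

text \<open>The bound concerns each variable separately rather than the total degree, so that the
  monomials concerned fill a box whose size is immediate.\<close>

definition exp_bounded :: "('v, 'k::field) mpoly \<Rightarrow> nat \<Rightarrow> bool" where
  "exp_bounded p e \<longleftrightarrow> (\<forall>m\<in>Poly_Mapping.keys p. \<forall>v. Poly_Mapping.lookup m v \<le> e)"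

lemma exp_bounded_one: "exp_bounded 1 0"
  by (simp add: exp_bounded_def)

lemma exp_bounded_mult: "exp_bounded p a \<Longrightarrow> exp_bounded q b \<Longrightarrow> exp_bounded (p * q) (a + b)"
  using keys_mult[of p q] unfolding exp_bounded_def by (fastforce simp: lookup_add intro: add_mono)

lemma exp_bounded_power: "exp_bounded p a \<Longrightarrow> exp_bounded (p ^ k) (k * a)"
  by (induction k) (auto intro: exp_bounded_mult exp_bounded_one)

lemma exp_bounded_mono: "exp_bounded p a \<Longrightarrow> a \<le> b \<Longrightarrow> exp_bounded p b"
  unfolding exp_bounded_def by (meson le_trans)

lemma exp_bounded_exists: "\<exists>e. exp_bounded p e"
proof -
  let ?f = "\<lambda>m v. Poly_Mapping.lookup m v :: nat"
  have "?f m v \<le> (\<Sum>m\<in>Poly_Mapping.keys p. \<Sum>v\<in>Poly_Mapping.keys m. ?f m v)" 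
    if "m \<in> Poly_Mapping.keys p" for m v
  proof -
    have "?f m v \<le> (\<Sum>v\<in>Poly_Mapping.keys m. ?f m v)"
      by (cases "v \<in> Poly_Mapping.keys m") (auto intro: member_le_sum simp: in_keys_iff)
    also have "\<dots> \<le> (\<Sum>m\<in>Poly_Mapping.keys p. \<Sum>v\<in>Poly_Mapping.keys m. ?f m v)"
      using that by (intro member_le_sum[of m _ "\<lambda>m. \<Sum>v\<in>Poly_Mapping.keys m. ?f m v"]) auto
    finally show ?thesis .
  qed
  then show ?thesis unfolding exp_bounded_def by blast
qed

definition mono_box :: "'v set \<Rightarrow> nat \<Rightarrow> ('v \<Rightarrow>\<^sub>0 nat) set" where
  "mono_box V E = {m. Poly_Mapping.keys m \<subseteq> V \<and> (\<forall>v. Poly_Mapping.lookup m v \<le> E)}"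

lemma mono_box:
  assumes "finite V"
  shows "finite (mono_box V E)" "card (mono_box V E) \<le> (E + 1) ^ card V"
proof -
  let ?f = "\<lambda>m. restrict (Poly_Mapping.lookup m) V"
  have inj: "inj_on ?f (mono_box V E)"
  proof (rule inj_onI, rule poly_mapping_eqI)
    fix m m' v assume *: "m \<in> mono_box V E" "m' \<in> mono_box V E" "?f m = ?f m'"
    show "Poly_Mapping.lookup m v = Poly_Mapping.lookup m' v"
    proof (cases "v \<in> V")
      case True then show ?thesis using fun_cong[OF *(3), of v] by simp
    next
      case False
      then have "v \<notin> Poly_Mapping.keys m" "v \<notin> Poly_Mapping.keys m'" using * by (auto simp: mono_box_def)
      then show ?thesis by (simp add: in_keys_iff)
    qed
  qed
  have im: "?f ` mono_box V E \<subseteq> V \<rightarrow>\<^sub>E {..E}" by (auto simp: mono_box_def)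
  have fin: "finite (V \<rightarrow>\<^sub>E {..E})" using assms by (intro finite_PiE) auto
  show "finite (mono_box V E)" using inj im fin by (rule inj_on_finite)
  have "card (mono_box V E) \<le> card (V \<rightarrow>\<^sub>E {..E})" using inj im fin by (rule card_inj_on_le)
  then show "card (mono_box V E) \<le> (E + 1) ^ card V" using assms by (simp add: card_PiE)
qed

lemma mem_span_monomials:
  fixes p :: "('v, 'k::field) mpoly"
  assumes "\<And>m. m \<in> Poly_Mapping.keys p \<Longrightarrow> m \<in> X"
  shows "p \<in> pm.span ((\<lambda>m. Poly_Mapping.single m 1) ` X)"
proof -
  have "(\<Sum>m\<in>Poly_Mapping.keys p. const (Poly_Mapping.lookup p m) * Poly_Mapping.single m 1)
      \<in> pm.span ((\<lambda>m. Poly_Mapping.single m 1) ` X)"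
    unfolding pscale_def[symmetric] using assms by (intro pm.span_sum pm.span_scale pm.span_base) auto
  then show ?thesis using sum_keys_const_single[of "Poly_Mapping.keys p" p] by simp
qed

text \<open>Modulo \<open>B\<close> only \<open>g 0\<close> remains, so it vanishes; one factor
  \<open>f\<close> is then cancelled modulo \<open>A\<close> and the induction goes on. That
  \<open>g k\<close> in \<open>B\<close> forces \<open>g k = 0\<close> stands for independence
  modulo \<open>B\<close>.\<close>

lemma nzd_power_sum_zero:
  fixes f :: "('v, 'k::field) mpoly"
  assumes A: "ideal A (mpoly_ring V)" and B: "ideal B (mpoly_ring V)" "A \<subseteq> B" "f \<in> B"
    and nzd: "\<And>r. r \<in> carrier (mpoly_ring V) \<Longrightarrow> f * r \<in> A \<Longrightarrow> r \<in> A"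
    and g: "\<And>k. k < D \<Longrightarrow> g k \<in> carrier (mpoly_ring V)" "\<And>k. k < D \<Longrightarrow> g k \<in> B \<Longrightarrow> g k = 0"
    and sum: "(\<Sum>k<D. f ^ k * g k) \<in> A"
  shows "\<forall>k<D. g k = 0"
  using g sum
proof (induction D arbitrary: g)
  case (Suc D)
  have fc: "f \<in> carrier (mpoly_ring V)" using B mpoly_idealD(1)[OF B(1)] by blast
  define r where "r = (\<Sum>k<D. f ^ k * g (Suc k))"
  have rc: "r \<in> carrier (mpoly_ring V)"
    unfolding r_def using Suc.prems(1) fc by (intro sum_carrier times_carrier power_carrier) auto
  have eq: "(\<Sum>k<Suc D. f ^ k * g k) = g 0 + r * f"
    by (simp add: sum.lessThan_Suc_shift r_def sum_distrib_left mult.commute[of _ f] mult.left_commute[of _ f] mult.assoc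
        del: sum.lessThan_Suc)
  have "r * f \<in> B" using mpoly_idealD(4)[OF B(1) rc B(3)] .
  then have "(g 0 + r * f) - r * f \<in> B"
    using Suc.prems(3) B(2) unfolding eq by (intro mpoly_idealD(6)[OF B(1)]) auto
  then have g0: "g 0 = 0" using Suc.prems(2)[of 0] by simp
  then have "r \<in> A" using Suc.prems(3) nzd[OF rc] unfolding eq by (simp add: mult.commute)
  have "\<forall>k<D. g (Suc k) = 0"
  proof (rule Suc.IH)
    show "(\<Sum>k<D. f ^ k * g (Suc k)) \<in> A" using \<open>r \<in> A\<close> unfolding r_def .
  qed (use Suc.prems(1,2) in blast)+
  with g0 show ?case by (auto simp: less_Suc_eq_0_disj)
qed simp

definition tuples :: "nat \<Rightarrow> nat \<Rightarrow> nat list set" where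
  "tuples n D = {xs. set xs \<subseteq> {..<D} \<and> length xs = n}"

lemma finite_tuples: "finite (tuples n D)"
  unfolding tuples_def by (rule finite_lists_length_eq) simp

lemma card_tuples: "card (tuples n D) = D ^ n"
  unfolding tuples_def by (subst card_lists_length_eq) simp_all

lemma sum_tuples_Suc: "(\<Sum>xs\<in>tuples (Suc n) D. h xs) = (\<Sum>k<D. \<Sum>xs\<in>tuples n D. h (k # xs))"
proof -
  have inj: "inj_on (\<lambda>(k, xs). k # xs) ({..<D} \<times> tuples n D)" by (auto simp: inj_on_def)
  have "tuples (Suc n) D = (\<lambda>(k, xs). k # xs) ` ({..<D} \<times> tuples n D)"
    by (auto simp: tuples_def length_Suc_conv image_iff)
  then have "(\<Sum>xs\<in>tuples (Suc n) D. h xs) = (\<Sum>(k, xs)\<in>{..<D} \<times> tuples n D. h (k # xs))"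
    using sum.reindex[OF inj, of h] by (simp add: o_def case_prod_unfold)
  then show ?thesis by (simp add: sum.cartesian_product)
qed

text \<open>The elements of the chain are algebraically independent modulo the bottom ideal.\<close>

lemma nzd_chain_independent:
  assumes "nzd_chain (mpoly_ring V :: ('v, 'k::field) mpoly ring) n A C" "1 \<notin> C"
  shows "\<exists>G e. (\<forall>xs. G xs \<in> carrier (mpoly_ring V) \<and> exp_bounded (G xs) (e * sum_list xs)) \<and>
    (\<forall>D c. (\<Sum>xs\<in>tuples n D. const (c xs) * G xs) \<in> A \<longrightarrow> (\<forall>xs\<in>tuples n D. c xs = (0::'k)))"
  using assms
proof (induction rule: nzd_chain.induct)
  case (nzd_chain_refl A)
  have "c = 0" if "const c \<in> A" for c :: 'k
  proof (rule ccontr)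
    assume "c \<noteq> 0"
    then have "const (inverse c) * const c = (1 :: ('v, 'k) mpoly)" by (simp add: mult_single)
    then show False
      using mpoly_idealD(4)[OF nzd_chain_refl(1) const_carrier that, of "inverse c"] nzd_chain_refl(2) by (simp only: simp_thms)
  qed
  then have "\<forall>xs\<in>tuples 0 D. c xs = 0" if "(\<Sum>xs\<in>tuples 0 D. const (c xs) * 1) \<in> A" 
    for D and c :: "nat list \<Rightarrow> 'k"
  proof -
    have "tuples 0 D = {[]}" by (auto simp: tuples_def)
    then show ?thesis using that \<open>\<And>c. const c \<in> A \<Longrightarrow> c = 0\<close> by simp
  qed
  then show ?case
    by (intro exI[of _ "\<lambda>_. 1"] exI[of _ 0]) (auto intro: mpoly_carrier exp_bounded_one)
next
  case (nzd_chain_step A B f n C)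
  have idB: "ideal B (mpoly_ring V)" using nzd_chain_ideal[OF nzd_chain_step(5)] by blast
  have fc: "f \<in> carrier (mpoly_ring V)" using nzd_chain_step(3) mpoly_idealD(1)[OF idB] by blast
  obtain G e where G: "\<And>xs. G xs \<in> carrier (mpoly_ring V)" "\<And>xs. exp_bounded (G xs) (e * sum_list xs)"
    and ind: "\<And>D c. (\<Sum>xs\<in>tuples n D. const (c xs) * G xs) \<in> B \<Longrightarrow> (\<forall>xs\<in>tuples n D. c xs = (0::'k))"
    using nzd_chain_step.IH nzd_chain_step.prems by blast
  obtain e' where e': "exp_bounded f e'" using exp_bounded_exists by blast
  \<comment> \<open>Along the chain this produces the monomials in the chosen nonzerodivisors, one
    exponent per list entry. The value at the empty list is a default: the lists summed over have
    length \<open>Suc n\<close>.\<close>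
  define H where "H xs = (case xs of [] \<Rightarrow> 0 | k # ys \<Rightarrow> f ^ k * G ys)" for xs
  have "exp_bounded (H xs) ((e + e') * sum_list xs)" for xs
  proof (cases xs)
    case Nil
    then show ?thesis by (simp add: H_def exp_bounded_def)
  next
    case (Cons k ys)
    have "exp_bounded (f ^ k * G ys) ((e + e') * sum_list xs)"
      using exp_bounded_mult[OF exp_bounded_power[OF e', of k] G(2)[of ys]]
      by (rule exp_bounded_mono) (simp add: Cons algebra_simps)
    then show ?thesis by (simp add: H_def Cons)
  qed
  moreover have "H xs \<in> carrier (mpoly_ring V)" for xs
    using G fc by (cases xs) (auto simp: H_def intro: times_carrier power_carrier zero_carrier)
  moreover have "\<forall>xs\<in>tuples (Suc n) D. c xs = 0"
    if s: "(\<Sum>xs\<in>tuples (Suc n) D. const (c xs) * H xs) \<in> A" for D and c :: "nat list \<Rightarrow> 'k"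
  proof -
    define g where "g k = (\<Sum>xs\<in>tuples n D. const (c (k # xs)) * G xs)" for k
    have g: "c (k # xs) = 0" if "g k \<in> B" "xs \<in> tuples n D" for k xs
      using ind[of "\<lambda>xs. c (k # xs)"] that unfolding g_def by blast
    have "(\<Sum>k<D. f ^ k * g k) \<in> A"
      using s by (simp add: sum_tuples_Suc H_def g_def sum_distrib_left mult.left_commute)
    moreover have "g k \<in> carrier (mpoly_ring V)" for k
      unfolding g_def using G by (intro sum_carrier times_carrier const_carrier)
    moreover have "g k = 0" if "g k \<in> B" for k
      using g[OF that] unfolding g_def by (intro sum.neutral) auto
    ultimately have "\<forall>k<D. g k = 0"
      using nzd_chain_step(4) by (intro nzd_power_sum_zero[OF nzd_chain_step(1) idB nzd_chain_step(2,3)]) auto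
    then have "\<forall>k<D. \<forall>xs\<in>tuples n D. c (k # xs) = 0" using g mpoly_idealD(2)[OF idB] by auto
    then show ?thesis by (auto simp: tuples_def length_Suc_conv)
  qed
  ultimately show ?case by blast
qed

text \<open>The \<open>D ^ n\<close> products of powers with exponents below \<open>D\<close> are
  independent modulo \<open>A\<close>, while all of them lie in the span of a box of monomials whose
  side is linear in \<open>D\<close>. Letting \<open>D\<close> grow compares the exponents.\<close>

theorem nzd_chain_length_le:
  assumes V: "finite V" and ch: "nzd_chain (mpoly_ring V :: ('v, 'k::field) mpoly ring) n A C" "1 \<notin> C"
  shows "n \<le> card V"
proof -
  obtain G e where G: "\<And>xs. G xs \<in> carrier (mpoly_ring V)" "\<And>xs. exp_bounded (G xs) (e * sum_list xs)"
    and ind: "\<And>D c. (\<Sum>xs\<in>tuples n D. const (c xs) * G xs) \<in> A \<Longrightarrow> (\<forall>xs\<in>tuples n D. c xs = (0::'k))"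
    using nzd_chain_independent[OF ch] by blast
  have A0: "0 \<in> A" using nzd_chain_ideal[OF ch(1)] mpoly_idealD(2) by blast
  \<comment> \<open>The box has side \<open>e * (n * D) + 1\<close>; for \<open>D \<ge> 1\<close>
    this is at most \<open>(e * n + 1) * D\<close>, the shape that
    \<open>exponent_le_of_power_bound\<close> expects.\<close>
  have "D ^ n \<le> 1 * ((e * n + 1) * D) ^ card V" if D: "D \<ge> 1" for D
  proof -
    let ?T = "(\<lambda>m. Poly_Mapping.single m 1 :: ('v, 'k) mpoly) ` mono_box V (e * (n * D))"
    have "G xs \<in> pm.span ?T" if xs: "xs \<in> tuples n D" for xs
    proof (rule mem_span_monomials)
      fix m assume m: "m \<in> Poly_Mapping.keys (G xs)"
      have "sum_list xs \<le> n * D"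
        using xs sum_list_mono[of xs "\<lambda>x. x" "\<lambda>_. D"] by (force simp: tuples_def sum_list_triv)
      then have "exp_bounded (G xs) (e * (n * D))" using exp_bounded_mono[OF G(2)[of xs]] by simp
      then show "m \<in> mono_box V (e * (n * D))"
        using G(1)[of xs] m by (auto simp: mono_box_def exp_bounded_def carrier_mpoly_ring)
    qed
    then have "card (tuples n D) \<le> card ?T"
      using mono_box(1)[OF V] finite_tuples
    proof (intro pm.card_le_of_independent_family[of "tuples n D" G])
      fix c assume "(\<Sum>xs\<in>tuples n D. pscale (c xs) (G xs)) = 0"
      then show "\<forall>xs\<in>tuples n D. c xs = 0" using ind[of c D] A0 by (simp add: pscale_def)
    qed auto
    also have "\<dots> \<le> card (mono_box V (e * (n * D)))" by (rule card_image_le) (simp add: mono_box V)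
    also have "\<dots> \<le> (e * (n * D) + 1) ^ card V" by (rule mono_box) (rule V)
    also have "\<dots> \<le> ((e * n + 1) * D) ^ card V" using D by (intro power_mono) (auto simp: algebra_simps)
    finally show ?thesis by (simp add: card_tuples)
  qed
  then show ?thesis by (rule exponent_le_of_power_bound)
qed

section \<open>Toric kernels\<close>

text \<open>Linear extension of a map on exponents. It serves for the toric map, for maps between
  group rings and for projections to graded parts, so \<open>F\<close> is arbitrary and
  multiplicativity is a separate hypothesis.\<close>

definition ev :: "('a \<Rightarrow> ('b::comm_monoid_add \<Rightarrow>\<^sub>0 'k::field)) \<Rightarrow> ('a \<Rightarrow>\<^sub>0 'k) \<Rightarrow> ('b \<Rightarrow>\<^sub>0 'k)" where
  "ev F p = (\<Sum>m\<in>Poly_Mapping.keys p. const (Poly_Mapping.lookup p m) * F m)"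

lemma ev_superset:
  assumes "finite X" "Poly_Mapping.keys p \<subseteq> X"
  shows "ev F p = (\<Sum>m\<in>X. const (Poly_Mapping.lookup p m) * F m)"
  unfolding ev_def using assms by (intro sum.mono_neutral_left) (auto simp: in_keys_iff)

lemma ev_add: "ev F (p + q) = ev F p + ev F q"
proof -
  let ?X = "Poly_Mapping.keys p \<union> Poly_Mapping.keys q"
  have "ev F (p + q) = (\<Sum>m\<in>?X. const (Poly_Mapping.lookup (p + q) m) * F m)"
    by (rule ev_superset) (use keys_add[of p q] in auto)
  also have "\<dots> = (\<Sum>m\<in>?X. const (Poly_Mapping.lookup p m) * F m) + (\<Sum>m\<in>?X. const (Poly_Mapping.lookup q m) * F m)"
    by (simp add: lookup_add single_add distrib_right sum.distrib)
  also have "\<dots> = ev F p + ev F q"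
    using ev_superset[of ?X p F] ev_superset[of ?X q F] by simp
  finally show ?thesis .
qed

lemma ev_zero [simp]: "ev F 0 = 0" by (simp add: ev_def)

lemma ev_single: "ev F (Poly_Mapping.single m c) = const c * F m"
  by (cases "c = 0") (simp_all add: ev_def)

lemma ev_const_mult:
  fixes p :: "'a::comm_monoid_add \<Rightarrow>\<^sub>0 'k::field"
  shows "ev F (const c * p) = const c * ev F p"
proof -
  have "Poly_Mapping.keys (const c * p) \<subseteq> Poly_Mapping.keys p"
    by (auto simp: in_keys_iff lookup_const_mult)
  then have "ev F (const c * p) = (\<Sum>m\<in>Poly_Mapping.keys p. const (Poly_Mapping.lookup (const c * p) m) * F m)"
    by (intro ev_superset) auto
  also have "\<dots> = const c * ev F p"
    by (simp add: lookup_const_mult ev_def sum_distrib_left mult.assoc[symmetric] mult_single)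
  finally show ?thesis .
qed

lemma ev_sum: "ev F (sum f X) = (\<Sum>x\<in>X. ev F (f x))"
  by (induction X rule: infinite_finite_induct) (simp_all add: ev_add)

lemma ev_uminus:
  fixes p :: "'a::comm_monoid_add \<Rightarrow>\<^sub>0 'k::field"
  shows "ev F (- p) = - ev F p"
  using ev_add[of F p "- p"] by (simp add: eq_neg_iff_add_eq_0 add.commute)

lemma ev_diff:
  fixes p :: "'a::comm_monoid_add \<Rightarrow>\<^sub>0 'k::field"
  shows "ev F (p - q) = ev F p - ev F q"
  using ev_add[of F p "- q"] by (simp add: ev_uminus)

lemma ev_mult:
  fixes p :: "'a::comm_monoid_add \<Rightarrow>\<^sub>0 'k::field"
  assumes "\<And>a b. F (a + b) = F a * F b"
  shows "ev F (p * q) = ev F p * ev F q"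
proof -
  let ?s = "\<lambda>(p :: 'a \<Rightarrow>\<^sub>0 'k) m. Poly_Mapping.single m (Poly_Mapping.lookup p m)"
  have eq: "p = sum (?s p) (Poly_Mapping.keys p)" for p :: "'a \<Rightarrow>\<^sub>0 'k"
    using sum_keys_const_single[of "Poly_Mapping.keys p" p] by (simp add: mult_single)
  have "p * q = sum (?s p) (Poly_Mapping.keys p) * sum (?s q) (Poly_Mapping.keys q)"
    by (rule arg_cong2[OF eq eq])
  also have "\<dots> = (\<Sum>m\<in>Poly_Mapping.keys p. \<Sum>n\<in>Poly_Mapping.keys q. ?s p m * ?s q n)"
    by (rule sum_product)
  also have "ev F \<dots> = (\<Sum>m\<in>Poly_Mapping.keys p. \<Sum>n\<in>Poly_Mapping.keys q.
      (const (Poly_Mapping.lookup p m) * F m) * (const (Poly_Mapping.lookup q n) * F n))"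
    unfolding ev_sum mult_single ev_single assms
  proof (intro sum.cong refl)
    fix m n
    have "const (Poly_Mapping.lookup p m * Poly_Mapping.lookup q n) =
        (const (Poly_Mapping.lookup p m) * const (Poly_Mapping.lookup q n) :: 'b \<Rightarrow>\<^sub>0 'k)"
      by (simp add: mult_single)
    then show "const (Poly_Mapping.lookup p m * Poly_Mapping.lookup q n) * (F m * F n) =
        (const (Poly_Mapping.lookup p m) * F m) * (const (Poly_Mapping.lookup q n) * F n)"
      by (simp only: ac_simps)
  qed
  also have "\<dots> = ev F p * ev F q"
    by (simp add: ev_def sum_product)
  finally show ?thesis .
qed

section \<open>Integer exponents, projections along a lattice, and toric kernels\<close>

definition zexp :: "('v \<Rightarrow>\<^sub>0 nat) \<Rightarrow> ('v \<Rightarrow>\<^sub>0 int)" where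
  "zexp m = Poly_Mapping.map int m"

definition pos_part :: "('v \<Rightarrow>\<^sub>0 int) \<Rightarrow> ('v \<Rightarrow>\<^sub>0 nat)" where
  "pos_part t = Poly_Mapping.map nat t"

lemma lookup_zexp [simp]: "Poly_Mapping.lookup (zexp m) v = int (Poly_Mapping.lookup m v)"
  by (simp add: zexp_def Poly_Mapping.map.rep_eq when_def)

lemma lookup_pos_part [simp]: "Poly_Mapping.lookup (pos_part t) v = nat (Poly_Mapping.lookup t v)"
  by (simp add: pos_part_def Poly_Mapping.map.rep_eq when_def)

lemma zexp_add: "zexp (a + b) = zexp a + zexp b"
  by (rule poly_mapping_eqI) (simp add: lookup_add)

lemma zexp_zero [simp]: "zexp 0 = 0"
  by (rule poly_mapping_eqI) simp

lemma zexp_inj: "zexp a = zexp b \<longleftrightarrow> a = b"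
  by (metis lookup_zexp of_nat_eq_iff poly_mapping_eqI)

lemma zexp_pos_part: "zexp (pos_part t) - zexp (pos_part (- t)) = t"
  by (rule poly_mapping_eqI) (simp add: lookup_minus)

lemma keys_pos_part: "Poly_Mapping.keys (pos_part t) \<subseteq> Poly_Mapping.keys t"
  "Poly_Mapping.keys (pos_part (- t)) \<subseteq> Poly_Mapping.keys t"
  by (auto simp: in_keys_iff)

text \<open>An entry \<open>(b, t)\<close> with \<open>t b = 1\<close> eliminates \<open>b\<close> by means of the lattice vector \<open>t\<close>. For a triangular list
  below, \<open>red L\<close> is the projection of \<open>\<int>\<^sup>V\<close> along the lattice spanned by the vectors of \<open>L\<close>, and \<open>tker V Z L\<close> is the
  kernel of the induced map from \<open>K[V]\<close> to the group ring of \<open>\<int>\<^sup>V\<close> that sends the variables in \<open>Z\<close> to \<open>0\<close>.\<close>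

fun red :: "('v \<times> ('v \<Rightarrow>\<^sub>0 int)) list \<Rightarrow> ('v \<Rightarrow>\<^sub>0 int) \<Rightarrow> ('v \<Rightarrow>\<^sub>0 int)" where
  "red [] u = u"
| "red ((b, t) # L) u = red L (u - frag_cmul (Poly_Mapping.lookup u b) t)"

lemma red_append: "red (L @ L') u = red L' (red L u)"
  by (induction L arbitrary: u) auto

lemma red_add: "red L (u + v) = red L u + red L v"
proof (induction L arbitrary: u v)
  case (Cons a L)
  obtain b t where a: "a = (b, t)" by force
  have eq: "u + v - frag_cmul (Poly_Mapping.lookup (u + v) b) t =
      (u - frag_cmul (Poly_Mapping.lookup u b) t) + (v - frag_cmul (Poly_Mapping.lookup v b) t)"
    by (simp add: lookup_add frag_cmul_distrib)
  show ?case by (simp only: a red.simps eq Cons.IH)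
qed simp

lemma red_zero [simp]: "red L 0 = 0"
  using red_add[of L 0 0] by simp

lemma red_diff: "red L (u - v) = red L u - red L v"
  using red_add[of L "u - v" v] by simp

lemma red_fixed: "\<forall>x\<in>set L. Poly_Mapping.lookup u (fst x) = 0 \<Longrightarrow> red L u = u"
  by (induction L) auto

definition toric_mon :: "'v set \<Rightarrow> ('v \<times> ('v \<Rightarrow>\<^sub>0 int)) list \<Rightarrow> ('v \<Rightarrow>\<^sub>0 nat) \<Rightarrow> (('v \<Rightarrow>\<^sub>0 int) \<Rightarrow>\<^sub>0 'k::field)" where
  "toric_mon Z L m = (if Poly_Mapping.keys m \<inter> Z = {} then Poly_Mapping.single (red L (zexp m)) 1 else 0)"

lemma toric_mon_add: "toric_mon Z L (a + b) = toric_mon Z L a * toric_mon Z L b"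
  by (auto simp: toric_mon_def keys_plus_nat mult_single zexp_add red_add Int_Un_distrib2)

lemma toric_mon_zero [simp]: "toric_mon Z L 0 = 1"
  by (simp add: toric_mon_def)

definition tker :: "'v set \<Rightarrow> 'v set \<Rightarrow> ('v \<times> ('v \<Rightarrow>\<^sub>0 int)) list \<Rightarrow> ('v, 'k::field) mpoly set" where
  "tker V Z L = {p \<in> carrier (mpoly_ring V). ev (toric_mon Z L) p = 0}"

text \<open>The kernel of a ring homomorphism into a group ring; the linear order on the variables
  induces one on the exponents and makes the group ring a domain.\<close>

lemma tker_prime: "primeideal (tker V Z L) (mpoly_ring V :: ('v::linorder, 'k::field) mpoly ring)"
proof -
  have id: "ideal (tker V Z L) (mpoly_ring V :: ('v, 'k) mpoly ring)"
    by (rule mpoly_idealI)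
      (auto simp: tker_def ev_add ev_mult[OF toric_mon_add] intro: mpoly_carrier)
  show ?thesis
  proof (rule primeidealI[OF id cring_mpoly_ring])
    have "ev (toric_mon Z L) (1 :: ('v, 'k) mpoly) = 1"
      using ev_single[of "toric_mon Z L" 0 "1::'k"] by simp
    then have "(1 :: ('v, 'k) mpoly) \<notin> tker V Z L" by (simp add: tker_def)
    then show "carrier (mpoly_ring V) \<noteq> (tker V Z L :: ('v, 'k) mpoly set)"
      using one_carrier by blast
  qed (auto simp: tker_def ev_mult[OF toric_mon_add])
qed

lemma tker_ideal: "ideal (tker V Z L) (mpoly_ring V :: ('v::linorder, 'k::field) mpoly ring)"
  using tker_prime by (rule primeideal.axioms)

lemma one_notin_prime: "primeideal P (mpoly_ring V :: ('v, 'k::field) mpoly ring) \<Longrightarrow> 1 \<notin> P"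
  using primeideal.I_notcarr ideal.one_imp_carrier[OF primeideal.axioms(1)] by fastforce

lemma tker_mono: "tker V Z L \<subseteq> (tker V Z (L @ L') :: ('v, 'k::field) mpoly set)"
proof
  fix p :: "('v, 'k) mpoly" assume p: "p \<in> tker V Z L"
  have "toric_mon Z (L @ L') m = ev (\<lambda>u. Poly_Mapping.single (red L' u) (1::'k)) (toric_mon Z L m)" for m
    by (simp add: toric_mon_def ev_single red_append)
  then have "ev (toric_mon Z (L @ L')) p = ev (\<lambda>u. Poly_Mapping.single (red L' u) 1) (ev (toric_mon Z L) p)"
    by (simp add: ev_def[of "toric_mon Z L"] ev_def[of "toric_mon Z (L @ L')"] ev_sum ev_const_mult)
  then show "p \<in> tker V Z (L @ L')" using p by (simp add: tker_def)
qed

definition binom :: "('v \<Rightarrow>\<^sub>0 int) \<Rightarrow> ('v, 'k::field) mpoly" where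
  "binom t = Poly_Mapping.single (pos_part t) 1 - Poly_Mapping.single (pos_part (- t)) 1"

lemma diff_carrier:
  "p \<in> carrier (mpoly_ring V) \<Longrightarrow> q \<in> carrier (mpoly_ring V) \<Longrightarrow> p - q \<in> carrier (mpoly_ring V)"
  using plus_carrier[of p V "- q"] uminus_carrier[of q V] by simp

text \<open>Both monomials avoid \<open>Z\<close> and go to single group elements, which coincide
  exactly if the difference of the exponents reduces to 0.\<close>

lemma binom_mem_tker:
  assumes "Poly_Mapping.keys t \<subseteq> V - Z"
  shows "(binom t :: ('v, 'k::field) mpoly) \<in> tker V Z L \<longleftrightarrow> red L t = 0"
proof -
  have k: "Poly_Mapping.keys (pos_part t) \<subseteq> V - Z" "Poly_Mapping.keys (pos_part (- t)) \<subseteq> V - Z"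
    using order_trans[OF keys_pos_part(1) assms] order_trans[OF keys_pos_part(2) assms] by simp_all
  then have *: "Poly_Mapping.keys (pos_part t) \<inter> Z = {}" "Poly_Mapping.keys (pos_part (- t)) \<inter> Z = {}"
    "Poly_Mapping.keys (pos_part t) \<subseteq> V" "Poly_Mapping.keys (pos_part (- t)) \<subseteq> V" by auto
  have "binom t \<in> (carrier (mpoly_ring V) :: ('v, 'k) mpoly set)"
    unfolding binom_def using * by (intro diff_carrier single_carrier)
  moreover have "ev (toric_mon Z L) (binom t :: ('v, 'k) mpoly) =
      Poly_Mapping.single (red L (zexp (pos_part t))) 1 - Poly_Mapping.single (red L (zexp (pos_part (- t)))) 1"
    using * by (simp add: binom_def ev_diff ev_single toric_mon_def)
  moreover have "red L t = red L (zexp (pos_part t)) - red L (zexp (pos_part (- t)))"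
    by (simp flip: red_diff add: zexp_pos_part)
  moreover have "Poly_Mapping.single x (1::'k) = Poly_Mapping.single y 1 \<longleftrightarrow> x = y" for x y :: "'v \<Rightarrow>\<^sub>0 int"
  proof
    assume eq: "Poly_Mapping.single x (1::'k) = Poly_Mapping.single y 1"
    have "Poly_Mapping.lookup (Poly_Mapping.single x (1::'k)) x \<noteq> 0" by simp
    then show "x = y" unfolding eq by (simp add: lookup_single when_def split: if_splits)
  qed simp
  ultimately show ?thesis by (simp add: tker_def)
qed

text \<open>Later vectors vanish at earlier pivots, while an earlier vector may involve later
  pivots. Thus a vector of the list reaches its own entry unchanged and is killed there.\<close>

definition triangular :: "('v \<times> ('v \<Rightarrow>\<^sub>0 int)) list \<Rightarrow> bool" where
  "triangular L \<longleftrightarrow> sorted_wrt (\<lambda>x y. Poly_Mapping.lookup (snd y) (fst x) = 0) L \<and>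
     (\<forall>x\<in>set L. Poly_Mapping.lookup (snd x) (fst x) = 1)"

lemma red_member:
  assumes "triangular L" "(b, t) \<in> set L"
  shows "red L t = 0"
proof -
  obtain xs ys where L: "L = xs @ (b, t) # ys" using split_list[OF assms(2)] by blast
  have "red xs t = t"
    using assms(1) by (intro red_fixed) (force simp: triangular_def L sorted_wrt_append)
  moreover have "Poly_Mapping.lookup t b = 1" using assms by (force simp: triangular_def)
  ultimately show ?thesis by (simp add: L red_append)
qed

text \<open>The new vector vanishes at all old pivots, so the old reduction fixes it and the new one
  kills it; its binomial separates the two kernels.\<close>

lemma tker_strict:
  assumes "triangular (L @ [x])" "Poly_Mapping.keys (snd x) \<subseteq> V - Z"
  shows "tker V Z L \<subset> (tker V Z (L @ [x]) :: ('v, 'k::field) mpoly set)"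
proof -
  have "red (L @ [x]) (snd x) = 0" by (rule red_member[OF assms(1), of "fst x"]) simp
  moreover have "red L (snd x) = snd x"
    using assms(1) by (intro red_fixed) (force simp: triangular_def sorted_wrt_append)
  moreover have "snd x \<noteq> 0" using assms(1) by (auto simp: triangular_def)
  ultimately have "(binom (snd x) :: ('v, 'k) mpoly) \<in> tker V Z (L @ [x])"
    "(binom (snd x) :: ('v, 'k) mpoly) \<notin> tker V Z L"
    by (simp_all add: binom_mem_tker[OF assms(2)])
  then show ?thesis using tker_mono[of V Z L "[x]"] by blast
qed

lemma triangular_appendD: "triangular (L @ L') \<Longrightarrow> triangular L"
  by (auto simp: triangular_def sorted_wrt_append)

text \<open>Each further lattice vector gives one step. For unit vectors the element added is x_v -
  1, so that free variables are set to 1.\<close>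

lemma tker_nzd_chain:
  assumes "triangular (L @ L')" "\<And>x. x \<in> set L' \<Longrightarrow> Poly_Mapping.keys (snd x) \<subseteq> V - Z"
  shows "nzd_chain (mpoly_ring V) (length L') (tker V Z L) (tker V Z (L @ L') :: ('v::linorder, 'k::field) mpoly set)"
  using assms
proof (induction L' rule: rev_induct)
  case Nil
  then show ?case by (simp add: nzd_chain_refl tker_ideal)
next
  case (snoc x L')
  have tri: "triangular ((L @ L') @ [x])" using snoc.prems(1) by simp
  have "nzd_chain (mpoly_ring V) (length L') (tker V Z L) (tker V Z (L @ L') :: ('v, 'k) mpoly set)"
    using snoc.IH triangular_appendD[OF tri] snoc.prems(2) by simp
  from nzd_chain_primes_Suc[OF this tker_prime tker_prime tker_strict[OF tri]] snoc.prems(2)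
  show ?case by simp
qed

text \<open>The same kernels, started at the empty list, bound the height of the last one from
  below.\<close>

lemma tker_prime_chain:
  assumes "triangular L" "\<And>x. x \<in> set L \<Longrightarrow> Poly_Mapping.keys (snd x) \<subseteq> V"
  shows "prime_chain (mpoly_ring V) (length L) (tker V {} L :: ('v::linorder, 'k::field) mpoly set)"
  using assms
proof (induction L rule: rev_induct)
  case Nil
  then show ?case by (simp add: prime_chain_0 tker_prime)
next
  case (snoc x L)
  have "prime_chain (mpoly_ring V) (length L) (tker V {} L :: ('v, 'k) mpoly set)"
    using snoc.IH triangular_appendD[OF snoc.prems(1)] snoc.prems(2) by simp
  from prime_chain_Suc[OF this tker_prime tker_strict[OF snoc.prems(1)]] snoc.prems(2)
  show ?case by simp
qed

section \<open>Saturation by monomials and the lattice ideal\<close>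

definition saturation :: "'v set \<Rightarrow> ('v, 'k::field) mpoly set \<Rightarrow> ('v, 'k) mpoly set" where
  "saturation V I = {f \<in> carrier (mpoly_ring V).
     \<exists>m. Poly_Mapping.keys m \<subseteq> V \<and> Poly_Mapping.single m 1 * f \<in> I}"

lemma saturation_ideal:
  assumes I: "ideal I (mpoly_ring V :: ('v, 'k::field) mpoly ring)"
  shows "ideal (saturation V I) (mpoly_ring V)"
proof (rule mpoly_idealI)
  show "0 \<in> saturation V I"
    using mpoly_idealD(2)[OF I] by (auto simp: saturation_def zero_carrier intro!: exI[of _ 0])
  fix x y :: "('v, 'k) mpoly" assume "x \<in> saturation V I" "y \<in> saturation V I"
  then obtain m n where *: "x \<in> carrier (mpoly_ring V)" "y \<in> carrier (mpoly_ring V)"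
    "Poly_Mapping.keys m \<subseteq> V" "Poly_Mapping.keys n \<subseteq> V"
    "Poly_Mapping.single m 1 * x \<in> I" "Poly_Mapping.single n 1 * y \<in> I"
    by (auto simp: saturation_def)
  have "Poly_Mapping.single (m + n) 1 * (x + y) = Poly_Mapping.single n 1 * (Poly_Mapping.single m 1 * x)
      + Poly_Mapping.single m 1 * (Poly_Mapping.single n 1 * y)"
    using mult_single[of m "1::'k" n 1] by (simp add: algebra_simps)
  moreover have "\<dots> \<in> I"
    by (intro mpoly_idealD(3)[OF I] mpoly_idealD(4)[OF I _ *(5)] mpoly_idealD(4)[OF I _ *(6)] single_carrier *(3,4))
  ultimately show "x + y \<in> saturation V I"
    using * by (auto simp: saturation_def keys_plus_nat plus_carrier intro!: exI[of _ "m + n"])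
next
  fix r x :: "('v, 'k) mpoly"
  assume r: "r \<in> carrier (mpoly_ring V)" and "x \<in> saturation V I"
  then obtain m where *: "x \<in> carrier (mpoly_ring V)" "Poly_Mapping.keys m \<subseteq> V"
    "Poly_Mapping.single m 1 * x \<in> I" by (auto simp: saturation_def)
  have "Poly_Mapping.single m 1 * (r * x) \<in> I"
    using mpoly_idealD(4)[OF I r *(3)] by (simp add: mult.left_commute)
  then show "r * x \<in> saturation V I" using r * by (auto simp: saturation_def times_carrier)
qed (auto simp: saturation_def)

lemma saturation_superset: "ideal I (mpoly_ring V) \<Longrightarrow> I \<subseteq> saturation V I"
  using mpoly_idealD(1)[of I V] by (auto simp: saturation_def intro!: exI[of _ 0])

lemma saturation_cancel:
  fixes f :: "('v, 'k::field) mpoly"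
  assumes "f \<in> carrier (mpoly_ring V)" "Poly_Mapping.keys m \<subseteq> V" "Poly_Mapping.single m 1 * f \<in> saturation V I"
  shows "f \<in> saturation V I"
proof -
  obtain n where n: "Poly_Mapping.keys n \<subseteq> V" "Poly_Mapping.single n 1 * (Poly_Mapping.single m 1 * f) \<in> I"
    using assms by (auto simp: saturation_def)
  then have "Poly_Mapping.single (n + m) 1 * f \<in> I"
    using mult_single[of n "1::'k" m 1] by (simp add: mult.assoc[symmetric])
  then show ?thesis using assms n by (auto simp: saturation_def keys_plus_nat intro!: exI[of _ "n + m"])
qed

definition null_exp :: "'v set \<Rightarrow> ('v, 'k::field) mpoly set \<Rightarrow> ('v \<Rightarrow>\<^sub>0 int) \<Rightarrow> bool" where
  "null_exp V J e \<longleftrightarrow> (\<exists>u u'. Poly_Mapping.keys u \<subseteq> V \<and> Poly_Mapping.keys u' \<subseteq> V \<and>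
     e = zexp u - zexp u' \<and> Poly_Mapping.single u 1 - Poly_Mapping.single u' 1 \<in> J)"

context
  fixes V :: "'v set" and J :: "('v, 'k::field) mpoly set"
  assumes J: "ideal J (mpoly_ring V)"
begin

lemma null_exp_zero: "null_exp V J 0"
  unfolding null_exp_def using mpoly_idealD(2)[OF J] by (intro exI[of _ 0]) auto

lemma null_exp_add:
  assumes "null_exp V J e" "null_exp V J e'"
  shows "null_exp V J (e + e')"
proof -
  obtain u u' v v' where *: "Poly_Mapping.keys u \<subseteq> V" "Poly_Mapping.keys u' \<subseteq> V" "e = zexp u - zexp u'"
    "Poly_Mapping.single u 1 - Poly_Mapping.single u' 1 \<in> J"
    "Poly_Mapping.keys v \<subseteq> V" "Poly_Mapping.keys v' \<subseteq> V" "e' = zexp v - zexp v'"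
    "Poly_Mapping.single v 1 - Poly_Mapping.single v' 1 \<in> J"
    using assms unfolding null_exp_def by blast
  have "Poly_Mapping.single (u + v) 1 - Poly_Mapping.single (u' + v') (1::'k) =
      Poly_Mapping.single v 1 * (Poly_Mapping.single u 1 - Poly_Mapping.single u' 1) +
      Poly_Mapping.single u' 1 * (Poly_Mapping.single v 1 - Poly_Mapping.single v' 1)"
    by (simp add: right_diff_distrib mult_single add.commute)
  also have "\<dots> \<in> J"
    by (intro mpoly_idealD(3)[OF J] mpoly_idealD(4)[OF J _ *(4)] mpoly_idealD(4)[OF J _ *(8)] single_carrier *(2,5))
  finally show ?thesis
    unfolding null_exp_def using *
    by (intro exI[of _ "u + v"] exI[of _ "u' + v'"]) (auto simp: keys_plus_nat zexp_add)
qed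

lemma null_exp_uminus: "null_exp V J e \<Longrightarrow> null_exp V J (- e)"
  unfolding null_exp_def by (metis minus_diff_eq mpoly_idealD(5)[OF J])

lemma null_exp_cmul:
  assumes "null_exp V J e"
  shows "null_exp V J (frag_cmul k e)"
proof -
  have nat: "null_exp V J (frag_cmul (int n) e)" for n
    by (induction n) (auto simp: null_exp_zero frag_cmul_distrib intro: null_exp_add assms)
  show ?thesis
  proof (cases "k \<ge> 0")
    case True then show ?thesis using nat[of "nat k"] by simp
  next
    case False
    then have "frag_cmul k e = - frag_cmul (int (nat (- k))) e" by (simp add: minus_frag_cmul)
    then show ?thesis using null_exp_uminus[OF nat, of "nat (- k)"] by simp
  qed
qed

text \<open>Only integer multiples of the listed vectors are subtracted by \<open>red\<close>, so
  the total change stays in the subgroup.\<close>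

lemma null_exp_red:
  "(\<And>x. x \<in> set L \<Longrightarrow> null_exp V J (snd x)) \<Longrightarrow> null_exp V J (u - red L u)"
proof (induction L arbitrary: u)
  case (Cons x L)
  obtain b t where x: "x = (b, t)" by force
  let ?u = "u - frag_cmul (Poly_Mapping.lookup u b) t"
  have "null_exp V J (frag_cmul (Poly_Mapping.lookup u b) t + (?u - red L ?u))"
    using Cons.IH Cons.prems Cons.prems[of x] x by (intro null_exp_add null_exp_cmul) simp_all
  then show ?case by (simp add: x)
qed (simp add: null_exp_zero)

end

lemma null_exp_binom:
  assumes "Poly_Mapping.keys t \<subseteq> V" "(binom t :: ('v, 'k::field) mpoly) \<in> J"
  shows "null_exp V J t"
  unfolding null_exp_def
  using assms keys_pos_part[of t] zexp_pos_part[of t] unfolding binom_def by (metis order_trans)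

text \<open>Modulo the saturation the chosen pair does not matter: two binomials with the same
  exponent difference agree after multiplication by monomials, and these can be cancelled.\<close>

lemma null_exp_cancel:
  fixes I :: "('v, 'k::field) mpoly set"
  assumes I: "ideal I (mpoly_ring V)" and n: "null_exp V (saturation V I) (zexp u - zexp u')"
    and u: "Poly_Mapping.keys u \<subseteq> V" "Poly_Mapping.keys u' \<subseteq> V"
  shows "Poly_Mapping.single u 1 - Poly_Mapping.single u' 1 \<in> saturation V I"
proof -
  note sat = saturation_ideal[OF I]
  obtain v v' where v: "Poly_Mapping.keys v \<subseteq> V" "Poly_Mapping.keys v' \<subseteq> V"
    "zexp u - zexp u' = zexp v - zexp v'" "Poly_Mapping.single v 1 - Poly_Mapping.single v' 1 \<in> saturation V I"
    using n unfolding null_exp_def by blast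
  have "zexp (v' + u) = zexp (u' + v)" using v(3) by (simp add: zexp_add algebra_simps)
  then have uv: "v' + u = u' + v" by (simp only: zexp_inj)
  have "Poly_Mapping.single v' 1 * (Poly_Mapping.single u 1 - Poly_Mapping.single u' (1::'k)) =
      Poly_Mapping.single u' 1 * (Poly_Mapping.single v 1 - Poly_Mapping.single v' 1)"
    by (simp add: right_diff_distrib mult_single uv add.commute[of v' u'])
  also have "\<dots> \<in> saturation V I" using v u by (intro mpoly_idealD(4)[OF sat] single_carrier)
  finally have "Poly_Mapping.single v' 1 * (Poly_Mapping.single u 1 - Poly_Mapping.single u' 1) \<in> saturation V I" .
  from saturation_cancel[OF _ v(2) this] show ?thesis using u by (simp add: diff_carrier single_carrier)
qed

text \<open>Modulo the saturation, monomials with equal reduced exponents agree. Choosing one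
  representative per class turns \<open>f\<close> into a combination whose coefficients are those of
  its toric image, hence into 0.\<close>

lemma tker_subset_saturation:
  fixes I :: "('v, 'k::field) mpoly set"
  assumes I: "ideal I (mpoly_ring V)"
    and L: "\<And>x. x \<in> set L \<Longrightarrow> Poly_Mapping.keys (snd x) \<subseteq> V \<and> binom (snd x) \<in> I"
  shows "tker V {} L \<subseteq> saturation V I"
proof
  note sat = saturation_ideal[OF I]
  fix f :: "('v, 'k) mpoly" assume f: "f \<in> tker V {} L"
  let ?w = "\<lambda>m. red L (zexp m)"
  define r where "r t = (SOME m. m \<in> Poly_Mapping.keys f \<and> ?w m = t)" for t
  have keysV: "Poly_Mapping.keys m \<subseteq> V" if "m \<in> Poly_Mapping.keys f" for m
    using f that by (auto simp: tker_def carrier_mpoly_ring)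
  have r: "r (?w m) \<in> Poly_Mapping.keys f" "?w (r (?w m)) = ?w m" if "m \<in> Poly_Mapping.keys f" for m
    using someI[of "\<lambda>m'. m' \<in> Poly_Mapping.keys f \<and> ?w m' = ?w m" m] that unfolding r_def by auto
  have null: "null_exp V (saturation V I) (u - red L u)" for u
    using L saturation_superset[OF I] by (intro null_exp_red[OF sat] null_exp_binom) auto
  have "Poly_Mapping.single m 1 - Poly_Mapping.single (r (?w m)) 1 \<in> saturation V I"
    if m: "m \<in> Poly_Mapping.keys f" for m
  proof (rule null_exp_cancel[OF I])
    have "null_exp V (saturation V I) ((zexp m - ?w m) + - (zexp (r (?w m)) - ?w (r (?w m))))"
      by (intro null_exp_add[OF sat] null_exp_uminus[OF sat] null)
    then show "null_exp V (saturation V I) (zexp m - zexp (r (?w m)))" using r[OF m] by simp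
  qed (use keysV r m in auto)
  then have "(\<Sum>m\<in>Poly_Mapping.keys f. const (Poly_Mapping.lookup f m) *
      (Poly_Mapping.single m 1 - Poly_Mapping.single (r (?w m)) 1)) \<in> saturation V I" (is "?s \<in> _")
    by (intro mpoly_ideal_sum[OF sat] mpoly_idealD(4)[OF sat] const_carrier)
  also have "?s = f - (\<Sum>m\<in>Poly_Mapping.keys f. const (Poly_Mapping.lookup f m) * Poly_Mapping.single (r (?w m)) 1)"
    using sum_keys_const_single[of "Poly_Mapping.keys f" f] by (simp add: right_diff_distrib sum_subtractf)
  \<comment> \<open>The subtracted sum is the toric image of \<open>f\<close> with every group
    element replaced by its representative monomial.\<close>
  also have "(\<Sum>m\<in>Poly_Mapping.keys f. const (Poly_Mapping.lookup f m) * Poly_Mapping.single (r (?w m)) 1)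
      = ev (\<lambda>t. Poly_Mapping.single (r t) 1) (ev (toric_mon {} L) f)"
    by (simp add: ev_def[of "toric_mon {} L"] ev_sum ev_const_mult toric_mon_def ev_single)
  also have "\<dots> = 0" using f by (simp add: tker_def)
  finally show "f \<in> saturation V I" by simp
qed

section \<open>The lattice of a collection of cells\<close>

definition corners :: "(int \<times> int) set set \<Rightarrow> (int \<times> int) set" where
  "corners \<C> = {x. cell (fst x) (snd x) \<in> \<C>}"

definition upper :: "int \<times> int \<Rightarrow> int \<times> int" where
  "upper x = (fst x + 1, snd x + 1)"

definition cell_vec :: "int \<times> int \<Rightarrow> (int \<times> int) \<Rightarrow>\<^sub>0 int" where
  "cell_vec x = Poly_Mapping.single x 1 + Poly_Mapping.single (upper x) 1
     - Poly_Mapping.single (fst x, snd x + 1) 1 - Poly_Mapping.single (fst x + 1, snd x) 1"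

text \<open>The pivot of a cell is its lexicographically greatest vertex, and the cells come in
  descending order of their lower left corners, so no later cell contains an earlier pivot.\<close>

definition cell_pivots :: "(int \<times> int) set \<Rightarrow> ((int \<times> int) \<times> ((int \<times> int) \<Rightarrow>\<^sub>0 int)) list" where
  "cell_pivots K = map (\<lambda>x. (upper x, cell_vec x)) (rev (sorted_list_of_set K))"

text \<open>These entries set the variables in \<open>F\<close> to 1.\<close>

definition var_pivots :: "(int \<times> int) set \<Rightarrow> ((int \<times> int) \<times> ((int \<times> int) \<Rightarrow>\<^sub>0 int)) list" where
  "var_pivots F = map (\<lambda>v. (v, Poly_Mapping.single v 1)) (sorted_list_of_set F)"

lemma lookup_cell_vec:
  "Poly_Mapping.lookup (cell_vec (i, j)) v =
     (if v = (i, j) \<or> v = (i + 1, j + 1) then 1 else if v = (i, j + 1) \<or> v = (i + 1, j) then -1 else 0)"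
  by (auto simp: cell_vec_def upper_def lookup_add lookup_minus lookup_single when_def)

lemma keys_cell_vec: "Poly_Mapping.keys (cell_vec x) = cell (fst x) (snd x)"
  by (cases x) (auto simp: in_keys_iff lookup_cell_vec cell_def split: if_splits)

lemma upper_mem_cell: "upper x \<in> cell (fst x) (snd x)"
  by (simp add: upper_def cell_def)

lemma inj_upper: "inj upper"
  by (auto simp: inj_def upper_def prod_eq_iff)

lemma set_cell_pivots: "finite K \<Longrightarrow> set (cell_pivots K) = (\<lambda>x. (upper x, cell_vec x)) ` K"
  by (simp add: cell_pivots_def)

lemma set_var_pivots: "finite F \<Longrightarrow> set (var_pivots F) = (\<lambda>v. (v, Poly_Mapping.single v 1)) ` F"
  by (simp add: var_pivots_def)

text \<open>The unit vectors come last, since cells may involve the variables in \<open>F\<close>,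
  whereas a unit vector outside the cell pivots vanishes at all of them.\<close>

lemma triangular_pivots:
  assumes K: "finite K" and F: "finite F" "F \<inter> upper ` K = {}"
  shows "triangular (cell_pivots K @ var_pivots F)"
proof -
  have cc: "Poly_Mapping.lookup (cell_vec y) (upper x) = 0" if "y < x" for x y
    using that by (cases x; cases y) (auto simp: lookup_cell_vec upper_def)
  have "sorted_wrt (\<lambda>x y. y < x) (rev (sorted_list_of_set K))"
    by (simp add: sorted_wrt_rev strict_sorted_list_of_set)
  then have 1: "sorted_wrt (\<lambda>x y. Poly_Mapping.lookup (snd y) (fst x) = 0) (cell_pivots K)"
    unfolding cell_pivots_def sorted_wrt_map by (rule sorted_wrt_mono_rel[rotated]) (simp add: cc)
  have "sorted_wrt (<) (sorted_list_of_set F)" by (rule strict_sorted_list_of_set)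
  then have 2: "sorted_wrt (\<lambda>x y. Poly_Mapping.lookup (snd y) (fst x) = (0::int)) (var_pivots F)"
    unfolding var_pivots_def sorted_wrt_map
    by (rule sorted_wrt_mono_rel[rotated]) (auto simp: lookup_single when_def)
  have 3: "Poly_Mapping.lookup (Poly_Mapping.single v (1::int)) (upper x) = 0" if "x \<in> K" "v \<in> F" for x v
    using that F by (auto simp: lookup_single when_def)
  have 4: "Poly_Mapping.lookup (cell_vec x) (upper x) = 1" for x
    by (cases x) (simp add: lookup_cell_vec upper_def)
  show ?thesis
    unfolding triangular_def sorted_wrt_append
    using 1 2 3 4 K F by (auto simp: set_cell_pivots set_var_pivots)
qed

lemma triangular_cell_pivots: "finite K \<Longrightarrow> triangular (cell_pivots K)"
  using triangular_appendD[OF triangular_pivots[of K "{}"]] by simp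

lemma mvar_mult: "mvar v * mvar w = Poly_Mapping.single (Poly_Mapping.single v 1 + Poly_Mapping.single w 1) 1"
  by (simp add: mvar_def mult_single)

lemma binom_cell_vec: "binom (cell_vec x) = adjacent_minor (fst x) (snd x)"
proof (cases x)
  case (Pair i j)
  have "pos_part (cell_vec x) = Poly_Mapping.single (i, j) 1 + Poly_Mapping.single (i + 1, j + 1) 1"
    by (rule poly_mapping_eqI) (auto simp: Pair lookup_cell_vec lookup_add lookup_single when_def)
  moreover have "pos_part (- cell_vec x) = Poly_Mapping.single (i, j + 1) 1 + Poly_Mapping.single (i + 1, j) 1"
    by (rule poly_mapping_eqI) (auto simp: Pair lookup_cell_vec lookup_add lookup_single when_def)
  ultimately show ?thesis
    by (simp add: binom_def adjacent_minor_def mvar_mult Pair)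
qed

lemma I_adj_eq:
  "(I_adj \<C> :: (int \<times> int, 'k::field) mpoly set)
    = Idl\<^bsub>mpoly_ring (\<Union>\<C>)\<^esub> ((\<lambda>x. binom (cell_vec x)) ` corners \<C>)"
proof -
  have "{adjacent_minor i j :: (int \<times> int, 'k) mpoly |i j. cell i j \<in> \<C>} = (\<lambda>x. binom (cell_vec x)) ` corners \<C>"
  proof (intro equalityI subsetI)
    fix p :: "(int \<times> int, 'k) mpoly" assume "p \<in> {adjacent_minor i j |i j. cell i j \<in> \<C>}"
    then obtain i j where "p = adjacent_minor i j" "cell i j \<in> \<C>" by blast
    then show "p \<in> (\<lambda>x. binom (cell_vec x)) ` corners \<C>"
      by (intro image_eqI[of _ _ "(i, j)"]) (simp_all add: corners_def binom_cell_vec)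
  qed (auto simp: corners_def binom_cell_vec)
  then show ?thesis by (simp add: I_adj_def)
qed

lemma cell_subset: "x \<in> corners \<C> \<Longrightarrow> cell (fst x) (snd x) \<subseteq> \<Union>\<C>"
  by (auto simp: corners_def)

lemma binom_carrier: "Poly_Mapping.keys t \<subseteq> V \<Longrightarrow> binom t \<in> carrier (mpoly_ring V)"
  unfolding binom_def using keys_pos_part[of t] by (intro diff_carrier single_carrier) auto

lemma minors_carrier:
  "(\<lambda>x. binom (cell_vec x)) ` corners \<C> \<subseteq> carrier (mpoly_ring (\<Union>\<C>))"
  using cell_subset by (intro image_subsetI binom_carrier) (simp add: keys_cell_vec)

lemma I_adj_ideal: "ideal (I_adj \<C> :: (int \<times> int, 'k::field) mpoly set) (mpoly_ring (\<Union>\<C>))"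
proof -
  interpret cring "mpoly_ring (\<Union>\<C>) :: (int \<times> int, 'k) mpoly ring" by (rule cring_mpoly_ring)
  show ?thesis unfolding I_adj_eq by (rule genideal_ideal[OF minors_carrier])
qed

lemma minor_mem_I_adj: "x \<in> corners \<C> \<Longrightarrow> (binom (cell_vec x) :: (int \<times> int, 'k::field) mpoly) \<in> I_adj \<C>"
proof -
  interpret cring "mpoly_ring (\<Union>\<C>) :: (int \<times> int, 'k) mpoly ring" by (rule cring_mpoly_ring)
  show "x \<in> corners \<C> \<Longrightarrow> ?thesis" unfolding I_adj_eq using genideal_self[OF minors_carrier] by blast
qed

lemma I_adj_minimal:
  assumes "ideal J (mpoly_ring (\<Union>\<C>))" "\<And>x. x \<in> corners \<C> \<Longrightarrow> binom (cell_vec x) \<in> J"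
  shows "I_adj \<C> \<subseteq> (J :: (int \<times> int, 'k::field) mpoly set)"
proof -
  interpret cring "mpoly_ring (\<Union>\<C>) :: (int \<times> int, 'k) mpoly ring" by (rule cring_mpoly_ring)
  show ?thesis unfolding I_adj_eq using assms by (intro genideal_minimal) auto
qed

lemma cell_inj: "cell i j = cell k l \<Longrightarrow> i = k \<and> j = l"
proof -
  assume eq: "cell i j = cell k l"
  have "(i, j) \<in> cell k l" "(i + 1, j + 1) \<in> cell k l"
    unfolding eq[symmetric] by (simp_all add: cell_def)
  then show ?thesis by (auto simp: cell_def)
qed

lemma corners:
  assumes "finite \<C>" "\<C> \<subseteq> cells"
  shows "finite (corners \<C>)" "card (corners \<C>) = card \<C>" "finite (\<Union>\<C>)"
proof -
  have inj: "inj_on (\<lambda>x. cell (fst x) (snd x)) (corners \<C>)"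
    by (auto simp: inj_on_def prod_eq_iff dest: cell_inj)
  have "\<C> \<subseteq> (\<lambda>x. cell (fst x) (snd x)) ` corners \<C>"
    using assms(2) by (force simp: corners_def cells_def image_iff)
  then have im: "(\<lambda>x. cell (fst x) (snd x)) ` corners \<C> = \<C>" by (auto simp: corners_def)
  show "finite (corners \<C>)" by (rule finite_imageD[OF _ inj]) (simp add: im assms(1))
  show "card (corners \<C>) = card \<C>" using card_image[OF inj] im by simp
  have "finite C" if "C \<in> cells" for C using that by (auto simp: cells_def cell_def)
  then show "finite (\<Union>\<C>)" using assms by auto
qed

section \<open>A prime ideal of small height\<close>

text \<open>\<open>Z\<close> meets both the diagonal and the anti-diagonal of the cell, so both
  terms of the minor vanish together with the variables in \<open>Z\<close>.\<close>

definition covered :: "(int \<times> int) set \<Rightarrow> int \<times> int \<Rightarrow> bool" where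
  "covered Z x \<longleftrightarrow> (x \<in> Z \<or> upper x \<in> Z) \<and> ((fst x, snd x + 1) \<in> Z \<or> (fst x + 1, snd x) \<in> Z)"

lemma covered_mono: "covered Z x \<Longrightarrow> Z \<subseteq> Z' \<Longrightarrow> covered Z' x"
  by (auto simp: covered_def)

text \<open>A cell meeting \<open>Z\<close> without being covered becomes covered by one further vertex, so a
  maximal \<open>Z\<close> with fewer elements than covered cells has the required property.\<close>

lemma exists_covering:
  assumes fin: "finite (corners \<C>)" "finite (\<Union>\<C>)" and X: "x_pentomino i j \<subseteq> \<C>"
  obtains Z where "Z \<subseteq> \<Union>\<C>" "card Z < card {x \<in> corners \<C>. covered Z x}"
    "\<And>x. x \<in> corners \<C> \<Longrightarrow> cell (fst x) (snd x) \<inter> Z \<noteq> {} \<Longrightarrow> covered Z x"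
proof -
  define P where "P Z \<longleftrightarrow> Z \<subseteq> \<Union>\<C> \<and> card Z < card {x \<in> corners \<C>. covered Z x}" for Z
  let ?Z0 = "cell i j"
  \<comment> \<open>The corners of the five cells. A neighbour shares an edge with the central cell,
    and every edge joins a diagonal to an anti-diagonal corner, so all five cells are covered by
    four vertices: 4 < 5.\<close>
  let ?X = "{(i, j), (i + 1, j), (i - 1, j), (i, j + 1), (i, j - 1)}"
  have "P ?Z0"
    unfolding P_def
  proof
    show "?Z0 \<subseteq> \<Union>\<C>" using X by (auto simp: x_pentomino_def)
    have "card ?Z0 \<le> 4" by (auto simp: cell_def card_insert_if)
    also have "4 < card ?X" by (auto simp: card_insert_if)
    also have "?X \<subseteq> {x \<in> corners \<C>. covered ?Z0 x}"
      using X by (auto simp: x_pentomino_def corners_def covered_def cell_def upper_def)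
    then have "card ?X \<le> card {x \<in> corners \<C>. covered ?Z0 x}" using fin by (intro card_mono) auto
    finally show "card ?Z0 < card {x \<in> corners \<C>. covered ?Z0 x}" .
  qed
  moreover have "card Z \<le> card (\<Union>\<C>)" if "P Z" for Z
    using fin(2) that unfolding P_def by (intro card_mono) simp_all
  ultimately have "\<exists>Z. P Z \<and> (\<forall>Z'. P Z' \<longrightarrow> card Z' \<le> card Z)"
    by (intro ex_has_greatest_nat[of P ?Z0 card "Suc (card (\<Union>\<C>))"]) (simp_all add: less_Suc_eq_le)
  then obtain Z where Z: "P Z" and max: "\<And>Z'. P Z' \<Longrightarrow> card Z' \<le> card Z" by metis
  have finZ: "finite Z" using Z fin finite_subset by (auto simp: P_def)
  have "covered Z x" if x: "x \<in> corners \<C>" and meets: "cell (fst x) (snd x) \<inter> Z \<noteq> {}" for x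
  proof (rule ccontr)
    assume nc: "\<not> covered Z x"
    \<comment> \<open>\<open>Z\<close> meets exactly one of the two diagonals of this cell, and
      \<open>v\<close> is taken from the other.\<close>
    obtain v where v: "v \<in> cell (fst x) (snd x)" "v \<notin> Z" "covered (insert v Z) x"
      using meets nc by (cases x) (auto simp: covered_def cell_def upper_def)
    let ?G = "\<lambda>Z. {x \<in> corners \<C>. covered Z x}"
    have "x \<in> ?G (insert v Z)" "x \<notin> ?G Z" using x nc v by simp_all
    moreover have "?G Z \<subseteq> ?G (insert v Z)" using covered_mono[of Z _ "insert v Z"] by blast
    ultimately have "?G Z \<subset> ?G (insert v Z)" by blast
    then have "card (?G Z) < card (?G (insert v Z))" using fin by (intro psubset_card_mono) auto
    moreover have "insert v Z \<subseteq> \<Union>\<C>" using Z v(1) cell_subset[OF x] unfolding P_def by blast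
    ultimately have "P (insert v Z)" using Z finZ v(2) unfolding P_def by simp
    from max[OF this] show False using finZ v by simp
  qed
  with Z that[of Z] show ?thesis unfolding P_def by simp
qed

lemma ev_toric_mvar:
  "ev (toric_mon Z L) (mvar v :: ('v, 'k::field) mpoly) = 0" if "v \<in> Z"
  using that by (simp add: mvar_def ev_single toric_mon_def)

text \<open>A cell avoiding \<open>Z\<close> contributes a lattice vector that \<open>red\<close>
  kills; in every other cell the variables in \<open>Z\<close> kill both terms of the minor.\<close>

lemma I_adj_subset_tker:
  assumes "finite (corners \<C>)"
    and Z: "\<And>x. x \<in> corners \<C> \<Longrightarrow> cell (fst x) (snd x) \<inter> Z \<noteq> {} \<Longrightarrow> covered Z x"
    and K: "K = {x \<in> corners \<C>. cell (fst x) (snd x) \<inter> Z = {}}"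
  shows "I_adj \<C> \<subseteq> (tker (\<Union>\<C>) Z (cell_pivots K) :: (int \<times> int, 'k::field) mpoly set)"
proof (rule I_adj_minimal[OF tker_ideal])
  fix x assume x: "x \<in> corners \<C>"
  have finK: "finite K" using assms(1) K by simp
  show "(binom (cell_vec x) :: (int \<times> int, 'k) mpoly) \<in> tker (\<Union>\<C>) Z (cell_pivots K)"
  proof (cases "x \<in> K")
    case True
    then have "red (cell_pivots K) (cell_vec x) = 0"
      using finK by (intro red_member[of _ "upper x"] triangular_cell_pivots) (auto simp: set_cell_pivots)
    moreover have "Poly_Mapping.keys (cell_vec x) \<subseteq> \<Union>\<C> - Z"
      using True K cell_subset[OF x] by (auto simp: keys_cell_vec)
    ultimately show ?thesis using binom_mem_tker by blast
  next
    case False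
    then have cov: "covered Z x" using Z[OF x] x K by auto
    have "ev (toric_mon Z (cell_pivots K)) (adjacent_minor (fst x) (snd x) :: (int \<times> int, 'k) mpoly) = 0"
      unfolding adjacent_minor_def ev_diff ev_mult[OF toric_mon_add]
      using cov by (cases x) (auto simp: covered_def upper_def ev_toric_mvar)
    then show ?thesis
      using binom_carrier[of "cell_vec x" "\<Union>\<C>", where ?'b = 'k] cell_subset[OF x]
      by (simp add: tker_def keys_cell_vec binom_cell_vec)
  qed
qed

text \<open>Vertices that are neither killed nor pivots. If the cells of \<open>K\<close> avoid
  \<open>Z\<close>, these variables stay independent modulo the toric prime and their number is the
  dimension of its quotient.\<close>

definition free_vars :: "(int \<times> int) set \<Rightarrow> (int \<times> int) set \<Rightarrow> (int \<times> int) set \<Rightarrow> (int \<times> int) set" where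
  "free_vars V Z K = V - Z - upper ` K"

lemma card_free_vars:
  assumes V: "finite V" and Z: "Z \<subseteq> V" and K: "\<And>x. x \<in> K \<Longrightarrow> cell (fst x) (snd x) \<subseteq> V - Z"
  shows "card (free_vars V Z K) + card Z + card K = card V"
proof -
  have up: "upper ` K \<subseteq> V - Z" using K upper_mem_cell by blast
  have "card (free_vars V Z K) + card (upper ` K) = card (V - Z)"
    unfolding free_vars_def using V up finite_subset[OF up] card_mono[OF _ up]
    by (subst card_Diff_subset) auto
  moreover have "card (upper ` K) = card K" using inj_upper by (simp add: card_image inj_on_subset)
  moreover have "card (V - Z) + card Z = card V"
    using V Z finite_subset[OF Z V] by (simp add: card_Diff_subset card_mono)
  ultimately show ?thesis by simp
qed

text \<open>A chain up to the toric prime is prolonged by one step per free variable, which is set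
  to 1; the total is at most \<open>card V\<close>.\<close>

lemma nzd_chain_tker_le:
  fixes A :: "(int \<times> int, 'k::field) mpoly set"
  assumes V: "finite V" and Z: "Z \<subseteq> V" and K: "finite K" "\<And>x. x \<in> K \<Longrightarrow> cell (fst x) (snd x) \<subseteq> V - Z"
    and ch: "nzd_chain (mpoly_ring V) h A (tker V Z (cell_pivots K))"
  shows "h \<le> card Z + card K"
proof -
  let ?F = "free_vars V Z K"
  have fin: "finite ?F" using V by (simp add: free_vars_def)
  have "nzd_chain (mpoly_ring V) (length (var_pivots ?F))
      (tker V Z (cell_pivots K)) (tker V Z (cell_pivots K @ var_pivots ?F) :: (int \<times> int, 'k) mpoly set)"
    using fin K(1)
    by (intro tker_nzd_chain triangular_pivots) (auto simp: set_var_pivots free_vars_def)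
  from nzd_chain_trans[OF ch this]
  have "h + length (var_pivots ?F) \<le> card V"
    by (rule nzd_chain_length_le[OF V _ one_notin_prime[OF tker_prime]])
  moreover have "card ?F + card Z + card K = card V" using K(2) by (rule card_free_vars[OF V Z])
  ultimately show ?thesis by (simp add: var_pivots_def)
qed

text \<open>By \<open>nzd_chain_tker_le\<close> the prime in the last line has height at most \<open>card Z + card K\<close>.\<close>

lemma exists_small_prime:
  fixes \<C> :: "(int \<times> int) set set"
  assumes fin: "finite \<C>" "\<C> \<subseteq> cells" and X: "contains_x_pentomino \<C>"
  obtains Z K where "Z \<subseteq> \<Union>\<C>" "K \<subseteq> corners \<C>" "\<And>x. x \<in> K \<Longrightarrow> cell (fst x) (snd x) \<subseteq> \<Union>\<C> - Z"
    "card Z + card K < card \<C>"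
    "I_adj \<C> \<subseteq> (tker (\<Union>\<C>) Z (cell_pivots K) :: (int \<times> int, 'k::field) mpoly set)"
proof -
  note c = corners[OF fin]
  obtain i j where "x_pentomino i j \<subseteq> \<C>" using X by (auto simp: contains_x_pentomino_def)
  then obtain Z where Z: "Z \<subseteq> \<Union>\<C>" "card Z < card {x \<in> corners \<C>. covered Z x}"
    "\<And>x. x \<in> corners \<C> \<Longrightarrow> cell (fst x) (snd x) \<inter> Z \<noteq> {} \<Longrightarrow> covered Z x"
    using exists_covering[OF c(1,3)] by blast
  define K where "K = {x \<in> corners \<C>. cell (fst x) (snd x) \<inter> Z = {}}"
  let ?G = "{x \<in> corners \<C>. covered Z x}"
  \<comment> \<open>A covered cell meets \<open>Z\<close>, so covered cells and cells of
    \<open>K\<close> are disjoint parts of the collection; replacing the number of covered cells by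
    the smaller \<open>card Z\<close> gives the strict inequality.\<close>
  have "K \<inter> ?G = {}" by (auto simp: K_def covered_def cell_def upper_def)
  then have "card K + card ?G = card (K \<union> ?G)" using c(1) by (subst card_Un_disjoint) (auto simp: K_def)
  also have "\<dots> \<le> card (corners \<C>)" using c(1) by (intro card_mono) (auto simp: K_def)
  finally have "card Z + card K < card \<C>" using Z(2) c(2) by simp
  moreover have "I_adj \<C> \<subseteq> (tker (\<Union>\<C>) Z (cell_pivots K) :: (int \<times> int, 'k) mpoly set)"
    using c(1) Z(3) K_def by (rule I_adj_subset_tker)
  moreover have "cell (fst x) (snd x) \<subseteq> \<Union>\<C> - Z" if "x \<in> K" for x
    using that cell_subset[of x \<C>] by (auto simp: K_def)
  moreover have "K \<subseteq> corners \<C>" by (auto simp: K_def)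
  ultimately show ?thesis using that Z(1) by blast
qed

section \<open>Complete intersections\<close>

lemma mono_degree_superset:
  "finite X \<Longrightarrow> Poly_Mapping.keys m \<subseteq> X \<Longrightarrow> mono_degree m = (\<Sum>v\<in>X. Poly_Mapping.lookup m v)"
  unfolding mono_degree_def by (intro sum.mono_neutral_left) (auto simp: in_keys_iff)

lemma mono_degree_add: "mono_degree (a + b) = mono_degree a + mono_degree b"
proof -
  let ?X = "Poly_Mapping.keys a \<union> Poly_Mapping.keys b"
  have "mono_degree (a + b) = (\<Sum>v\<in>?X. Poly_Mapping.lookup (a + b) v)"
    by (rule mono_degree_superset) (simp_all add: keys_plus_nat)
  also have "\<dots> = (\<Sum>v\<in>?X. Poly_Mapping.lookup a v) + (\<Sum>v\<in>?X. Poly_Mapping.lookup b v)"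
    by (simp add: lookup_add sum.distrib)
  also have "\<dots> = mono_degree a + mono_degree b"
    using mono_degree_superset[of ?X a] mono_degree_superset[of ?X b] by simp
  finally show ?thesis .
qed

lemma mono_degree_single [simp]: "mono_degree (Poly_Mapping.single v k) = k"
  by (cases "k = 0") (simp_all add: mono_degree_def)

lemma mono_degree_eq_0: "mono_degree m = 0 \<longleftrightarrow> m = 0"
proof
  assume "mono_degree m = 0"
  then have "Poly_Mapping.lookup m v = 0" for v
    by (cases "v \<in> Poly_Mapping.keys m") (simp_all add: mono_degree_def in_keys_iff)
  then show "m = 0" by (intro poly_mapping_eqI) simp
qed (simp add: mono_degree_def)

text \<open>Extended linearly by \<open>ev\<close>, this is the projection to the part of degree
  two.\<close>

definition quad_mon :: "('v \<Rightarrow>\<^sub>0 nat) \<Rightarrow> ('v, 'k::field) mpoly" where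
  "quad_mon m = (if mono_degree m = 2 then Poly_Mapping.single m 1 else 0)"

text \<open>The \<open>d\<close>-th power of the irrelevant ideal, described through its
  monomials.\<close>

definition order_ge :: "'v set \<Rightarrow> nat \<Rightarrow> ('v, 'k::field) mpoly set" where
  "order_ge V d = {p \<in> carrier (mpoly_ring V). \<forall>m\<in>Poly_Mapping.keys p. d \<le> mono_degree m}"

lemma order_ge_ideal: "ideal (order_ge V d) (mpoly_ring V :: ('v, 'k::field) mpoly ring)"
proof (rule mpoly_idealI)
  fix x y :: "('v, 'k) mpoly" assume "x \<in> order_ge V d" "y \<in> order_ge V d"
  then show "x + y \<in> order_ge V d"
    using keys_add[of x y] by (auto simp: order_ge_def plus_carrier)
next
  fix r x :: "('v, 'k) mpoly" assume r: "r \<in> carrier (mpoly_ring V)" and x: "x \<in> order_ge V d"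
  have "d \<le> mono_degree m" if m: "m \<in> Poly_Mapping.keys (r * x)" for m
  proof -
    obtain a b where "m = a + b" "b \<in> Poly_Mapping.keys x" using keys_mult[of r x] m by blast
    then show ?thesis using x by (auto simp: order_ge_def mono_degree_add intro: trans_le_add2)
  qed
  then show "r * x \<in> order_ge V d" using r x by (auto simp: order_ge_def times_carrier)
qed (auto simp: order_ge_def zero_carrier)

lemma quad_single_mult:
  fixes p :: "('v, 'k::field) mpoly"
  assumes "p \<in> order_ge V 2"
  shows "ev quad_mon (Poly_Mapping.single a c * p) = (if a = 0 then const c * ev quad_mon p else 0)"
proof (cases "a = 0")
  case True
  then show ?thesis by (simp add: ev_const_mult)
next
  case False
  have "Poly_Mapping.single a c * p = (\<Sum>m\<in>Poly_Mapping.keys p. Poly_Mapping.single a c *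
      (const (Poly_Mapping.lookup p m) * Poly_Mapping.single m 1))"
    using sum_keys_const_single[of "Poly_Mapping.keys p" p] by (simp flip: sum_distrib_left)
  also have "ev quad_mon \<dots> = (\<Sum>m\<in>Poly_Mapping.keys p.
      const (c * Poly_Mapping.lookup p m) * (quad_mon (a + m) :: ('v, 'k) mpoly))"
    by (simp add: ev_sum mult_single ev_single)
  also have "\<dots> = 0"
  proof (intro sum.neutral ballI)
    fix m assume "m \<in> Poly_Mapping.keys p"
    then have "2 \<le> mono_degree m" using assms by (auto simp: order_ge_def)
    then have "mono_degree (a + m) \<noteq> 2" using False mono_degree_eq_0[of a] by (simp add: mono_degree_add)
    then show "const (c * Poly_Mapping.lookup p m) * (quad_mon (a + m) :: ('v, 'k) mpoly) = 0"
      by (simp add: quad_mon_def)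
  qed
  finally show ?thesis using False by simp
qed

text \<open>In the absence of terms of degree below two, a factor \<open>r\<close> acts on the
  quadratic part through its constant term only. So the quadratic parts of any generators span those
  of the whole ideal.\<close>

lemma quad_span_ideal:
  "ideal {p \<in> order_ge V 2. ev quad_mon p \<in> pm.span T} (mpoly_ring V :: ('v, 'k::field) mpoly ring)"
proof (rule mpoly_idealI)
  show "{p \<in> order_ge V 2. ev quad_mon p \<in> pm.span T} \<subseteq> (carrier (mpoly_ring V) :: ('v, 'k) mpoly set)"
    by (auto simp: order_ge_def)
  show "(0 :: ('v, 'k) mpoly) \<in> {p \<in> order_ge V 2. ev quad_mon p \<in> pm.span T}"
    using mpoly_idealD(2)[OF order_ge_ideal] by (simp add: pm.span_zero)
next
  fix x y :: "('v, 'k) mpoly"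
  assume "x \<in> {p \<in> order_ge V 2. ev quad_mon p \<in> pm.span T}" "y \<in> {p \<in> order_ge V 2. ev quad_mon p \<in> pm.span T}"
  then show "x + y \<in> {p \<in> order_ge V 2. ev quad_mon p \<in> pm.span T}"
    using mpoly_idealD(3)[OF order_ge_ideal] by (auto simp: ev_add intro: pm.span_add)
next
  fix r p :: "('v, 'k) mpoly"
  assume r: "r \<in> carrier (mpoly_ring V)" and "p \<in> {p \<in> order_ge V 2. ev quad_mon p \<in> pm.span T}"
  then have p: "p \<in> order_ge V 2" "ev quad_mon p \<in> pm.span T" by auto
  have "r * p = (\<Sum>a\<in>Poly_Mapping.keys r. Poly_Mapping.single a (Poly_Mapping.lookup r a) * p)"
    using sum_keys_const_single[of "Poly_Mapping.keys r" r] by (simp add: mult_single flip: sum_distrib_right)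
  then have "ev quad_mon (r * p) = (\<Sum>a\<in>Poly_Mapping.keys r.
      ev quad_mon (Poly_Mapping.single a (Poly_Mapping.lookup r a) * p))" by (simp only: ev_sum)
  also have "\<dots> \<in> pm.span T"
    using p(2) pm.span_scale[OF p(2)]
    by (intro pm.span_sum) (simp add: quad_single_mult[OF p(1)] pscale_def pm.span_zero)
  finally show "r * p \<in> {p \<in> order_ge V 2. ev quad_mon p \<in> pm.span T}"
    using mpoly_idealD(4)[OF order_ge_ideal r p(1)] by simp
qed

lemma keys_single_add_single: "Poly_Mapping.keys (Poly_Mapping.single v 1 + Poly_Mapping.single w (1::nat)) = {v, w}"
  by (auto simp: keys_plus_nat)

text \<open>The diagonal product of a cell occurs in no other minor; reading off its coefficient
  gives the linear independence of the minors.\<close>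

lemma lookup_adjacent_minor:
  "Poly_Mapping.lookup (adjacent_minor k l :: (int \<times> int, 'k::field) mpoly)
     (Poly_Mapping.single (i, j) 1 + Poly_Mapping.single (i + 1, j + 1) 1) = (if k = i \<and> l = j then 1 else 0)"
proof -
  let ?m = "\<lambda>v w :: int \<times> int. Poly_Mapping.single v 1 + Poly_Mapping.single w 1 :: (int \<times> int) \<Rightarrow>\<^sub>0 nat"
  have "?m (k, l) (k + 1, l + 1) = ?m (i, j) (i + 1, j + 1) \<longleftrightarrow> k = i \<and> l = j"
  proof
    assume "?m (k, l) (k + 1, l + 1) = ?m (i, j) (i + 1, j + 1)"
    then have "{(k, l), (k + 1, l + 1)} = {(i, j), (i + 1, j + 1)}" by (metis keys_single_add_single)
    then show "k = i \<and> l = j" by (auto simp: doubleton_eq_iff)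
  qed auto
  moreover have "?m (k, l + 1) (k + 1, l) \<noteq> ?m (i, j) (i + 1, j + 1)"
  proof
    assume "?m (k, l + 1) (k + 1, l) = ?m (i, j) (i + 1, j + 1)"
    then have "{(k, l + 1), (k + 1, l)} = {(i, j), (i + 1, j + 1)}" by (metis keys_single_add_single)
    then show False by (auto simp: doubleton_eq_iff)
  qed
  ultimately show ?thesis
    unfolding adjacent_minor_def mvar_mult lookup_minus lookup_single when_def by simp
qed

lemma minor_order_ge:
  assumes "x \<in> corners \<C>"
  shows "(adjacent_minor (fst x) (snd x) :: (int \<times> int, 'k::field) mpoly) \<in> order_ge (\<Union>\<C>) 2"
proof -
  let ?minor = "adjacent_minor (fst x) (snd x) :: (int \<times> int, 'k) mpoly"
  have "m \<in> Poly_Mapping.keys ?minor \<Longrightarrow> 2 \<le> mono_degree m" for m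
    using keys_diff[of "mvar (fst x, snd x) * mvar (fst x + 1, snd x + 1) :: (int \<times> int, 'k) mpoly"
        "mvar (fst x, snd x + 1) * mvar (fst x + 1, snd x)"]
    by (auto simp: adjacent_minor_def mvar_mult mono_degree_add split: if_splits)
  moreover have "?minor \<in> carrier (mpoly_ring (\<Union>\<C>))"
    using minors_carrier[of \<C>] assms by (auto simp: binom_cell_vec)
  ultimately show ?thesis by (simp add: order_ge_def)
qed

lemma I_adj_order_ge: "I_adj \<C> \<subseteq> (order_ge (\<Union>\<C>) 2 :: (int \<times> int, 'k::field) mpoly set)"
  using minor_order_ge by (intro I_adj_minimal order_ge_ideal) (simp add: binom_cell_vec)

text \<open>The generators may be inhomogeneous, so they are replaced by their quadratic parts,
  whose span contains the independent minors.\<close>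

lemma card_le_generators:
  fixes xs :: "(int \<times> int, 'k::field) mpoly list"
  assumes fin: "finite \<C>" "\<C> \<subseteq> cells"
    and xs: "I_adj \<C> = Idl\<^bsub>mpoly_ring (\<Union>\<C>)\<^esub> (set xs)" "set xs \<subseteq> carrier (mpoly_ring (\<Union>\<C>))"
  shows "card \<C> \<le> length xs"
proof -
  let ?V = "\<Union>\<C>"
  let ?q = "ev quad_mon :: (int \<times> int, 'k) mpoly \<Rightarrow> (int \<times> int, 'k) mpoly"
  let ?T = "?q ` set xs"
  interpret cring "mpoly_ring ?V :: (int \<times> int, 'k) mpoly ring" by (rule cring_mpoly_ring)
  note c = corners[OF fin]
  let ?minor = "\<lambda>x. adjacent_minor (fst x) (snd x) :: (int \<times> int, 'k) mpoly"
  have quad: "?q (?minor x) = ?minor x" for x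
    by (simp add: adjacent_minor_def mvar_mult ev_diff ev_single quad_mon_def mono_degree_add)
  have "I_adj \<C> \<subseteq> (order_ge ?V 2 :: (int \<times> int, 'k) mpoly set)" by (rule I_adj_order_ge)
  then have "set xs \<subseteq> order_ge ?V 2" using genideal_self[OF xs(2)] xs(1) by auto
  then have "I_adj \<C> \<subseteq> {p \<in> order_ge ?V 2. ?q p \<in> pm.span ?T}"
    unfolding xs(1) by (intro genideal_minimal quad_span_ideal) (auto intro: pm.span_base)
  then have span: "?minor x \<in> pm.span ?T" if "x \<in> corners \<C>" for x
    using minor_mem_I_adj[OF that, where ?'k = 'k] quad[of x] by (auto simp: binom_cell_vec)
  have "card (corners \<C>) \<le> card ?T"
  proof (rule pm.card_le_of_independent_family[OF c(1), of ?minor])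
    fix f assume s: "(\<Sum>x\<in>corners \<C>. pscale (f x) (?minor x)) = 0"
    show "\<forall>x\<in>corners \<C>. f x = 0"
    proof
      fix x assume x: "x \<in> corners \<C>"
      obtain i j where ij: "x = (i, j)" by force
      let ?m = "Poly_Mapping.single (i, j) 1 + Poly_Mapping.single (i + 1, j + 1) 1 :: (int \<times> int) \<Rightarrow>\<^sub>0 nat"
      have "0 = Poly_Mapping.lookup (\<Sum>y\<in>corners \<C>. pscale (f y) (?minor y)) ?m" using s by simp
      also have "\<dots> = (\<Sum>y\<in>corners \<C>. if y = x then f y else 0)"
        unfolding lookup_sum pscale_def lookup_const_mult lookup_adjacent_minor
        by (intro sum.cong) (auto simp: ij prod_eq_iff)
      also have "\<dots> = f x" using c(1) x by simp
      finally show "f x = 0" by simp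
    qed
  qed (use span in auto)
  also have "card ?T \<le> length xs" using card_image_le[of "set xs" ?q] card_length[of xs] by simp
  finally show ?thesis using c(2) by simp
qed

lemma not_complete_intersection:
  fixes \<C> :: "(int \<times> int) set set"
  assumes fin: "finite \<C>" "\<C> \<subseteq> cells" and X: "contains_x_pentomino \<C>"
  shows "\<not> complete_intersection (mpoly_ring (\<Union>\<C>)) (I_adj \<C> :: (int \<times> int, 'k::field) mpoly set)"
proof
  assume "complete_intersection (mpoly_ring (\<Union>\<C>)) (I_adj \<C> :: (int \<times> int, 'k) mpoly set)"
  then obtain xs :: "(int \<times> int, 'k) mpoly list" where xs: "regular_sequence (mpoly_ring (\<Union>\<C>)) xs"
    "I_adj \<C> = Idl\<^bsub>mpoly_ring (\<Union>\<C>)\<^esub> (set xs)" by (auto simp: complete_intersection_def)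
  interpret cring "mpoly_ring (\<Union>\<C>) :: (int \<times> int, 'k) mpoly ring" by (rule cring_mpoly_ring)
  have xc: "set xs \<subseteq> carrier (mpoly_ring (\<Union>\<C>))" using xs(1) by (simp add: regular_sequence_def)
  obtain Z K where ZK: "Z \<subseteq> \<Union>\<C>" "K \<subseteq> corners \<C>" "\<And>x. x \<in> K \<Longrightarrow> cell (fst x) (snd x) \<subseteq> \<Union>\<C> - Z"
    "card Z + card K < card \<C>" "I_adj \<C> \<subseteq> (tker (\<Union>\<C>) Z (cell_pivots K) :: (int \<times> int, 'k) mpoly set)"
    using exists_small_prime[OF fin X] by blast
  have "set xs \<subseteq> tker (\<Union>\<C>) Z (cell_pivots K)" using genideal_self[OF xc] xs(2) ZK(5) by simp
  from regular_sequence_prime_chain[OF xs(1) tker_prime this]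
  obtain A :: "(int \<times> int, 'k) mpoly set"
    where "nzd_chain (mpoly_ring (\<Union>\<C>)) (length xs) A (tker (\<Union>\<C>) Z (cell_pivots K))"
    by (rule prime_chain_nzd_chain)
  then have "length xs \<le> card Z + card K"
    using corners[OF fin] ZK by (intro nzd_chain_tker_le) (auto intro: finite_subset)
  then show False using card_le_generators[OF fin xs(2) xc] ZK(4) by simp
qed

section \<open>Unmixedness\<close>

abbreviation lattice_prime :: "(int \<times> int) set set \<Rightarrow> (int \<times> int, 'k::field) mpoly set" where
  "lattice_prime \<C> \<equiv> tker (\<Union>\<C>) {} (cell_pivots (corners \<C>))"

lemma monomial_notin_tker: "(Poly_Mapping.single m 1 :: ('v, 'k::field) mpoly) \<notin> tker V {} L"
proof -
  have "Poly_Mapping.lookup (Poly_Mapping.single (red L (zexp m)) (1::'k)) (red L (zexp m)) \<noteq> 0" by simp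
  then have "Poly_Mapping.single (red L (zexp m)) (1::'k) \<noteq> 0" by (metis lookup_zero)
  then show ?thesis by (simp add: tker_def ev_single toric_mon_def)
qed

lemma cell_pivots_binom:
  assumes "finite (corners \<C>)" "x \<in> set (cell_pivots (corners \<C>))"
  shows "Poly_Mapping.keys (snd x) \<subseteq> \<Union>\<C>" "(binom (snd x) :: (int \<times> int, 'k::field) mpoly) \<in> I_adj \<C>"
proof -
  obtain y where y: "y \<in> corners \<C>" "x = (upper y, cell_vec y)"
    using assms by (auto simp: set_cell_pivots)
  show "Poly_Mapping.keys (snd x) \<subseteq> \<Union>\<C>" "(binom (snd x) :: (int \<times> int, 'k) mpoly) \<in> I_adj \<C>"
    using cell_subset[OF y(1)] minor_mem_I_adj[OF y(1)] by (simp_all add: y(2) keys_cell_vec)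
qed

lemma lattice_prime_subset_saturation:
  assumes "finite (corners \<C>)"
  shows "lattice_prime \<C> \<subseteq> saturation (\<Union>\<C>) (I_adj \<C> :: (int \<times> int, 'k::field) mpoly set)"
  using cell_pivots_binom[OF assms] by (intro tker_subset_saturation I_adj_ideal) blast

lemma I_adj_subset_lattice_prime:
  assumes "finite (corners \<C>)"
  shows "I_adj \<C> \<subseteq> (lattice_prime \<C> :: (int \<times> int, 'k::field) mpoly set)"
  by (rule I_adj_subset_tker[OF assms]) auto

text \<open>A prime inside the lattice prime contains no monomial; if it contains
  \<open>I_adj \<C>\<close>, it contains the saturation and hence the lattice prime.\<close>

lemma lattice_prime_minimal:
  assumes fin: "finite (corners \<C>)"
  shows "minimal_prime (mpoly_ring (\<Union>\<C>)) (I_adj \<C>) (lattice_prime \<C> :: (int \<times> int, 'k::field) mpoly set)"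
  unfolding minimal_prime_def
proof (intro conjI allI impI)
  fix Q :: "(int \<times> int, 'k) mpoly set"
  assume Q: "primeideal Q (mpoly_ring (\<Union>\<C>)) \<and> I_adj \<C> \<subseteq> Q \<and> Q \<subseteq> lattice_prime \<C>"
  interpret Q: primeideal Q "mpoly_ring (\<Union>\<C>)" using Q by blast
  have "f \<in> Q" if "f \<in> lattice_prime \<C>" for f
  proof -
    have "f \<in> saturation (\<Union>\<C>) (I_adj \<C>)" using lattice_prime_subset_saturation[OF fin] that by blast
    then obtain m where m: "f \<in> carrier (mpoly_ring (\<Union>\<C>))" "Poly_Mapping.keys m \<subseteq> \<Union>\<C>"
      "Poly_Mapping.single m 1 * f \<in> I_adj \<C>" by (auto simp: saturation_def)
    then have "Poly_Mapping.single m 1 \<in> Q \<or> f \<in> Q"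
      using Q Q.I_prime[of "Poly_Mapping.single m 1" f] single_carrier[OF m(2)] by auto
    then show ?thesis using Q monomial_notin_tker by blast
  qed
  then show "Q = lattice_prime \<C>" using Q by blast
qed (use tker_prime I_adj_subset_lattice_prime[OF fin] in auto)

lemma length_cell_pivots: "length (cell_pivots K) = card K"
  by (simp add: cell_pivots_def)

lemma not_unmixed:
  fixes \<C> :: "(int \<times> int) set set"
  assumes fin: "finite \<C>" "\<C> \<subseteq> cells" and X: "contains_x_pentomino \<C>"
  shows "\<not> unmixed (mpoly_ring (\<Union>\<C>)) (I_adj \<C> :: (int \<times> int, 'k::field) mpoly set)"
proof
  let ?S = "mpoly_ring (\<Union>\<C>) :: (int \<times> int, 'k) mpoly ring"
  let ?I = "I_adj \<C> :: (int \<times> int, 'k) mpoly set"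
  assume un: "unmixed ?S ?I"
  interpret cring ?S by (rule cring_mpoly_ring)
  note c = corners[OF fin]
  obtain Z K where ZK: "Z \<subseteq> \<Union>\<C>" "K \<subseteq> corners \<C>" "\<And>x. x \<in> K \<Longrightarrow> cell (fst x) (snd x) \<subseteq> \<Union>\<C> - Z"
    "card Z + card K < card \<C>" "?I \<subseteq> tker (\<Union>\<C>) Z (cell_pivots K)"
    using exists_small_prime[OF fin X] by blast
  let ?Q = "tker (\<Union>\<C>) Z (cell_pivots K) :: (int \<times> int, 'k) mpoly set"
  obtain P where P: "minimal_prime ?S ?I P" "P \<subseteq> ?Q"
    using exists_minimal_prime[OF I_adj_ideal tker_prime ZK(5)] by blast
  \<comment> \<open>The toric prime may fail to be minimal over the ideal, so heights are compared
    for a minimal prime \<open>P\<close> inside it; a chain up to \<open>P\<close> continues to the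
    toric prime without getting shorter.\<close>
  have "n \<le> card Z + card K" if n: "prime_chain ?S n P" for n
  proof -
    obtain A where A: "nzd_chain ?S n A P" using prime_chain_nzd_chain[OF n] by blast
    obtain n' where n': "n \<le> n'" "nzd_chain ?S n' A ?Q"
    proof (cases "P = ?Q")
      case True then show ?thesis using that A by blast
    next
      case False
      then have "nzd_chain ?S (Suc n) A ?Q"
        using P A by (intro nzd_chain_primes_Suc[OF A _ tker_prime]) (auto simp: minimal_prime_def)
      then show ?thesis using that[of "Suc n"] by simp
    qed
    have "n' \<le> card Z + card K"
      using c ZK n'(2) by (intro nzd_chain_tker_le) (auto intro: finite_subset)
    then show ?thesis using n'(1) by simp
  qed
  then have "prime_height ?S P \<le> enat (card Z + card K)"
    unfolding prime_height_eq_Sup by (intro Sup_least) auto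
  moreover have "enat (card \<C>) \<le> prime_height ?S (lattice_prime \<C>)"
  proof -
    have "prime_chain ?S (length (cell_pivots (corners \<C>))) (lattice_prime \<C>)"
      using c cell_pivots_binom(1)[OF c(1)] by (intro tker_prime_chain triangular_cell_pivots) auto
    then show ?thesis
      unfolding prime_height_eq_Sup length_cell_pivots c(2) by (intro Sup_upper) auto
  qed
  moreover have "prime_height ?S P = prime_height ?S (lattice_prime \<C>)"
    by (rule un[unfolded unmixed_def, rule_format, OF conjI[OF P(1) lattice_prime_minimal[OF c(1)]]])
  ultimately have "enat (card \<C>) \<le> enat (card Z + card K)" by (metis order_trans)
  then show False using ZK(4) by simp
qed

section \<open>Growth modulo powers of the irrelevant ideal\<close>

lemma order_ge_mult:
  assumes "p \<in> order_ge V a" "q \<in> order_ge V b"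
  shows "p * q \<in> (order_ge V (a + b) :: ('v, 'k::field) mpoly set)"
proof -
  have "a + b \<le> mono_degree m" if m: "m \<in> Poly_Mapping.keys (p * q)" for m
  proof -
    obtain x y where "m = x + y" "x \<in> Poly_Mapping.keys p" "y \<in> Poly_Mapping.keys q"
      using keys_mult[of p q] m by blast
    then show ?thesis using assms by (auto simp: order_ge_def mono_degree_add intro: add_mono)
  qed
  then show ?thesis using assms by (auto simp: order_ge_def times_carrier)
qed

lemma order_ge_power: "p \<in> order_ge V 1 \<Longrightarrow> p ^ d \<in> (order_ge V d :: ('v, 'k::field) mpoly set)"
proof (induction d)
  case 0
  then show ?case by (simp add: order_ge_def one_carrier)
next
  case (Suc d)
  then show ?case using order_ge_mult[of p V 1 "p ^ d" d] by simp
qed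

lemma order_ge_carrier: "p \<in> order_ge V d \<Longrightarrow> p \<in> carrier (mpoly_ring V)"
  by (simp add: order_ge_def)

lemma irrelevant_eq:
  "(order_ge V 1 :: ('v, 'k::field) mpoly set) = {p \<in> carrier (mpoly_ring V). Poly_Mapping.lookup p 0 = 0}"
proof (intro equalityI subsetI CollectI conjI)
  fix p :: "('v, 'k) mpoly" assume p: "p \<in> order_ge V 1"
  then show "p \<in> carrier (mpoly_ring V)" by (rule order_ge_carrier)
  have "0 \<notin> Poly_Mapping.keys p"
    using p mono_degree_eq_0[of "0 :: 'v \<Rightarrow>\<^sub>0 nat"] by (force simp: order_ge_def)
  then show "Poly_Mapping.lookup p 0 = 0" by (simp add: in_keys_iff)
next
  fix p :: "('v, 'k) mpoly" assume p: "p \<in> {p \<in> carrier (mpoly_ring V). Poly_Mapping.lookup p 0 = (0::'k)}"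
  have "1 \<le> mono_degree m" if "m \<in> Poly_Mapping.keys p" for m
  proof -
    have "m \<noteq> 0" using that p by (auto simp: in_keys_iff)
    then show ?thesis using mono_degree_eq_0[of m] by linarith
  qed
  then show "p \<in> order_ge V 1" using p by (simp add: order_ge_def)
qed

text \<open>Killing all variables is the toric map with \<open>Z = V\<close> and the empty
  list.\<close>

lemma irrelevant_prime: "primeideal (order_ge V 1) (mpoly_ring V :: ('v::linorder, 'k::field) mpoly ring)"
proof -
  have "ev (toric_mon V []) p = const (Poly_Mapping.lookup p 0)" if p: "p \<in> carrier (mpoly_ring V)" for p :: "('v, 'k) mpoly"
  proof -
    have "toric_mon V [] m = (if m = 0 then 1 else (0 :: ('v \<Rightarrow>\<^sub>0 int) \<Rightarrow>\<^sub>0 'k))"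
      if m: "m \<in> Poly_Mapping.keys p" for m
    proof (cases "m = 0")
      case False
      then have "Poly_Mapping.keys m \<noteq> {}" by simp
      moreover have "Poly_Mapping.keys m \<subseteq> V" using p m by (simp add: carrier_mpoly_ring)
      ultimately have "Poly_Mapping.keys m \<inter> V \<noteq> {}" by (simp add: Int_absorb2)
      then show ?thesis using False by (simp add: toric_mon_def)
    qed simp
    then have "ev (toric_mon V []) p = (\<Sum>m\<in>Poly_Mapping.keys p. if m = 0 then const (Poly_Mapping.lookup p 0) else 0)"
      unfolding ev_def by (intro sum.cong) auto
    also have "\<dots> = const (Poly_Mapping.lookup p 0)"
      by (auto simp: in_keys_iff)
    finally show ?thesis .
  qed
  moreover have "const c = (0 :: ('v \<Rightarrow>\<^sub>0 int) \<Rightarrow>\<^sub>0 'k) \<longleftrightarrow> c = 0" for c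
    by (metis lookup_single_eq lookup_zero single_zero)
  ultimately have "order_ge V 1 = (tker V V [] :: ('v, 'k) mpoly set)"
    unfolding irrelevant_eq tker_def by auto
  then show ?thesis using tker_prime by simp
qed

text \<open>\<open>K[V] / (J + \<mm>\<^sup>d)\<close> has dimension \<open>O(d\<^sup>q)\<close>, where \<open>\<mm>\<close> is the irrelevant ideal.\<close>

definition growth_le :: "'v set \<Rightarrow> ('v, 'k::field) mpoly set \<Rightarrow> nat \<Rightarrow> bool" where
  "growth_le V J q \<longleftrightarrow> (\<exists>c. \<forall>d. \<exists>T. finite T \<and> card T \<le> c * (d + 1) ^ q \<and>
     (\<forall>p\<in>carrier (mpoly_ring V). \<exists>s\<in>pm.span T. \<exists>j\<in>J. p - s - j \<in> order_ge V d))"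

lemma span_image:
  fixes f :: "('a::comm_monoid_add \<Rightarrow>\<^sub>0 'k::field) \<Rightarrow> ('b::comm_monoid_add \<Rightarrow>\<^sub>0 'k)"
  assumes add: "\<And>x y. f (x + y) = f x + f y" and scale: "\<And>c x. f (const c * x) = const c * f x"
    and s: "s \<in> pm.span T"
  shows "f s \<in> pm.span (f ` T)"
  using s
proof (induction rule: pm.span_induct_alt)
  case base
  have "f 0 = 0" using add[of 0 0] by simp
  then show ?case by (simp add: pm.span_zero)
next
  case (step c x y)
  have eq: "f (pscale c x + y) = pscale c (f x) + f y" by (simp only: add scale pscale_def)
  have "f x \<in> f ` T" using step.hyps by blast
  then show ?case unfolding eq by (intro pm.span_add pm.span_scale pm.span_base step.IH)
qed

text \<open>Every element is expanded in powers of \<open>y\<close> modulo \<open>J\<close>, with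
  coefficients from the spanning set for \<open>J'\<close>. After \<open>d\<close> rounds the
  remainder is a multiple of y^d, of order at least \<open>d\<close>, so \<open>d\<close> copies of
  the spanning set suffice.\<close>

lemma growth_le_adjoin:
  fixes y :: "('v, 'k::field) mpoly"
  assumes g: "growth_le V J' q" and J: "ideal J (mpoly_ring V)" and y: "y \<in> order_ge V 1"
    and J': "\<And>x. x \<in> J' \<Longrightarrow> \<exists>a\<in>J. \<exists>r\<in>carrier (mpoly_ring V). x = a + r * y"
  shows "growth_le V J (Suc q)"
proof -
  note O = order_ge_ideal[of V, where ?'k = 'k]
  obtain c where c: "\<And>d. \<exists>T. finite T \<and> card T \<le> c * (d + 1) ^ q \<and>
     (\<forall>p\<in>carrier (mpoly_ring V). \<exists>s\<in>pm.span T. \<exists>j\<in>J'. p - s - j \<in> order_ge V d)"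
    using g unfolding growth_le_def by blast
  have "\<exists>T. finite T \<and> card T \<le> c * (d + 1) ^ Suc q \<and>
     (\<forall>p\<in>carrier (mpoly_ring V). \<exists>s\<in>pm.span T. \<exists>j\<in>J. p - s - j \<in> order_ge V d)" for d
  proof -
    obtain T where T: "finite T" "card T \<le> c * (d + 1) ^ q"
      and span: "\<And>p. p \<in> carrier (mpoly_ring V) \<Longrightarrow> \<exists>s\<in>pm.span T. \<exists>j\<in>J'. p - s - j \<in> order_ge V d"
      using c[of d] by blast
    have yc: "y ^ e \<in> carrier (mpoly_ring V)" for e using order_ge_carrier[OF y] by (rule power_carrier)
    define U where "U e = (\<Union>k<e. (\<lambda>t. y ^ k * t) ` T)" for e
    have ex: "\<exists>s\<in>pm.span (U e). \<exists>j\<in>J. \<exists>r\<in>carrier (mpoly_ring V). p - s - j - y ^ e * r \<in> order_ge V d"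
      if p: "p \<in> carrier (mpoly_ring V)" for p e
    proof (induction e)
      case 0
      show ?case
      proof (intro bexI)
        show "p - 0 - 0 - y ^ 0 * p \<in> order_ge V d" using mpoly_idealD(2)[OF O] by simp
      qed (use mpoly_idealD(2)[OF J] p in \<open>simp_all add: pm.span_zero\<close>)
    next
      case (Suc e)
      then obtain s j r where sj: "s \<in> pm.span (U e)" "j \<in> J" "r \<in> carrier (mpoly_ring V)"
        "p - s - j - y ^ e * r \<in> order_ge V d" by blast
      obtain s' j' where s': "s' \<in> pm.span T" "j' \<in> J'" "r - s' - j' \<in> order_ge V d"
        using span[OF sj(3)] by blast
      obtain a r' where a: "a \<in> J" "r' \<in> carrier (mpoly_ring V)" "j' = a + r' * y"
        using J'[OF s'(2)] by blast
      have "y ^ e * s' \<in> pm.span ((\<lambda>t. y ^ e * t) ` T)"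
        using s'(1) by (intro span_image) (simp_all add: distrib_left mult.left_commute)
      moreover have "pm.span ((\<lambda>t. y ^ e * t) ` T) \<subseteq> pm.span (U (Suc e))" "pm.span (U e) \<subseteq> pm.span (U (Suc e))"
        by (intro pm.span_mono; force simp: U_def)+
      ultimately have 1: "s + y ^ e * s' \<in> pm.span (U (Suc e))"
        using sj(1) by (intro pm.span_add) auto
      have 2: "j + y ^ e * a \<in> J" by (intro mpoly_idealD(3)[OF J sj(2)] mpoly_idealD(4)[OF J yc a(1)])
      have "(p - s - j - y ^ e * r) + y ^ e * (r - s' - j') \<in> order_ge V d"
        by (intro mpoly_idealD(3)[OF O sj(4)] mpoly_idealD(4)[OF O yc s'(3)])
      also have "(p - s - j - y ^ e * r) + y ^ e * (r - s' - j') =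
          p - (s + y ^ e * s') - (j + y ^ e * a) - y ^ Suc e * r'"
        by (simp add: a(3) algebra_simps)
      finally show ?case using 1 2 a(2) by blast
    qed
    have "\<forall>p\<in>carrier (mpoly_ring V). \<exists>s\<in>pm.span (U d). \<exists>j\<in>J. p - s - j \<in> order_ge V d"
    proof
      fix p :: "('v, 'k) mpoly" assume "p \<in> carrier (mpoly_ring V)"
      then obtain s j r where sj: "s \<in> pm.span (U d)" "j \<in> J" "r \<in> carrier (mpoly_ring V)"
        "p - s - j - y ^ d * r \<in> order_ge V d" using ex by blast
      have "y ^ d * r \<in> order_ge V d"
        using mpoly_idealD(4)[OF O sj(3) order_ge_power[OF y]] by (simp add: mult.commute)
      from mpoly_idealD(3)[OF O sj(4) this] have "p - s - j \<in> order_ge V d" by simp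
      then show "\<exists>s\<in>pm.span (U d). \<exists>j\<in>J. p - s - j \<in> order_ge V d" using sj(1,2) by blast
    qed
    moreover have "finite (U d)" using T(1) by (simp add: U_def)
    moreover have "card (U d) \<le> c * (d + 1) ^ Suc q"
    proof -
      have "card (U d) \<le> (\<Sum>k<d. card ((\<lambda>t. y ^ k * t) ` T))" unfolding U_def by (rule card_UN_le) simp
      also have "\<dots> \<le> (\<Sum>k<d. c * (d + 1) ^ q)"
        by (intro sum_mono order_trans[OF card_image_le[OF T(1)] T(2)])
      also have "\<dots> \<le> (d + 1) * (c * (d + 1) ^ q)" by simp
      finally show ?thesis by (simp add: algebra_simps)
    qed
    ultimately show ?thesis by blast
  qed
  then show ?thesis unfolding growth_le_def by blast
qed

text \<open>The hypothesis says that every variable is nilpotent modulo \<open>J\<close> in the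
  localization at the irrelevant ideal. Monomials with a large exponent can then be pushed to higher
  order, and the others fill a box independent of \<open>d\<close>.\<close>

lemma growth_le_zero:
  fixes J :: "('v, 'k::field) mpoly set"
  assumes V: "finite V" and J: "ideal J (mpoly_ring V)"
    and nil: "\<And>v. v \<in> V \<Longrightarrow> \<exists>g n. g \<in> carrier (mpoly_ring V) \<and> g \<notin> order_ge V 1 \<and> g * mvar v ^ n \<in> J"
  shows "growth_le V J 0"
proof -
  note O = order_ge_ideal[of V, where ?'k = 'k]
  have "\<forall>v\<in>V. \<exists>n. \<exists>g. g \<in> carrier (mpoly_ring V) \<and> g \<notin> order_ge V 1 \<and> g * mvar v ^ n \<in> J"
    using nil by blast
  then obtain n where n: "\<And>v. v \<in> V \<Longrightarrow> \<exists>g. g \<in> carrier (mpoly_ring V) \<and> g \<notin> order_ge V 1 \<and> g * mvar v ^ n v \<in> J"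
    by (metis bchoice)
  \<comment> \<open>One exponent for all variables; the sum stands in for the maximum.\<close>
  define N where "N = (\<Sum>v\<in>V. n v)"
  have nN: "n v \<le> N" if "v \<in> V" for v using V that unfolding N_def by (intro member_le_sum) auto
  let ?T = "(\<lambda>m. Poly_Mapping.single m 1 :: ('v, 'k) mpoly) ` mono_box V N"
  let ?U = "\<lambda>d. {p. \<exists>s\<in>pm.span ?T. \<exists>j\<in>J. p - s - j \<in> order_ge V d}"
  have U_add: "p + q \<in> ?U d" if "p \<in> ?U d" "q \<in> ?U d" for p q d
  proof -
    obtain s j s' j' where *: "s \<in> pm.span ?T" "j \<in> J" "p - s - j \<in> order_ge V d"
      "s' \<in> pm.span ?T" "j' \<in> J" "q - s' - j' \<in> order_ge V d" using \<open>p \<in> ?U d\<close> \<open>q \<in> ?U d\<close> by blast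
    have eq: "p + q - (s + s') - (j + j') = (p - s - j) + (q - s' - j')" by simp
    have "p + q - (s + s') - (j + j') \<in> order_ge V d"
      unfolding eq by (rule mpoly_idealD(3)[OF O *(3,6)])
    then show ?thesis using pm.span_add[OF *(1,4)] mpoly_idealD(3)[OF J *(2,5)] by blast
  qed
  have U_scale: "const c * p \<in> ?U d" if p: "p \<in> ?U d" for c p d
  proof -
    obtain s j where *: "s \<in> pm.span ?T" "j \<in> J" "p - s - j \<in> order_ge V d" using p by blast
    have "const c * p - const c * s - const c * j \<in> order_ge V d"
      using mpoly_idealD(4)[OF O const_carrier *(3), of c] by (simp add: right_diff_distrib)
    moreover have "const c * s \<in> pm.span ?T" using pm.span_scale[OF *(1), of c] by (simp add: pscale_def)
    ultimately show ?thesis using mpoly_idealD(4)[OF J const_carrier *(2), of c] by blast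
  qed
  have U_zero: "0 \<in> ?U d" for d
    using mpoly_idealD(2)[OF O, of d] mpoly_idealD(2)[OF J] pm.span_zero[of ?T]
    by (auto intro!: bexI[of _ 0])
  have mono: "Poly_Mapping.single m 1 \<in> ?U (Suc d)"
    if m: "Poly_Mapping.keys m \<subseteq> V" "d \<le> mono_degree m" for m d
  proof (cases "m \<in> mono_box V N")
    case True
    then have "Poly_Mapping.single m 1 \<in> pm.span ?T" by (intro pm.span_base) blast
    moreover have "Poly_Mapping.single m 1 - Poly_Mapping.single m 1 - 0 \<in> (order_ge V (Suc d) :: ('v, 'k) mpoly set)"
      using mpoly_idealD(2)[OF O] by simp
    ultimately show ?thesis using mpoly_idealD(2)[OF J] by blast
  next
    case False
    then obtain v where v: "\<not> Poly_Mapping.lookup m v \<le> N" using m by (auto simp: mono_box_def)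
    then have vm: "v \<in> Poly_Mapping.keys m" by (auto simp: in_keys_iff)
    then have vV: "v \<in> V" using m by blast
    obtain g where g: "g \<in> carrier (mpoly_ring V)" "g \<notin> order_ge V 1" "g * mvar v ^ n v \<in> J" using n[OF vV] by blast
    define m' where "m' = m - Poly_Mapping.single v (n v)"
    have mm': "m = m' + Poly_Mapping.single v (n v)"
      using v nN[OF vV] by (intro poly_mapping_eqI) (auto simp: m'_def lookup_add lookup_minus lookup_single when_def)
    have km': "Poly_Mapping.keys m' \<subseteq> V" using m mm' by (simp add: keys_plus_nat)
    define c where "c = Poly_Mapping.lookup g 0"
    have c: "c \<noteq> 0" using g(1,2) unfolding irrelevant_eq c_def by simp
    define g' where "g' = g - const c"
    have g': "g' \<in> order_ge V 1"
      using g(1) unfolding irrelevant_eq g'_def c_def by (simp add: lookup_minus diff_carrier const_carrier)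
    have pow: "mvar v ^ k = (Poly_Mapping.single (Poly_Mapping.single v k) 1 :: ('v, 'k) mpoly)" for k
      by (induction k) (simp_all add: mvar_def mult_single single_add[symmetric])
    let ?xm = "Poly_Mapping.single m 1 :: ('v, 'k) mpoly"
    have xm: "?xm = Poly_Mapping.single m' 1 * mvar v ^ n v"
      by (simp add: pow mult_single mm'[symmetric])
    \<comment> \<open>Subtracting this element of \<open>J\<close> leaves a multiple of
      \<open>g'\<close> times the monomial; as \<open>g'\<close> has no constant term, the order
      rises.\<close>
    let ?j = "(const (inverse c) * Poly_Mapping.single m' 1) * (g * mvar v ^ n v)"
    have j: "?j \<in> J" using km' by (intro mpoly_idealD(4)[OF J _ g(3)] times_carrier const_carrier single_carrier)
    have "?j = const (inverse c) * g * ?xm" by (simp add: xm ac_simps)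
    also have "\<dots> = const (inverse c) * const c * ?xm + const (inverse c) * g' * ?xm"
      by (simp add: g'_def algebra_simps)
    also have "const (inverse c) * const c = (1 :: ('v, 'k) mpoly)" using c by (simp add: mult_single)
    finally have "?xm - 0 - ?j = - (const (inverse c) * (g' * ?xm))" by (simp add: mult.assoc)
    moreover have "g' * ?xm \<in> order_ge V (1 + d)"
      using m by (intro order_ge_mult[OF g']) (simp add: order_ge_def single_carrier)
    then have "- (const (inverse c) * (g' * ?xm)) \<in> order_ge V (Suc d)"
      using mpoly_idealD(5)[OF O mpoly_idealD(4)[OF O const_carrier]] by simp
    ultimately have "?xm - 0 - ?j \<in> order_ge V (Suc d)" by simp
    then show ?thesis using j pm.span_zero[of ?T] by blast
  qed
  have "p \<in> ?U d" if p: "p \<in> carrier (mpoly_ring V)" for p d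
  proof (induction d)
    case 0
    have "p - 0 - 0 \<in> order_ge V 0" using p by (simp add: order_ge_def)
    then show ?case using mpoly_idealD(2)[OF J] pm.span_zero[of ?T] by blast
  next
    case (Suc d)
    then obtain s j where *: "s \<in> pm.span ?T" "j \<in> J" "p - s - j \<in> order_ge V d" by blast
    let ?r = "p - s - j"
    have sum_U: "(\<Sum>m\<in>X. const (Poly_Mapping.lookup ?r m) * Poly_Mapping.single m 1) \<in> ?U (Suc d)"
      if "finite X" "X \<subseteq> Poly_Mapping.keys ?r" for X
      using that
    proof (induction X)
      case empty
      show ?case unfolding sum.empty by (rule U_zero)
    next
      case (insert m X)
      have "Poly_Mapping.keys m \<subseteq> V" "d \<le> mono_degree m"
        using insert.prems *(3) by (auto simp: order_ge_def carrier_mpoly_ring)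
      then have "const (Poly_Mapping.lookup ?r m) * Poly_Mapping.single m 1 \<in> ?U (Suc d)"
        by (intro U_scale mono)
      from U_add[OF this insert.IH] show ?case using insert by simp
    qed
    have "?r \<in> ?U (Suc d)"
      using sum_U[of "Poly_Mapping.keys ?r"] sum_keys_const_single[of "Poly_Mapping.keys ?r" ?r] by simp
    then obtain s' j' where s': "s' \<in> pm.span ?T" "j' \<in> J" "?r - s' - j' \<in> order_ge V (Suc d)" by blast
    have eq: "p - (s + s') - (j + j') = ?r - s' - j'" by simp
    have "p - (s + s') - (j + j') \<in> order_ge V (Suc d)" unfolding eq by (rule s'(3))
    then show ?case using pm.span_add[OF *(1) s'(1)] mpoly_idealD(3)[OF J *(2) s'(2)] by blast
  qed
  then show ?thesis
    unfolding growth_le_def using mono_box(1)[OF V, of N]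
    by (intro exI[of _ "card ?T"] allI exI[of _ ?T]) auto
qed

section \<open>The grading of the group ring and growth along toric primes\<close>

text \<open>The total degree on exponents of any sign, as the homomorphism to the free group on one
  generator. Cell vectors have degree 0, so reduction along them preserves it.\<close>

definition zdeg :: "('v \<Rightarrow>\<^sub>0 int) \<Rightarrow> int" where
  "zdeg u = Poly_Mapping.lookup (frag_extend (\<lambda>_. frag_of ()) u) ()"

lemma zdeg_add: "zdeg (u + v) = zdeg u + zdeg v"
  by (simp add: zdeg_def frag_extend_add lookup_add)

lemma zdeg_diff: "zdeg (u - v) = zdeg u - zdeg v"
  by (simp add: zdeg_def frag_extend_diff lookup_minus)

lemma zdeg_cmul: "zdeg (frag_cmul c u) = c * zdeg u"
  by (simp add: zdeg_def frag_extend_cmul)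

lemma zdeg_zexp: "zdeg (zexp m) = int (mono_degree m)"
proof -
  have "Poly_Mapping.keys (zexp m) = Poly_Mapping.keys m" by (auto simp: in_keys_iff)
  then show ?thesis by (simp add: zdeg_def frag_extend_def lookup_sum mono_degree_def)
qed

lemma zdeg_single: "zdeg (Poly_Mapping.single v 1) = 1"
  by (simp add: zdeg_def)

lemma zdeg_cell_vec: "zdeg (cell_vec x) = 0"
  by (simp only: cell_vec_def zdeg_add zdeg_diff zdeg_single)

lemma zdeg_red: "\<forall>x\<in>set L. zdeg (snd x) = 0 \<Longrightarrow> zdeg (red L u) = zdeg u"
  by (induction L u rule: red.induct) (simp_all add: zdeg_diff zdeg_cmul)

lemma zdeg_red_cell_pivots: "finite K \<Longrightarrow> zdeg (red (cell_pivots K) u) = zdeg u"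
  by (rule zdeg_red) (simp add: set_cell_pivots zdeg_cell_vec)

text \<open>The toric map followed by truncation to degrees below \<open>d\<close> kills
  \<open>I\<close> and everything of order \<open>d\<close>, but carries the monomials in the free
  variables with exponents below \<open>D\<close> to distinct group elements. The spanning set must
  be at least as large as their number.\<close>

lemma growth_le_tker:
  fixes I :: "(int \<times> int, 'k::field) mpoly set"
  assumes V: "finite V" and K: "finite K" and I: "I \<subseteq> tker V Z (cell_pivots K)" and gr: "growth_le V I q"
  shows "card (free_vars V Z K) \<le> q"
proof -
  let ?F = "free_vars V Z K"
  have finF: "finite ?F" using V by (simp add: free_vars_def)
  obtain c where c: "\<And>d. \<exists>T. finite T \<and> card T \<le> c * (d + 1) ^ q \<and>
     (\<forall>p\<in>carrier (mpoly_ring V). \<exists>s\<in>pm.span T. \<exists>j\<in>I. p - s - j \<in> order_ge V d)"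
    using gr unfolding growth_le_def by blast
  have "D ^ card ?F \<le> c * ((card ?F + 2) * D) ^ q" if D: "D \<ge> 1" for D
  proof -
    \<comment> \<open>Larger than the degree of each of these monomials, so truncation keeps
      them.\<close>
    let ?d = "card ?F * D + 1"
    obtain T where T: "finite T" "card T \<le> c * (?d + 1) ^ q"
      and span: "\<And>p. p \<in> carrier (mpoly_ring V) \<Longrightarrow> \<exists>s\<in>pm.span T. \<exists>j\<in>I. p - s - j \<in> order_ge V ?d"
      using c[of ?d] by blast
    let ?E = "ev (toric_mon Z (cell_pivots K)) :: (int \<times> int, 'k) mpoly \<Rightarrow> _"
    let ?H = "ev (\<lambda>u. if zdeg u < int ?d then Poly_Mapping.single u (1::'k) else 0)"
    define \<Psi> where "\<Psi> p = ?H (?E p)" for p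
    have \<Psi>_add: "\<Psi> (x + y) = \<Psi> x + \<Psi> y" for x y by (simp add: \<Psi>_def ev_add)
    have \<Psi>_scale: "\<Psi> (const a * x) = const a * \<Psi> x" for a x by (simp add: \<Psi>_def ev_const_mult)
    have \<Psi>_I: "\<Psi> j = 0" if "j \<in> I" for j
      using that I by (auto simp: \<Psi>_def tker_def)
    have \<Psi>_order: "\<Psi> p = 0" if p: "p \<in> order_ge V ?d" for p
    proof -
      have "?H (toric_mon Z (cell_pivots K) m) = 0" if m: "m \<in> Poly_Mapping.keys p" for m
      proof -
        have "int ?d \<le> zdeg (red (cell_pivots K) (zexp m))"
        proof -
          have "?d \<le> mono_degree m" using p m unfolding order_ge_def by blast
          then show ?thesis by (simp only: zdeg_red_cell_pivots[OF K] zdeg_zexp of_nat_le_iff)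
        qed
        then show ?thesis by (simp add: toric_mon_def ev_single)
      qed
      then show ?thesis
        unfolding \<Psi>_def ev_def[of "toric_mon Z (cell_pivots K)"] ev_sum ev_const_mult by simp
    qed
    let ?X = "?F \<rightarrow>\<^sub>E {..<D}"
    define mon where "mon x = (\<Sum>v\<in>?F. Poly_Mapping.single v (x v :: nat))" for x
    have lookup_mon: "Poly_Mapping.lookup (mon x) v = (if v \<in> ?F then x v else 0)" for x v
    proof -
      have "Poly_Mapping.lookup (mon x) v = (\<Sum>w\<in>?F. if w = v then x v else 0)"
        unfolding mon_def lookup_sum by (intro sum.cong) (auto simp: lookup_single when_def)
      then show ?thesis using finF by simp
    qed
    have keys_mon: "Poly_Mapping.keys (mon x) \<subseteq> ?F" for x
      by (auto simp: in_keys_iff lookup_mon split: if_splits)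
    have mon_red: "red (cell_pivots K) (zexp (mon x)) = zexp (mon x)" for x
      by (rule red_fixed) (auto simp: set_cell_pivots[OF K] lookup_mon free_vars_def)
    have \<Psi>_mon: "\<Psi> (Poly_Mapping.single (mon x) 1) = Poly_Mapping.single (zexp (mon x)) 1" if x: "x \<in> ?X" for x
    proof -
      have "mono_degree (mon x) = (\<Sum>v\<in>?F. x v)"
        using mono_degree_superset[OF finF keys_mon[of x]] by (simp add: lookup_mon)
      also have "\<dots> \<le> (\<Sum>v\<in>?F. D)" using x by (intro sum_mono) (auto dest!: PiE_mem)
      finally have "mono_degree (mon x) < ?d" by simp
      then have "zdeg (zexp (mon x)) < int ?d" by (simp only: zdeg_zexp of_nat_less_iff)
      moreover have "Poly_Mapping.keys (mon x) \<inter> Z = {}" using keys_mon[of x] by (auto simp: free_vars_def)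
      ultimately show ?thesis by (simp add: \<Psi>_def ev_single toric_mon_def mon_red)
    qed
    have inj_mon: "x = y" if "x \<in> ?X" "y \<in> ?X" "mon x = mon y" for x y
      using that(1,2)
    proof (rule PiE_ext)
      fix v assume "v \<in> ?F"
      then show "x v = y v" using lookup_mon[of x v] lookup_mon[of y v] that(3) by simp
    qed
    have "card ?X \<le> card (\<Psi> ` T)"
    proof (rule pm.card_le_of_independent_family[where g = "\<lambda>x. \<Psi> (Poly_Mapping.single (mon x) 1)"])
      show finX: "finite ?X" using finF by (intro finite_PiE) auto
      fix f :: "(int \<times> int \<Rightarrow> nat) \<Rightarrow> 'k"
      assume s: "(\<Sum>x\<in>?X. pscale (f x) (\<Psi> (Poly_Mapping.single (mon x) 1))) = 0"
      show "\<forall>x\<in>?X. f x = 0"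
      proof
        fix x assume x: "x \<in> ?X"
        have "0 = Poly_Mapping.lookup (\<Sum>y\<in>?X. pscale (f y) (\<Psi> (Poly_Mapping.single (mon y) 1))) (zexp (mon x))"
          using s by simp
        also have "\<dots> = (\<Sum>y\<in>?X. if y = x then f x else 0)"
          unfolding lookup_sum pscale_def lookup_const_mult
          using inj_mon x by (intro sum.cong) (auto simp: \<Psi>_mon lookup_single when_def zexp_inj)
        also have "\<dots> = f x" using finX x by simp
        finally show "f x = 0" by simp
      qed
    next
      show "(\<lambda>x. \<Psi> (Poly_Mapping.single (mon x) 1)) ` ?X \<subseteq> pm.span (\<Psi> ` T)"
      proof (rule image_subsetI)
        fix x assume "x \<in> ?X"
        let ?p = "Poly_Mapping.single (mon x) 1 :: (int \<times> int, 'k) mpoly"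
        have "?p \<in> carrier (mpoly_ring V)"
          using keys_mon[of x] by (intro single_carrier) (auto simp: free_vars_def)
        then obtain s j where sj: "s \<in> pm.span T" "j \<in> I" "?p - s - j \<in> order_ge V ?d" using span by blast
        have "\<Psi> ?p = \<Psi> ((?p - s - j) + s + j)" by simp
        also have "\<dots> = \<Psi> s" unfolding \<Psi>_add \<Psi>_I[OF sj(2)] \<Psi>_order[OF sj(3)] by simp
        finally show "\<Psi> ?p \<in> pm.span (\<Psi> ` T)" using span_image[of \<Psi>, OF \<Psi>_add \<Psi>_scale sj(1)] by simp
      qed
    qed (use T(1) in simp)
    also have "\<dots> \<le> c * (?d + 1) ^ q" using card_image_le[OF T(1)] T(2) by (rule order_trans)
    also have "\<dots> \<le> c * ((card ?F + 2) * D) ^ q"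
      using D by (intro mult_left_mono power_mono) (auto simp: algebra_simps)
    finally show ?thesis using finF by (simp add: card_PiE)
  qed
  then show ?thesis by (rule exponent_le_of_power_bound)
qed

text \<open>Reduction preserves the degree, so no nonconstant monomial reduces to exponent 0 and the
  constant term survives in the toric image.\<close>

lemma lattice_prime_irrelevant:
  assumes fin: "finite (corners \<C>)"
  shows "(lattice_prime \<C> :: (int \<times> int, 'k::field) mpoly set) \<subseteq> order_ge (\<Union>\<C>) 1"
proof
  let ?L = "cell_pivots (corners \<C>)"
  fix p :: "(int \<times> int, 'k) mpoly" assume p: "p \<in> lattice_prime \<C>"
  have "Poly_Mapping.lookup (const a * toric_mon {} ?L m) 0 = (if m = 0 then a else 0)" for m and a :: 'k
  proof (cases "m = 0")
    case False
    then have "zdeg (red ?L (zexp m)) \<noteq> 0"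
      by (simp add: zdeg_red_cell_pivots[OF fin] zdeg_zexp mono_degree_eq_0)
    moreover have "zdeg (0 :: (int \<times> int) \<Rightarrow>\<^sub>0 int) = 0" by (simp add: zdeg_def)
    ultimately have "red ?L (zexp m) \<noteq> 0" by metis
    then show ?thesis using False by (simp add: toric_mon_def mult_single lookup_single when_def)
  qed simp
  then have "Poly_Mapping.lookup (ev (toric_mon {} ?L) p) 0 =
      (\<Sum>m\<in>Poly_Mapping.keys p. if m = 0 then Poly_Mapping.lookup p m else 0)"
    unfolding ev_def lookup_sum by (simp only:)
  also have "\<dots> = Poly_Mapping.lookup p 0" by (auto simp: in_keys_iff)
  finally have "Poly_Mapping.lookup p 0 = 0" using p by (simp add: tker_def)
  then show "p \<in> order_ge (\<Union>\<C>) 1" using p unfolding irrelevant_eq by (simp add: tker_def)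
qed

lemma order_ge_antimono: "a \<le> b \<Longrightarrow> order_ge V b \<subseteq> order_ge V a"
  unfolding order_ge_def using le_trans by blast

section \<open>Cohen-Macaulayness\<close>

text \<open>This carries chains in the quotient back to the polynomial ring, where their lengths are
  bounded.\<close>

lemma nzd_chain_vimage:
  assumes h: "ring_hom_ring R R' h" and surj: "carrier R' = h ` carrier R"
    and ch: "nzd_chain R' n A C"
  shows "nzd_chain R n {r \<in> carrier R. h r \<in> A} {r \<in> carrier R. h r \<in> C}"
  using ch
proof (induction rule: nzd_chain.induct)
  case (nzd_chain_refl A)
  then show ?case by (intro nzd_chain.intros(1) ring_hom_ring.ideal_vimage[OF h])
next
  case (nzd_chain_step A B f n C)
  have "ideal B R'" using nzd_chain_ideal[OF nzd_chain_step(5)] by simp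
  then have "f \<in> carrier R'" using nzd_chain_step(3) by (rule ideal.Icarr)
  then obtain f' where f': "f' \<in> carrier R" "f = h f'" unfolding surj by blast
  show ?case
  proof (rule nzd_chain.intros(2)[OF _ _ _ _ nzd_chain_step.IH])
    show "ideal {r \<in> carrier R. h r \<in> A} R" using nzd_chain_step(1) by (rule ring_hom_ring.ideal_vimage[OF h])
    show "f' \<in> {r \<in> carrier R. h r \<in> B}" using f' nzd_chain_step(3) by simp
    show "{r \<in> carrier R. h r \<in> A} \<subseteq> {r \<in> carrier R. h r \<in> B}" using nzd_chain_step(2) by blast
    fix r assume r: "r \<in> carrier R" "f' \<otimes>\<^bsub>R\<^esub> r \<in> {r \<in> carrier R. h r \<in> A}"
    have "h (f' \<otimes>\<^bsub>R\<^esub> r) = f \<otimes>\<^bsub>R'\<^esub> h r"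
      using ring_hom_mult[OF ring_hom_ring.homh[OF h] f'(1) r(1)] f'(2) by simp
    then have "h r \<in> A" using nzd_chain_step(4)[of "h r"] r surj by auto
    then show "r \<in> {r \<in> carrier R. h r \<in> A}" using r by simp
  qed
qed

lemma ideal_depth_attained:
  assumes ne: "regular_sequence R []" and bound: "\<And>xs. regular_sequence R xs \<Longrightarrow> set xs \<subseteq> P \<Longrightarrow> length xs \<le> b"
  obtains xs where "regular_sequence R xs" "set xs \<subseteq> P" "ideal_depth R P = enat (length xs)"
proof -
  let ?Q = "\<lambda>xs. regular_sequence R xs \<and> set xs \<subseteq> P"
  have "\<exists>xs. ?Q xs \<and> (\<forall>ys. ?Q ys \<longrightarrow> length ys \<le> length xs)"
    using ne bound by (intro ex_has_greatest_nat[of ?Q "[]" length "Suc b"]) (simp_all add: less_Suc_eq_le)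
  then obtain xs where xs: "regular_sequence R xs" "set xs \<subseteq> P"
    and max: "\<And>ys. regular_sequence R ys \<Longrightarrow> set ys \<subseteq> P \<Longrightarrow> length ys \<le> length xs" by metis
  have "ideal_depth R P = enat (length xs)"
    unfolding ideal_depth_def
  proof (rule antisym)
    show "Sup {enat (length xs) |xs. set xs \<subseteq> P \<and> regular_sequence R xs} \<le> enat (length xs)"
      using max by (intro Sup_least) auto
    show "enat (length xs) \<le> Sup {enat (length xs) |xs. set xs \<subseteq> P \<and> regular_sequence R xs}"
      using xs by (intro Sup_upper) auto
  qed
  with xs that show ?thesis by blast
qed

text \<open>A strictly smaller prime over the sequence would end a chain of the full length and
  leave room for one more step up to \<open>M\<close>, exceeding the height.\<close>

lemma minimal_prime_of_height_eq_length:
  assumes "cring R" and xs: "regular_sequence R xs" "set xs \<subseteq> M" and M: "primeideal M R"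
    and ht: "prime_height R M = enat (length xs)"
  shows "minimal_prime R (Idl\<^bsub>R\<^esub> (set xs)) M"
proof -
  interpret cring R by fact
  interpret M: primeideal M R by fact
  have c: "set xs \<subseteq> carrier R" using xs(1) by (simp add: regular_sequence_def)
  show ?thesis
    unfolding minimal_prime_def
  proof (intro conjI allI impI M)
    show "Idl\<^bsub>R\<^esub> (set xs) \<subseteq> M" using xs(2) by (rule genideal_minimal[OF M.is_ideal])
    fix Q assume Q: "primeideal Q R \<and> Idl\<^bsub>R\<^esub> (set xs) \<subseteq> Q \<and> Q \<subseteq> M"
    show "Q = M"
    proof (rule ccontr)
      assume "Q \<noteq> M"
      have "set xs \<subseteq> Q" using genideal_self[OF c] Q by (meson order_trans)
      then have "prime_chain R (length xs) Q" using Q by (intro regular_sequence_prime_chain[OF xs(1)]) auto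
      then have "prime_chain R (Suc (length xs)) M" using M Q \<open>Q \<noteq> M\<close> by (intro prime_chain_Suc) auto
      then have "enat (Suc (length xs)) \<le> prime_height R M"
        unfolding prime_height_eq_Sup by (intro Sup_upper) auto
      then show False unfolding ht by simp
    qed
  qed
qed

lemma not_cohen_macaulay:
  fixes \<C> :: "(int \<times> int) set set"
  assumes fin: "finite \<C>" "\<C> \<subseteq> cells" and X: "contains_x_pentomino \<C>"
  shows "\<not> cohen_macaulay (mpoly_ring (\<Union>\<C>) Quot (I_adj \<C> :: (int \<times> int, 'k::field) mpoly set))"
proof
  let ?V = "\<Union>\<C>"
  let ?S = "mpoly_ring (\<Union>\<C>) :: (int \<times> int, 'k) mpoly ring"
  let ?I = "I_adj \<C> :: (int \<times> int, 'k) mpoly set"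
  let ?R = "?S Quot ?I"
  let ?P = "lattice_prime \<C> :: (int \<times> int, 'k) mpoly set"
  let ?m = "order_ge ?V 1 :: (int \<times> int, 'k) mpoly set"
  assume CM: "cohen_macaulay ?R"
  note c = corners[OF fin]
  have noeth: "noetherian_ring ?R" using CM by (simp add: cohen_macaulay_def)
  interpret S: cring ?S by (rule cring_mpoly_ring)
  interpret I: ideal ?I ?S by (rule I_adj_ideal)
  interpret R: cring ?R by (rule I.quotient_is_cring[OF S.is_cring])
  define \<pi> where "\<pi> = (\<lambda>x. ?I +>\<^bsub>?S\<^esub> x)"
  interpret \<pi>: ring_hom_ring ?S ?R \<pi> unfolding \<pi>_def by (rule I.rcos_ring_hom_ring)
  have surj: "carrier ?R = \<pi> ` carrier ?S"
    by (auto simp: \<pi>_def FactRing_def A_RCOSETS_def')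
  have \<pi>_zero: "\<pi> x = \<zero>\<^bsub>?R\<^esub> \<longleftrightarrow> x \<in> ?I" if x: "x \<in> carrier ?S" for x
  proof
    assume "\<pi> x = \<zero>\<^bsub>?R\<^esub>"
    then have "?I +>\<^bsub>?S\<^esub> x = ?I" by (simp add: \<pi>_def FactRing_def)
    then show "x \<in> ?I" using I.rcos_const_imp_mem[OF x] by simp
  next
    assume "x \<in> ?I"
    then show "\<pi> x = \<zero>\<^bsub>?R\<^esub>" by (simp add: \<pi>_def FactRing_def I.a_rcos_const)
  qed
  have \<pi>_add: "\<pi> (x + y) = \<pi> x \<oplus>\<^bsub>?R\<^esub> \<pi> y" if "x \<in> carrier ?S" "y \<in> carrier ?S" for x y
    using \<pi>.hom_add[OF that] by simp
  have \<pi>_mult: "\<pi> (x * y) = \<pi> x \<otimes>\<^bsub>?R\<^esub> \<pi> y" if "x \<in> carrier ?S" "y \<in> carrier ?S" for x y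
    using \<pi>.hom_mult[OF that] by simp
  have \<pi>_eq: "x - y \<in> ?I" if "\<pi> x = \<pi> y" "x \<in> carrier ?S" "y \<in> carrier ?S" for x y
  proof -
    have d: "x - y \<in> carrier ?S" using that by (intro diff_carrier)
    have "\<pi> x = \<pi> (x - y) \<oplus>\<^bsub>?R\<^esub> \<pi> y" using \<pi>_add[OF d that(3)] by simp
    then have "\<pi> (x - y) = \<zero>\<^bsub>?R\<^esub>" using that d by (simp add: R.add.l_cancel_one')
    then show ?thesis using \<pi>_zero[OF d] by simp
  qed
  have I_sub_m: "?I \<subseteq> ?m" using I_adj_order_ge order_ge_antimono[of 1 2] by (rule order_trans) simp
  have image_memD: "f \<in> J" if f: "\<pi> f \<in> \<pi> ` J" "f \<in> carrier ?S" and J: "ideal J ?S" "?I \<subseteq> J" for f J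
  proof -
    obtain g where g: "g \<in> J" "\<pi> f = \<pi> g" using f(1) by blast
    have "g \<in> carrier ?S" using mpoly_idealD(1)[OF J(1)] g(1) by blast
    from \<pi>_eq[OF g(2) f(2) this] have "f - g \<in> J" using J(2) by blast
    from mpoly_idealD(3)[OF J(1) this g(1)] show ?thesis by simp
  qed
  have image_ideal: "ideal (\<pi> ` J) ?R" if J: "ideal J ?S" for J
  proof (rule idealI_cring[OF R.is_cring])
    show "\<pi> ` J \<subseteq> carrier ?R" using mpoly_idealD(1)[OF J] surj by blast
    have "\<pi> 0 = \<zero>\<^bsub>?R\<^esub>" using \<pi>_zero[OF zero_carrier] mpoly_idealD(2)[OF I_adj_ideal] by simp
    then show "\<zero>\<^bsub>?R\<^esub> \<in> \<pi> ` J" using mpoly_idealD(2)[OF J] by (metis imageI)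
  next
    fix x y assume "x \<in> \<pi> ` J" "y \<in> \<pi> ` J"
    then obtain x' y' where *: "x' \<in> J" "y' \<in> J" "x = \<pi> x'" "y = \<pi> y'" by blast
    then have "x \<oplus>\<^bsub>?R\<^esub> y = \<pi> (x' + y')" using mpoly_idealD(1)[OF J] by (subst \<pi>_add) auto
    then show "x \<oplus>\<^bsub>?R\<^esub> y \<in> \<pi> ` J" using mpoly_idealD(3)[OF J *(1,2)] by simp
  next
    fix r x assume r: "r \<in> carrier ?R" and "x \<in> \<pi> ` J"
    then obtain r' x' where *: "r' \<in> carrier ?S" "r = \<pi> r'" "x' \<in> J" "x = \<pi> x'" using surj by auto
    then have "r \<otimes>\<^bsub>?R\<^esub> x = \<pi> (r' * x')" using mpoly_idealD(1)[OF J] by (subst \<pi>_mult) auto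
    then show "r \<otimes>\<^bsub>?R\<^esub> x \<in> \<pi> ` J" using mpoly_idealD(4)[OF J *(1,3)] by simp
  qed
  define M where "M = \<pi> ` ?m"
  have one_m: "1 \<notin> ?m" by (rule one_notin_prime[OF irrelevant_prime])
  have M_mem: "\<pi> f \<in> M \<longleftrightarrow> f \<in> ?m" if "f \<in> carrier ?S" for f
    using image_memD[OF _ that order_ge_ideal I_sub_m] by (auto simp: M_def)
  have one_M: "\<one>\<^bsub>?R\<^esub> \<notin> M" using M_mem[OF one_carrier] one_m \<pi>.hom_one by simp
  have max: "maximalideal M ?R"
  proof (rule maximalidealI)
    show "ideal M ?R" unfolding M_def by (rule image_ideal[OF order_ge_ideal])
    show "carrier ?R \<noteq> M" using one_M R.one_closed by metis
    fix L assume L: "ideal L ?R" "M \<subseteq> L" "L \<subseteq> carrier ?R"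
    interpret L: ideal L ?R by fact
    show "L = M \<or> L = carrier ?R"
    proof (cases "L \<subseteq> M")
      case True then show ?thesis using L(2) by blast
    next
      case False
      then obtain y where y: "y \<in> L" "y \<notin> M" by blast
      then obtain f where f: "f \<in> carrier ?S" "y = \<pi> f" using L(3) surj by blast
      then have fm: "f \<notin> ?m" using M_mem y by blast
      let ?c = "Poly_Mapping.lookup f 0"
      have c0: "?c \<noteq> 0" using f(1) fm unfolding irrelevant_eq by simp
      define g where "g = const ?c - f"
      have g: "g \<in> ?m"
        using f(1) unfolding irrelevant_eq g_def by (simp add: lookup_minus diff_carrier const_carrier)
      have "\<pi> g \<in> L" using g L(2) by (auto simp: M_def)
      then have "\<pi> g \<oplus>\<^bsub>?R\<^esub> \<pi> f \<in> L" using y f L.a_closed by blast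
      then have "\<pi> (const ?c) \<in> L"
        using \<pi>_add[OF order_ge_carrier[OF g] f(1)] by (simp add: g_def)
      then have "\<pi> (const (inverse ?c)) \<otimes>\<^bsub>?R\<^esub> \<pi> (const ?c) \<in> L"
        by (rule L.I_l_closed[OF _ \<pi>.hom_closed[OF const_carrier]])
      then have "\<pi> (const (inverse ?c) * const ?c) \<in> L"
        using \<pi>_mult[OF const_carrier const_carrier] by simp
      then have "\<one>\<^bsub>?R\<^esub> \<in> L" using c0 \<pi>.hom_one by (simp add: mult_single)
      then show ?thesis using L.one_imp_carrier by simp
    qed
  qed
  have M_prime: "primeideal M ?R" by (rule R.maximalideal_prime[OF max])

  \<comment> \<open>Each of finitely many generators of the lattice prime modulo \<open>?I\<close>
    is killed by a monomial, so the product \<open>z\<close> of these monomials kills the whole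
    image. Since the lattice prime contains no monomial, that image is exactly the annihilator of
    \<open>z\<close>.\<close>
  have "ideal (\<pi> ` ?P) ?R" by (rule image_ideal[OF tker_ideal])
  from noetherian_ring.finetely_gen[OF noeth this]
  obtain A where A: "A \<subseteq> carrier ?R" "finite A" "\<pi> ` ?P = Idl\<^bsub>?R\<^esub> A" by auto
  have AP: "A \<subseteq> \<pi> ` ?P" using R.genideal_self[OF A(1)] A(3) by simp
  have "\<exists>m. Poly_Mapping.keys m \<subseteq> ?V \<and> (\<exists>f\<in>carrier ?S. a = \<pi> f \<and> Poly_Mapping.single m 1 * f \<in> ?I)" if a: "a \<in> A" for a
  proof -
    obtain f where f: "f \<in> ?P" "a = \<pi> f" using AP a by blast
    have "f \<in> saturation ?V ?I" using f(1) by (rule subsetD[OF lattice_prime_subset_saturation[OF c(1)]])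
    then show ?thesis using f(2) unfolding saturation_def by blast
  qed
  then obtain \<mu> where \<mu>: "\<And>a. a \<in> A \<Longrightarrow> Poly_Mapping.keys (\<mu> a) \<subseteq> ?V"
    "\<And>a. a \<in> A \<Longrightarrow> \<exists>f\<in>carrier ?S. a = \<pi> f \<and> Poly_Mapping.single (\<mu> a) 1 * f \<in> ?I" by metis
  define \<nu> where "\<nu> = (\<Sum>a\<in>A. \<mu> a)"
  have keys_sum_\<mu>: "Poly_Mapping.keys (\<Sum>a\<in>B. \<mu> a) \<subseteq> ?V" if "B \<subseteq> A" for B
    using finite_subset[OF that A(2)] that \<mu>(1) by (induction B) (auto simp: keys_plus_nat)
  let ?z' = "Poly_Mapping.single \<nu> 1 :: (int \<times> int, 'k) mpoly"
  have z'c: "?z' \<in> carrier ?S" unfolding \<nu>_def using keys_sum_\<mu>[of A] by (intro single_carrier) simp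
  define z where "z = \<pi> ?z'"
  have zc: "z \<in> carrier ?R" using z'c surj by (simp add: z_def)
  have colon_z: "\<pi> f \<in> R.colon {\<zero>\<^bsub>?R\<^esub>} z \<longleftrightarrow> f * ?z' \<in> ?I" if f: "f \<in> carrier ?S" for f
    using f z'c surj \<pi>_zero[OF times_carrier[OF f z'c]] \<pi>_mult[OF f z'c] by (simp add: R.colon_def z_def)
  have "A \<subseteq> R.colon {\<zero>\<^bsub>?R\<^esub>} z"
  proof
    fix a assume a: "a \<in> A"
    obtain f where f: "f \<in> carrier ?S" "a = \<pi> f" "Poly_Mapping.single (\<mu> a) 1 * f \<in> ?I" using \<mu>(2)[OF a] by blast
    have "\<nu> = \<mu> a + (\<Sum>b\<in>A - {a}. \<mu> b)" unfolding \<nu>_def by (rule sum.remove[OF A(2) a])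
    then have "f * ?z' = Poly_Mapping.single (\<Sum>b\<in>A - {a}. \<mu> b) 1 * (Poly_Mapping.single (\<mu> a) 1 * f)"
      by (simp add: mult_single mult.assoc[symmetric] ac_simps)
    also have "\<dots> \<in> ?I"
      using keys_sum_\<mu>[of "A - {a}"] by (intro mpoly_idealD(4)[OF I_adj_ideal _ f(3)] single_carrier) auto
    finally show "a \<in> R.colon {\<zero>\<^bsub>?R\<^esub>} z" using colon_z[OF f(1)] f(2) by simp
  qed
  then have "Idl\<^bsub>?R\<^esub> A \<subseteq> R.colon {\<zero>\<^bsub>?R\<^esub>} z"
    by (rule R.genideal_minimal[OF R.ideal_colon[OF R.zeroideal zc]])
  then have P_sub: "\<pi> ` ?P \<subseteq> R.colon {\<zero>\<^bsub>?R\<^esub>} z" using A(3) by simp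
  have sub_P: "f \<in> ?P" if f: "f \<in> carrier ?S" "\<pi> f \<in> R.colon {\<zero>\<^bsub>?R\<^esub>} z" for f
  proof -
    have "f * ?z' \<in> ?I" using colon_z[OF f(1)] f(2) by simp
    then have "f \<otimes>\<^bsub>?S\<^esub> ?z' \<in> ?P" using I_adj_subset_lattice_prime[OF c(1)] by auto
    from primeideal.I_prime[OF tker_prime f(1) z'c this] show ?thesis
      using monomial_notin_tker by blast
  qed
  have Pc: "?P \<subseteq> carrier ?S" by (rule mpoly_idealD(1)[OF tker_ideal])
  have pre_P: "{f \<in> carrier ?S. \<pi> f \<in> R.colon {\<zero>\<^bsub>?R\<^esub>} z} = ?P"
    using sub_P P_sub Pc by blast
  have colon_M: "R.colon {\<zero>\<^bsub>?R\<^esub>} z \<subseteq> M"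
  proof
    fix y assume y: "y \<in> R.colon {\<zero>\<^bsub>?R\<^esub>} z"
    then have "y \<in> carrier ?R" by (simp add: R.colon_def)
    then obtain f where f: "f \<in> carrier ?S" "y = \<pi> f" using surj by blast
    then have "f \<in> ?m" using subsetD[OF lattice_prime_irrelevant[OF c(1)] sub_P[OF f(1)]] y by simp
    then show "y \<in> M" using f(2) by (simp add: M_def)
  qed
  \<comment> \<open>Pulled back, the chain of a regular sequence starts at the lattice prime, below
    which there are already \<open>card \<C>\<close> steps.\<close>
  have depth_le: "length ys + card \<C> \<le> card ?V" if ys: "regular_sequence ?R ys" "set ys \<subseteq> M" for ys
  proof -
    obtain C where C: "nzd_chain ?R (length ys) (R.colon {\<zero>\<^bsub>?R\<^esub>} z) C" "C \<subseteq> M"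
      using R.regular_sequence_nzd_chain[OF noeth M_prime zc colon_M ys] by blast
    have ch: "nzd_chain ?S (length ys) ?P {r \<in> carrier ?S. \<pi> r \<in> C}"
      using nzd_chain_vimage[OF \<pi>.is_ring_hom_ring surj C(1)] pre_P by simp
    have "nzd_chain ?S (length (cell_pivots (corners \<C>))) (tker ?V {} []) (tker ?V {} ([] @ cell_pivots (corners \<C>)))"
      using triangular_cell_pivots[OF c(1)] cell_pivots_binom(1)[OF c(1)] by (intro tker_nzd_chain) auto
    then have "nzd_chain ?S (card \<C> + length ys) (tker ?V {} []) {r \<in> carrier ?S. \<pi> r \<in> C}"
      using nzd_chain_trans[OF _ ch] by (simp add: length_cell_pivots c(2))
    moreover have "1 \<notin> {r \<in> carrier ?S. \<pi> r \<in> C}" using C(2) one_M \<pi>.hom_one by auto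
    ultimately have "card \<C> + length ys \<le> card ?V" by (rule nzd_chain_length_le[OF c(3)])
    then show ?thesis by simp
  qed

  have Idl_empty: "Idl\<^bsub>?R\<^esub> {} \<subseteq> {\<zero>\<^bsub>?R\<^esub>}" by (rule R.genideal_minimal[OF R.zeroideal]) simp
  have "regular_sequence ?R []"
  proof -
    have "\<zero>\<^bsub>?R\<^esub> \<in> M" using additive_subgroup.zero_closed[OF ideal.axioms(1)[OF maximalideal.axioms(1)[OF max]]] .
    have "\<one>\<^bsub>?R\<^esub> \<notin> Idl\<^bsub>?R\<^esub> {}"
    proof
      assume "\<one>\<^bsub>?R\<^esub> \<in> Idl\<^bsub>?R\<^esub> {}"
      from singletonD[OF subsetD[OF Idl_empty this]] show False using one_M \<open>\<zero>\<^bsub>?R\<^esub> \<in> M\<close> by simp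
    qed
    then have "Idl\<^bsub>?R\<^esub> {} \<noteq> carrier ?R" using R.one_closed by metis
    then show ?thesis by (simp add: regular_sequence_def)
  qed
  then obtain ys where ys: "regular_sequence ?R ys" "set ys \<subseteq> M" "ideal_depth ?R M = enat (length ys)"
  proof (rule ideal_depth_attained)
    fix xs assume "regular_sequence ?R xs" "set xs \<subseteq> M"
    from depth_le[OF this] show "length xs \<le> card ?V" by simp
  qed
  \<comment> \<open>Here depth equals height by the Cohen-Macaulay hypothesis, which makes
    \<open>ys\<close> a system of parameters at \<open>M\<close>.\<close>
  have "prime_height ?R M = enat (length ys)"
    using CM max ys(3) by (simp add: cohen_macaulay_def)
  from minimal_prime_of_height_eq_length[OF R.is_cring ys(1,2) M_prime this]
  have minp: "minimal_prime ?R (Idl\<^bsub>?R\<^esub> (set ys)) M" .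
  have ysc: "set ys \<subseteq> carrier ?R" using ys(1) by (simp add: regular_sequence_def)
  \<comment> \<open>Modulo the full sequence the growth is bounded. Dropping its elements from the
    end raises the exponent by one each, until \<open>J 0\<close>, contained in \<open>?I\<close>,
    is reached with exponent \<open>length ys\<close>.\<close>
  define J where "J k = {r \<in> carrier ?S. \<pi> r \<in> Idl\<^bsub>?R\<^esub> (set (take k ys))}" for k
  have Idl_ideal: "ideal (Idl\<^bsub>?R\<^esub> (set (take k ys))) ?R" for k
    using ysc set_take_subset[of k ys] by (intro R.genideal_ideal) auto
  have J_ideal: "ideal (J k) ?S" for k
    unfolding J_def by (rule \<pi>.ideal_vimage[OF Idl_ideal])
  have "growth_le ?V (J (length ys)) 0"
  proof (rule growth_le_zero[OF c(3) J_ideal])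
    fix v assume v: "v \<in> ?V"
    have vm: "mvar v \<in> ?m" using v by (simp add: mvar_def order_ge_def single_carrier)
    note vc = order_ge_carrier[OF vm]
    obtain g and n :: nat where g: "g \<in> carrier ?R" "g \<notin> M" "g \<otimes>\<^bsub>?R\<^esub> \<pi> (mvar v) [^]\<^bsub>?R\<^esub> n \<in> Idl\<^bsub>?R\<^esub> (set ys)"
      using R.minimal_prime_nilpotent[OF R.genideal_ideal[OF ysc] minp, of "\<pi> (mvar v)"] vm by (auto simp: M_def)
    obtain g' where g': "g' \<in> carrier ?S" "g = \<pi> g'" using g(1) surj by blast
    have "\<pi> (mvar v) [^]\<^bsub>?R\<^esub> n = \<pi> (mvar v ^ n)" using \<pi>.hom_nat_pow[OF vc, of n] by (simp add: mpoly_nat_pow)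
    then have "\<pi> (g' * mvar v ^ n) \<in> Idl\<^bsub>?R\<^esub> (set ys)"
      using g(3) \<pi>_mult[OF g'(1) power_carrier[OF vc]] g'(2) by simp
    then have "g' * mvar v ^ n \<in> J (length ys)"
      using g' vc by (simp add: J_def times_carrier power_carrier)
    then show "\<exists>g n. g \<in> carrier ?S \<and> g \<notin> ?m \<and> g * mvar v ^ n \<in> J (length ys)"
      using g' g(2) M_mem by blast
  qed
  moreover have "growth_le ?V (J k) (Suc q)" if k: "k < length ys" and gr: "growth_le ?V (J (Suc k)) q" for k q
  proof -
    have "ys ! k \<in> M" using ys(2) k by auto
    then obtain y where y: "y \<in> ?m" "ys ! k = \<pi> y" by (auto simp: M_def)
    note yc = order_ge_carrier[OF y(1)]
    show ?thesis
    proof (rule growth_le_adjoin[OF gr J_ideal y(1)])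
      fix x assume "x \<in> J (Suc k)"
      then have x: "x \<in> carrier ?S" "\<pi> x \<in> Idl\<^bsub>?R\<^esub> (insert (\<pi> y) (set (take k ys)))"
        using k y(2) by (simp_all add: J_def take_Suc_conv_app_nth)
      have "set (take k ys) \<subseteq> carrier ?R" using ysc set_take_subset[of k ys] by blast
      then have "\<pi> x \<in> R.adjoin (Idl\<^bsub>?R\<^esub> (set (take k ys))) (\<pi> y)"
        using R.Idl_insert_subset_adjoin[of "set (take k ys)" "\<pi> y"] x(2) yc surj by blast
      then obtain a r where ar: "a \<in> Idl\<^bsub>?R\<^esub> (set (take k ys))" "r \<in> carrier ?R" "\<pi> x = a \<oplus>\<^bsub>?R\<^esub> r \<otimes>\<^bsub>?R\<^esub> \<pi> y"
        by (rule R.adjoinE)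
      obtain r' where r': "r' \<in> carrier ?S" "r = \<pi> r'" using ar(2) surj by blast
      have rc: "r' * y \<in> carrier ?S" using r' yc by (simp add: times_carrier)
      have dc: "x - r' * y \<in> carrier ?S" using x(1) rc by (rule diff_carrier)
      have ac: "a \<in> carrier ?R" using ideal.Icarr[OF Idl_ideal ar(1)] .
      have "\<pi> (x - r' * y) \<oplus>\<^bsub>?R\<^esub> \<pi> (r' * y) = \<pi> x" using \<pi>_add[OF dc rc] by simp
      also have "\<dots> = a \<oplus>\<^bsub>?R\<^esub> \<pi> (r' * y)" using ar(3) r' \<pi>_mult[OF r'(1) yc] by simp
      finally have "\<pi> (x - r' * y) = a" using ac dc rc surj by (subst (asm) R.add.r_cancel) auto
      then have "x - r' * y \<in> J k" using ar(1) dc by (simp add: J_def)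
      then show "\<exists>a\<in>J k. \<exists>r\<in>carrier ?S. x = a + r * y"
        using r'(1) by (intro bexI[of _ "x - r' * y"] bexI[of _ r']) simp_all
    qed
  qed
  ultimately have "k \<le> length ys \<Longrightarrow> growth_le ?V (J (length ys - k)) k" for k
  proof (induction k)
    case (Suc k)
    have "length ys - Suc k < length ys" "Suc (length ys - Suc k) = length ys - k" using Suc.prems by auto
    then show ?case using Suc by simp
  qed simp
  from this[of "length ys"] have gr: "growth_le ?V (J 0) (length ys)" by simp
  have J0: "J 0 \<subseteq> ?I" using Idl_empty \<pi>_zero by (auto simp: J_def)
  obtain Z K where ZK: "Z \<subseteq> ?V" "K \<subseteq> corners \<C>" "\<And>x. x \<in> K \<Longrightarrow> cell (fst x) (snd x) \<subseteq> ?V - Z"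
    "card Z + card K < card \<C>" "?I \<subseteq> tker ?V Z (cell_pivots K)"
    using exists_small_prime[OF fin X] by blast
  \<comment> \<open>The dimension of the toric quotient is bounded by \<open>length ys\<close>, and
    that by \<open>card ?V - card \<C>\<close>; this contradicts
    \<open>card Z + card K < card \<C>\<close>.\<close>
  have "card (free_vars ?V Z K) \<le> length ys"
    by (rule growth_le_tker[OF c(3) finite_subset[OF ZK(2) c(1)] order_trans[OF J0 ZK(5)] gr])
  moreover have "card (free_vars ?V Z K) + card Z + card K = card ?V"
    using ZK(3) by (rule card_free_vars[OF c(3) ZK(1)])
  ultimately show False using depth_le[OF ys(1,2)] ZK(4) by simp
qed

theorem lemma3p3:
  fixes \<C> :: "(int \<times> int) set set"
    and I :: "(int \<times> int, 'k::field) mpoly set"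
  assumes "finite \<C>" and "\<C> \<noteq> {}" and "\<C> \<subseteq> cells" and "weakly_connected \<C>"
    and "I = I_adj \<C>"
    and "complete_intersection (mpoly_ring (\<Union>\<C>)) I
       \<or> gorenstein (\<Union>\<C>) I
       \<or> level (\<Union>\<C>) I
       \<or> cohen_macaulay (mpoly_ring (\<Union>\<C>) Quot I)
       \<or> unmixed (mpoly_ring (\<Union>\<C>)) I"
  shows "\<not> contains_x_pentomino \<C>"
proof
  assume X: "contains_x_pentomino \<C>"
  have "complete_intersection (mpoly_ring (\<Union>\<C>)) I \<or> cohen_macaulay (mpoly_ring (\<Union>\<C>) Quot I)
      \<or> unmixed (mpoly_ring (\<Union>\<C>)) I"
    using assms(6) unfolding gorenstein_def level_def by argo
  then show False
    using not_complete_intersection[OF assms(1,3) X, where ?'k = 'k]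
      not_cohen_macaulay[OF assms(1,3) X, where ?'k = 'k]
      not_unmixed[OF assms(1,3) X, where ?'k = 'k] unfolding assms(5) by argo
qed

end
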